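(* In the setting described in the context, assume that $\{(X_j,Y_j)\}_{j\in\mathbb Z}$ is a stationary, $\beta$-mixing time series with $\alpha$-mixing coefficients $\alpha(j)=\mathcal O(j^{-\eta})$ for some $\eta>2$ and $\beta$-mixing coefficients $\beta(j)=\mathcal O(j^{-\nu})$ for some $\nu>0$, and that $F^x$ is continuous. Assume moreover: (C1) $u\mapsto 1/\gamma(u)$ is Lipschitz continuous on $U$ with constant $c_\gamma$; (C3) there exist $y_0>1$ and $c_L>0$ such that $\sup_{y\ge y_0}\left|\frac{\log L^{v}(y)-\log L^{u}(y)}{\log y}\right|\le c_L|v-u|$ for all $u,v\in U$; (C6) for any $s,t>0$ there exists a finite constant $M^x(s,t)$, not depending on $j$ ($j\ge1$), such that $\mathbb E[1_{\{Y_0>su_n\}}1_{\{Y_j>tu_n\}}\mid X_0=x+h_nw_1,X_j=x+h_nw_2]/\overline F^x(u_n)\to M^x(s,t)$ uniformly in $w_1,w_2\in[-1,1]$; (C6') for $A>0$ there exists a finite constant $\widetilde M^x$, not depending on $j$ ($j\ge1$), such that $\mathbb E[\log_+(\tfrac{Y_0}{u_nA})\log_+(\tfrac{Y_j}{u_nA})\mid X_0=x+h_nw_1,X_j=x+h_nw_2]/\overline F^x(u_n)\to\widetilde M^x$ uniformly in $w_1,w_2\in[-1,1]$; where (C6) and (C6') are assumed for all intermediate sequences $k_n$ (with $u_n=F^{\leftarrow,x}(1-k_n/n)$) and bandwidths $h_n>0$ with $h_n\log(u_n)\to0$ and $k_nh_n\to\infty$; (S) there exist $c_x>0$ and $\zeta_x$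 with $\zeta_x\gamma(x)>1$ such that $\sup_{t\ge1}t^{\zeta_x}\left|\overline F^x(t)-c_xt^{-1/\gamma(x)}\right|<\infty$. Then there exist sequences $\{(k_n,h_n,r_n,\ell_n),n\in\mathbb N\}$ (with $k_n$, $r_n$, $\ell_n$ intermediate, $h_n>0$, and $u_n=F^{\leftarrow,x}(1-k_n/n)$) such that all of the following hold as $n\to\infty$: (i) $h_n\log(u_n)\to0$; (ii) $nh_n\overline F^x(u_n)=k_nh_n\to\infty$; (iii) $r_nh_n\overline F^x(u_n)=r_nh_nk_n/n\to0$; (iv) $\lim1/\ell_n=\lim\ell_n/r_n=\lim r_n/n=\lim(n/r_n)\beta_{\ell_n}=0$; (v) $\sqrt{k_nh_n}\{g(x)-g_n(x)\}\to0$ in probability; (vi) there exists $s_0\in(0,1)$ such that $\sqrt{k_nh_n}\,B_n^x(s_0)\to0$; (vii) $\sqrt{k_nh_n}\int_1^\infty\frac{\mathbb E[\widetilde V_n^x(t)]-t^{-1/\gamma(x)}g(x)}{t}\,dt\to0$; (viii) for all $s,t>0$, $\lim_{m\to\infty}\limsup_{n\to\infty}\sum_{j=m}^{r_n}\frac{\mathbb E[K_{n,0}1_{\{Y_0>su_n\}}K_{n,j}1_{\{Y_j>tu_n\}}]}{h_n\overline F^x(u_n)}=0$; (ix) for all $A>0$, $\lim_{m\to\infty}\limsup_{n\to\infty}\sum_{j=m}^{r_n}\frac{\mathbb E[K_{n,0}K_{n,j}\log_+(\frac{Y_0}{u_nA})\log_+(\frac{Y_j}{u_nA})]}{h_n\overline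 F^x(u_n)}=0$.
   Context: $\{(X_j,Y_j)\}_{j\in\mathbb Z}$ is a stationary time series of real random variables with $Y_j>0$. $X_0$ has a twice continuously differentiable density $g$, and for all $i\neq j$ the pair $(X_i,X_j)$ has a joint density which is bounded. $F^u$ denotes the conditional distribution function of $Y_0$ given $X_0=u$ and $\overline F^u=1-F^u$. $U\subseteq\mathbb R$ is open and $x\in U$ is fixed with $g(x)>0$. Conditional regular variation: for all $u\in U$, $\overline F^u(y)=L^u(y)y^{-1/\gamma(u)}$ for $y>0$, where $\gamma(u)>0$ and $L^u$ is slowly varying at infinity. $K$ is a bounded probability density supported on $[-1,1]$. An integer sequence $a_n\le n$ is called intermediate if $a_n\to\infty$ and $a_n/n\to0$. $F^{\leftarrow,x}$ is the generalised inverse of $F^x$. For given $k_n,h_n$ and $u_n=F^{\leftarrow,x}(1-k_n/n)$ put $K_{n,j}=K\left(\frac{x-X_j}{h_n}\right)$, $g_n(x)=\frac1{nh_n}\sum_{j=1}^nK_{n,j}$, $\widetilde V_n^x(s)=\frac{1}{nh_n\overline F^x(u_n)}\sum_{j=1}^nK_{n,j}1_{\{Y_j>su_n\}}$, and $B_n^x(s_0)=\sup_{t\ge s_0}|\mathbb E[\widetilde V_n^x(t)]-t^{-1/\gamma(x)}g(x)|$. Mixing coefficients: with $\mathcal F_a^b=\sigma((X_j,Y_j):a\le j\le b)$, $\alpha(n)=\sup\{|\Pr(A\cap B)-\Pr(A)\Pr(B)|:A\in\mathcal F_{-\infty}^0,B\in\mathcal F_n^\infty\}$ and $\beta(n)=\beta_n=\sup\frac12\sum_i\sum_j|\Pr(A_i\cap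 B_j)-\Pr(A_i)\Pr(B_j)|$ over all finite partitions $(A_i)\subset\mathcal F_{-\infty}^0$, $(B_j)\subset\mathcal F_n^\infty$ of the sample space; $\beta$-mixing means $\beta(n)\to0$.
   Formalization: The joint densities of the pairs (X_i,X_j), i≠j, are assumed bounded by one constant common to all pairs; with bounds allowed to depend on the lag, the claim (viii) can fail. *)

theory Defs
  imports "HOL-Probability.Probability" "HOL-Library.Landau_Symbols"
begin

section \<open>Processes indexed by the integers and mixing\<close>

definition strictly_stationary :: "'a measure \<Rightarrow> (int \<Rightarrow> 'a \<Rightarrow> 'b::topological_space) \<Rightarrow> bool" where
  "strictly_stationary M Z \<longleftrightarrow>
     (\<forall>m. distr M (\<Pi>\<^sub>M j\<in>UNIV. borel) (\<lambda>\<omega> j. Z (j + m) \<omega>)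
        = distr M (\<Pi>\<^sub>M j\<in>UNIV. borel) (\<lambda>\<omega> j. Z j \<omega>))"

definition gen_events :: "'a measure \<Rightarrow> (int \<Rightarrow> 'a \<Rightarrow> 'b::topological_space) \<Rightarrow> int set \<Rightarrow> 'a set set" where
  "gen_events M Z J =
     sigma_sets (space M) {Z j -` A \<inter> space M | j A. j \<in> J \<and> A \<in> sets borel}"

definition alpha_coeff :: "'a measure \<Rightarrow> (int \<Rightarrow> 'a \<Rightarrow> 'b::topological_space) \<Rightarrow> nat \<Rightarrow> real" where
  "alpha_coeff M Z n =
     Sup {\<bar>measure M (A \<inter> B) - measure M A * measure M B\<bar> | A B.
            A \<in> gen_events M Z {..0} \<and> B \<in> gen_events M Z {int n..}}"

definition beta_coeff :: "'a measure \<Rightarrow> (int \<Rightarrow> 'a \<Rightarrow> 'b::topological_space) \<Rightarrow> nat \<Rightarrow> real" where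
  "beta_coeff M Z n =
     Sup {1 / 2 * (\<Sum>A\<in>P. \<Sum>B\<in>Q. \<bar>measure M (A \<inter> B) - measure M A * measure M B\<bar>) | P Q.
            finite P \<and> partition_on (space M) P \<and> P \<subseteq> gen_events M Z {..0} \<and>
            finite Q \<and> partition_on (space M) Q \<and> Q \<subseteq> gen_events M Z {int n..}}"

definition tends_to_zero_in_prob :: "'a measure \<Rightarrow> (nat \<Rightarrow> 'a \<Rightarrow> real) \<Rightarrow> bool" where
  "tends_to_zero_in_prob M Z \<longleftrightarrow>
     (\<forall>\<epsilon>>0. (\<lambda>n. measure M {\<omega> \<in> space M. \<bar>Z n \<omega>\<bar> > \<epsilon>}) \<longlonglongrightarrow> 0)"

section \<open>Densities and conditional distributions\<close>

definition twice_cont_diff :: "(real \<Rightarrow> real) \<Rightarrow> bool" where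
  "twice_cont_diff g \<longleftrightarrow>
     (\<exists>g' g''. (\<forall>u. (g has_real_derivative g' u) (at u)) \<and>
               (\<forall>u. (g' has_real_derivative g'' u) (at u)) \<and> continuous_on UNIV g'')"

text \<open>
  The bound on the joint densities is common to all pairs of indices, so that it covers
  all lags of a stationary series simultaneously.
\<close>

definition bounded_joint_densities :: "'a measure \<Rightarrow> (int \<Rightarrow> 'a \<Rightarrow> real) \<Rightarrow> bool" where
  "bounded_joint_densities M X \<longleftrightarrow>
     (\<exists>C. \<forall>i j. i \<noteq> j \<longrightarrow>
        (\<exists>f. (\<forall>p. 0 \<le> f p \<and> f p \<le> C) \<and>
             distributed M (lborel \<Otimes>\<^sub>M lborel) (\<lambda>\<omega>. (X i \<omega>, X j \<omega>)) (\<lambda>p. ennreal (f p))))"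

text \<open>
  \<open>\<kappa> u\<close> is the law of \<open>Z\<close> given \<open>W = u\<close>. Pointwise statements about conditional laws refer
  to the fixed version \<open>\<kappa>\<close>.
\<close>

definition regular_cond_law ::
    "'a measure \<Rightarrow> ('a \<Rightarrow> 'b::topological_space) \<Rightarrow> ('a \<Rightarrow> 'c::topological_space)
      \<Rightarrow> ('b \<Rightarrow> 'c measure) \<Rightarrow> bool" where
  "regular_cond_law M W Z \<kappa> \<longleftrightarrow>
     \<kappa> \<in> borel \<rightarrow>\<^sub>M prob_algebra borel \<and>
     (\<forall>A\<in>sets borel. \<forall>B\<in>sets borel.
        measure M {\<omega> \<in> space M. W \<omega> \<in> A \<and> Z \<omega> \<in> B}
          = (LINT \<omega>|M. indicator A (W \<omega>) * measure (\<kappa> (W \<omega>)) B))"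

definition cond_cdf :: "(real \<Rightarrow> real measure) \<Rightarrow> real \<Rightarrow> real \<Rightarrow> real" where
  "cond_cdf \<kappa> u y = cdf (\<kappa> u) y"

definition cond_tail :: "(real \<Rightarrow> real measure) \<Rightarrow> real \<Rightarrow> real \<Rightarrow> real" where
  "cond_tail \<kappa> u y = 1 - cond_cdf \<kappa> u y"

definition gen_inverse :: "(real \<Rightarrow> real) \<Rightarrow> real \<Rightarrow> real" where
  "gen_inverse F p = Inf {y. p \<le> F y}"

definition slowly_varying :: "(real \<Rightarrow> real) \<Rightarrow> bool" where
  "slowly_varying L \<longleftrightarrow>
     L \<in> borel_measurable (restrict_space borel {0<..}) \<and>
     (\<forall>\<^sub>F y in at_top. L y > 0) \<and>
     (\<forall>t>0. ((\<lambda>y. L (t * y) / L y) \<longlongrightarrow> 1) at_top)"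

text \<open>On \<open>z > 0\<close> this is \<open>max (ln z) 0\<close>; it avoids the values of \<open>ln\<close> at negative arguments.\<close>

definition log_plus :: "real \<Rightarrow> real" where
  "log_plus z = ln (max 1 z)"

section \<open>Kernel estimators\<close>

definition bounded_kernel :: "(real \<Rightarrow> real) \<Rightarrow> bool" where
  "bounded_kernel K \<longleftrightarrow>
     K \<in> borel_measurable borel \<and> (\<forall>z. 0 \<le> K z) \<and> (\<exists>C. \<forall>z. K z \<le> C) \<and>
     (\<forall>z. z \<notin> {-1..1} \<longrightarrow> K z = 0) \<and> (K has_integral 1) UNIV"

definition intermediate :: "(nat \<Rightarrow> nat) \<Rightarrow> bool" where
  "intermediate a \<longleftrightarrow>
     (\<forall>n. a n \<le> n) \<and> filterlim a at_top sequentially \<and> (\<lambda>n. real (a n) / real n) \<longlonglongrightarrow> 0"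

definition u_seq :: "(real \<Rightarrow> real measure) \<Rightarrow> real \<Rightarrow> (nat \<Rightarrow> nat) \<Rightarrow> nat \<Rightarrow> real" where
  "u_seq \<kappa> x k n = gen_inverse (cond_cdf \<kappa> x) (1 - real (k n) / real n)"

definition kernel_weight ::
    "(real \<Rightarrow> real) \<Rightarrow> real \<Rightarrow> (nat \<Rightarrow> real) \<Rightarrow> (int \<Rightarrow> 'a \<Rightarrow> real) \<Rightarrow> nat \<Rightarrow> int \<Rightarrow> 'a \<Rightarrow> real" where
  "kernel_weight K x h X n j \<omega> = K ((x - X j \<omega>) / h n)"

definition density_estimator ::
    "(real \<Rightarrow> real) \<Rightarrow> real \<Rightarrow> (nat \<Rightarrow> real) \<Rightarrow> (int \<Rightarrow> 'a \<Rightarrow> real) \<Rightarrow> nat \<Rightarrow> 'a \<Rightarrow> real" where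
  "density_estimator K x h X n \<omega> =
     1 / (real n * h n) * (\<Sum>j=1..int n. kernel_weight K x h X n j \<omega>)"

definition tail_estimator ::
    "(real \<Rightarrow> real) \<Rightarrow> (real \<Rightarrow> real measure) \<Rightarrow> real \<Rightarrow> (nat \<Rightarrow> nat) \<Rightarrow> (nat \<Rightarrow> real)
      \<Rightarrow> (int \<Rightarrow> 'a \<Rightarrow> real) \<Rightarrow> (int \<Rightarrow> 'a \<Rightarrow> real) \<Rightarrow> nat \<Rightarrow> real \<Rightarrow> 'a \<Rightarrow> real" where
  "tail_estimator K \<kappa> x k h X Y n s \<omega> =
     1 / (real n * h n * cond_tail \<kappa> x (u_seq \<kappa> x k n)) *
       (\<Sum>j=1..int n. kernel_weight K x h X n j \<omega> * indicator {s * u_seq \<kappa> x k n<..} (Y j \<omega>))"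

definition tail_bias ::
    "'a measure \<Rightarrow> (real \<Rightarrow> real) \<Rightarrow> (real \<Rightarrow> real measure) \<Rightarrow> (real \<Rightarrow> real) \<Rightarrow> (real \<Rightarrow> real) \<Rightarrow> real
      \<Rightarrow> (nat \<Rightarrow> nat) \<Rightarrow> (nat \<Rightarrow> real) \<Rightarrow> (int \<Rightarrow> 'a \<Rightarrow> real) \<Rightarrow> (int \<Rightarrow> 'a \<Rightarrow> real) \<Rightarrow> nat \<Rightarrow> real \<Rightarrow> real" where
  "tail_bias M K \<kappa> \<gamma> g x k h X Y n t =
     (LINT \<omega>|M. tail_estimator K \<kappa> x k h X Y n t \<omega>) - t powr (- (1 / \<gamma> x)) * g x"

definition sup_tail_bias ::
    "'a measure \<Rightarrow> (real \<Rightarrow> real) \<Rightarrow> (real \<Rightarrow> real measure) \<Rightarrow> (real \<Rightarrow> real) \<Rightarrow> (real \<Rightarrow> real) \<Rightarrow> real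
      \<Rightarrow> (nat \<Rightarrow> nat) \<Rightarrow> (nat \<Rightarrow> real) \<Rightarrow> (int \<Rightarrow> 'a \<Rightarrow> real) \<Rightarrow> (int \<Rightarrow> 'a \<Rightarrow> real) \<Rightarrow> nat \<Rightarrow> real \<Rightarrow> real" where
  "sup_tail_bias M K \<kappa> \<gamma> g x k h X Y n s\<^sub>0 = (SUP t\<in>{s\<^sub>0..}. \<bar>tail_bias M K \<kappa> \<gamma> g x k h X Y n t\<bar>)"

definition admissible_bandwidth ::
    "(real \<Rightarrow> real measure) \<Rightarrow> real \<Rightarrow> (nat \<Rightarrow> nat) \<Rightarrow> (nat \<Rightarrow> real) \<Rightarrow> bool" where
  "admissible_bandwidth \<kappa> x k h \<longleftrightarrow>
     intermediate k \<and> (\<forall>n. h n > 0) \<and>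
     (\<lambda>n. h n * ln (u_seq \<kappa> x k n)) \<longlonglongrightarrow> 0 \<and>
     filterlim (\<lambda>n. real (k n) * h n) at_top sequentially"

text \<open>
  \<open>\<kappa>\<^sub>2 j\<close> is the law of \<open>(Y\<^sub>0, Y\<^sub>j)\<close> given \<open>(X\<^sub>0, X\<^sub>j)\<close>. The limiting constants are quantified
  before the lag \<open>j\<close>, and the uniform limit is taken for each lag separately. In the second
  condition integrability is required because a Bochner integral that does not exist has
  the value 0.
\<close>

definition joint_exceedance_condition ::
    "(real \<Rightarrow> real measure) \<Rightarrow> (nat \<Rightarrow> real \<times> real \<Rightarrow> (real \<times> real) measure) \<Rightarrow> real \<Rightarrow> bool" where
  "joint_exceedance_condition \<kappa> \<kappa>\<^sub>2 x \<longleftrightarrow>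
     (\<forall>k h. admissible_bandwidth \<kappa> x k h \<longrightarrow>
       (\<forall>s>0. \<forall>t>0. \<exists>C::real. \<forall>j\<ge>1.
          uniform_limit ({-1..1} \<times> {-1..1})
            (\<lambda>n (w\<^sub>1, w\<^sub>2).
               (LINT (y\<^sub>0, y\<^sub>j)|\<kappa>\<^sub>2 j (x + h n * w\<^sub>1, x + h n * w\<^sub>2).
                  indicator {s * u_seq \<kappa> x k n<..} y\<^sub>0 * indicator {t * u_seq \<kappa> x k n<..} y\<^sub>j)
               / cond_tail \<kappa> x (u_seq \<kappa> x k n))
            (\<lambda>_. C) sequentially))"

definition joint_log_excess_condition ::
    "(real \<Rightarrow> real measure) \<Rightarrow> (nat \<Rightarrow> real \<times> real \<Rightarrow> (real \<times> real) measure) \<Rightarrow> real \<Rightarrow> bool" where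
  "joint_log_excess_condition \<kappa> \<kappa>\<^sub>2 x \<longleftrightarrow>
     (\<forall>k h. admissible_bandwidth \<kappa> x k h \<longrightarrow>
       (\<forall>A>0. \<exists>C::real. \<forall>j\<ge>1.
          (\<forall>\<^sub>F n in sequentially. \<forall>w\<^sub>1\<in>{-1..1}. \<forall>w\<^sub>2\<in>{-1..1}.
             integrable (\<kappa>\<^sub>2 j (x + h n * w\<^sub>1, x + h n * w\<^sub>2))
               (\<lambda>(y\<^sub>0, y\<^sub>j). log_plus (y\<^sub>0 / (u_seq \<kappa> x k n * A)) * log_plus (y\<^sub>j / (u_seq \<kappa> x k n * A)))) \<and>
          uniform_limit ({-1..1} \<times> {-1..1})
            (\<lambda>n (w\<^sub>1, w\<^sub>2).
               (LINT (y\<^sub>0, y\<^sub>j)|\<kappa>\<^sub>2 j (x + h n * w\<^sub>1, x + h n * w\<^sub>2).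
                  log_plus (y\<^sub>0 / (u_seq \<kappa> x k n * A)) * log_plus (y\<^sub>j / (u_seq \<kappa> x k n * A)))
               / cond_tail \<kappa> x (u_seq \<kappa> x k n))
            (\<lambda>_. C) sequentially))"

end

theory Submission
  imports Defs "HOL-Real_Asymp.Real_Asymp"
begin

text \<open>
  The sequences are polynomial: \<open>k\<close>, \<open>h\<close>, \<open>r\<close>, \<open>l\<close> are of order \<open>n powr (1 - a)\<close>,
  \<open>n powr (- (1 - a - e))\<close>, \<open>n powr (1 - 2 * e)\<close> and \<open>n powr (1 - 3 * e)\<close>, with small
  positive \<open>a\<close> and \<open>e\<close>. Hence \<open>k h\<close> is about \<open>n powr e\<close>: the effective sample size diverges, but so
  slowly that the biases, which are polynomially small, vanish after multiplication by \<open>sqrt (k h)\<close>.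

  \<^bold>\<open>Bias.\<close> Both the tail index and the slowly varying factor are Lipschitz in the covariate on the
  logarithmic scale, so on the window \<open>\<bar>v - x\<bar> \<le> h\<close> the conditional tail at \<open>v\<close> differs from that at \<open>x\<close>
  by a factor \<open>exp (O (h ln u))\<close>. The second-order expansion at \<open>x\<close> adds a relative error
  \<open>u powr (- (\<zeta> - \<alpha>))\<close>, where \<open>\<alpha> = 1 / \<gamma> x\<close>. The sum \<open>h ln u + u powr (- (\<zeta> - \<alpha>))\<close> bounds the bias of
  the tail estimator at level \<open>t\<close> up to a factor \<open>t powr (- \<alpha> / 2)\<close> (\<open>scaled_tail_error\<close>,
  \<open>local_tail_mean\<close>), which gives the uniform and the integrated bias statements at once
  (\<open>tail_bias_limits\<close>).

  \<^bold>\<open>Dependence.\<close> Write \<open>\<phi> = k / n\<close> for the tail probability at the threshold. Every sum over lags is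
  split at a lag \<open>p\<close>. Up to \<open>p\<close>, two observations both fall into the window with probability \<open>O (h\<^sup>2)\<close>,
  because the joint densities are bounded; relative to \<open>h \<phi>\<close> these lags cost \<open>p h / \<phi>\<close>. This is small
  since \<open>h\<close> is much smaller than \<open>\<phi>\<close>. Beyond \<open>p\<close>, a covariance is at most a multiple of \<open>\<alpha>(d)\<close>
  (\<open>covariance_le_alpha_coeff\<close>), and \<open>(\<Sum>d>p. d powr (- \<eta>))\<close> is of order at most
  \<open>p powr (- \<eta> / 2)\<close>, to be compared with \<open>h \<phi>\<close>, which is \<open>n powr (- (1 - e))\<close>. Taking \<open>p\<close> of order
  \<open>n powr (2 / \<eta>)\<close> makes the second cost vanish, and leaves room for the first one exactly because
  \<open>2 / \<eta> < 1\<close>; this is the place where \<open>\<eta> > 2\<close> enters. The same splitting bounds the variance of the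
  density estimator (\<open>kernel_sum_variance_le\<close>) and the joint exceedances (\<open>joint_exceedance_sum_lim\<close>).

  \<^bold>\<open>Logarithmic excesses.\<close> A log-excess has exponential tails, so truncating it at a level \<open>T\<close> of order
  \<open>ln n\<close> changes the sums by a negative power of \<open>n\<close>, while the truncated products are at most \<open>T\<^sup>2\<close>
  times joint exceedances. As all the estimates above gain a power of \<open>n\<close>, the factor \<open>T\<^sup>2\<close> is
  harmless (\<open>log_excess_product_expectation\<close>, \<open>log_excess_sum_lim\<close>).
\<close>

section \<open>Kernel averages\<close>

lemma bounded_kernelE:
  assumes "bounded_kernel K"
  obtains B where "B > 0" "\<And>z. 0 \<le> K z" "\<And>z. K z \<le> B" "K \<in> borel_measurable borel"
    "\<And>z. \<bar>z\<bar> > 1 \<Longrightarrow> K z = 0" "(K has_integral 1) UNIV"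
proof -
  from assms obtain C where C: "\<And>z. K z \<le> C" unfolding bounded_kernel_def by blast
  have "K z \<le> max C 1" for z using C[of z] by linarith
  moreover have "K z = 0" if "\<bar>z\<bar> > 1" for z
  proof -
    have "z \<notin> {-1..1}" using that by auto
    then show ?thesis using assms unfolding bounded_kernel_def by blast
  qed
  ultimately show thesis using assms by (intro that[of "max C 1"]) (auto simp: bounded_kernel_def)
qed

lemma kernel_has_bochner_integral:
  assumes "bounded_kernel K"
  shows "has_bochner_integral lborel K 1"
proof -
  obtain B where B: "B > 0" "\<And>z. 0 \<le> K z" "\<And>z. K z \<le> B" "K \<in> borel_measurable borel"
    "\<And>z. \<bar>z\<bar> > 1 \<Longrightarrow> K z = 0" "(K has_integral 1) UNIV" using bounded_kernelE[OF assms] by metis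
  have "integrable lborel (\<lambda>z::real. B * indicator {-1..1} z :: real)"
    by (intro integrable_mult_right integrable_real_indicator) auto
  then have i: "integrable lborel K"
    by (rule Bochner_Integration.integrable_bound) (use B in \<open>auto simp: indicator_def\<close>)
  then have "(K has_integral (integral\<^sup>L lborel K)) UNIV" by (rule has_integral_integral_lborel)
  then have "integral\<^sup>L lborel K = 1" using B(6) has_integral_unique by blast
  then show ?thesis using i by (simp add: has_bochner_integral_iff)
qed

lemma kernel_rescaled_has_bochner_integral:
  assumes K: "bounded_kernel K" and h: "h > 0"
  shows "has_bochner_integral lborel (\<lambda>v. K ((x - v) / h)) h"
proof -
  have "has_bochner_integral lborel (\<lambda>w. K (x / h + (- (1 / h)) * w)) (1 /\<^sub>R \<bar>- (1 / h)\<bar>)"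
    using kernel_has_bochner_integral[OF K] h
    by (subst (asm) lborel_has_bochner_integral_real_affine_iff[where c = "- (1 / h)" and t = "x / h"]) auto
  then show ?thesis using h by (simp add: diff_divide_distrib)
qed

lemma kernel_measurable:
  "bounded_kernel K \<Longrightarrow> K \<in> borel_measurable borel"
  by (simp add: bounded_kernel_def)

lemma kernel_eq_0_outside:
  assumes "bounded_kernel K" "h > 0" "\<bar>v - x\<bar> > h"
  shows "K ((x - v) / h) = 0"
proof -
  have "\<bar>(x - v) / h\<bar> > 1" using assms by (simp add: abs_minus_commute)
  then have "(x - v) / h \<notin> {-1..1}" by auto
  then show ?thesis using assms(1) unfolding bounded_kernel_def by blast
qed

text \<open>
  A rescaled kernel has total mass \<open>h\<close> and sees only the window of radius \<open>h\<close>; every bias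
  estimate below is a pointwise estimate on this window fed into this lemma.
\<close>

lemma kernel_average_bound:
  assumes K: "bounded_kernel K" and h: "h > 0" and [measurable]: "\<phi> \<in> borel_measurable borel"
    and B: "\<And>v. \<bar>v - x\<bar> \<le> h \<Longrightarrow> \<bar>\<phi> v\<bar> \<le> B"
  shows "integrable lborel (\<lambda>v. K ((x - v) / h) * \<phi> v)"
    and "\<bar>LINT v|lborel. K ((x - v) / h) * \<phi> v\<bar> \<le> B * h"
proof -
  note [measurable] = kernel_measurable[OF K]
  have K0: "0 \<le> K z" for z using K by (simp add: bounded_kernel_def)
  note I = kernel_rescaled_has_bochner_integral[OF K h, of x]
  have iK: "integrable lborel (\<lambda>v. B * K ((x - v) / h))"
    using I by (intro integrable_mult_right) (simp add: has_bochner_integral_iff)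
  have le: "\<bar>K ((x - v) / h) * \<phi> v\<bar> \<le> B * K ((x - v) / h)" for v
  proof (cases "\<bar>v - x\<bar> \<le> h")
    case True
    have "\<bar>K ((x - v) / h) * \<phi> v\<bar> = K ((x - v) / h) * \<bar>\<phi> v\<bar>" using K0 by (simp add: abs_mult)
    also have "\<dots> \<le> K ((x - v) / h) * B" by (rule mult_left_mono[OF B[OF True] K0])
    finally show ?thesis by (simp only: mult.commute)
  next
    case False
    then have "K ((x - v) / h) = 0" by (intro kernel_eq_0_outside[OF K h]) simp
    then show ?thesis by simp
  qed
  show i: "integrable lborel (\<lambda>v. K ((x - v) / h) * \<phi> v)"
    by (rule Bochner_Integration.integrable_bound[OF iK]) (use order_trans[OF le abs_ge_self] in simp_all)
  have "\<bar>LINT v|lborel. K ((x - v) / h) * \<phi> v\<bar> \<le> (LINT v|lborel. \<bar>K ((x - v) / h) * \<phi> v\<bar>)"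
    by (rule integral_abs_bound)
  also have "\<dots> \<le> (LINT v|lborel. B * K ((x - v) / h))"
    by (rule integral_mono) (use i iK le in auto)
  also have "\<dots> = B * h" using has_bochner_integral_integral_eq[OF I] by simp
  finally show "\<bar>LINT v|lborel. K ((x - v) / h) * \<phi> v\<bar> \<le> B * h" .
qed

section \<open>Covariances of bounded functions under mixing\<close>

text \<open>The layer-cake formula \<open>z = \<integral> 1{s \<le> z} ds\<close> on \<open>[0,1]\<close>, discretised with step \<open>1/N\<close>.\<close>

lemma layer_cake_approx:
  fixes z :: real
  assumes z: "0 \<le> z" "z \<le> 1" and N: "N \<ge> 1"
  shows "\<bar>z - (\<Sum>i=1..N. indicator {real i / real N..} z) / real N\<bar> \<le> 1 / real N"
proof -
  define m where "m = nat \<lfloor>real N * z\<rfloor>"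
  have m1: "real m \<le> real N * z" and m2: "real N * z < real m + 1"
    unfolding m_def using z N by (simp_all add: floor_correct)
  have mN: "m \<le> N"
  proof -
    have "real N * z \<le> real N * 1" by (rule mult_left_mono) (use z in auto)
    then have "real m \<le> real N" using m1 by simp
    then show ?thesis by simp
  qed
  have eq: "indicator {real i / real N..} z = (of_bool (i \<le> m) :: real)" for i :: nat
  proof -
    have "real i / real N \<le> z \<longleftrightarrow> real i \<le> real N * z" using N by (simp add: field_simps)
    also have "\<dots> \<longleftrightarrow> i \<le> m"
    proof
      assume "real i \<le> real N * z"
      then have "real i < real m + 1" using m2 by linarith
      then show "i \<le> m" by linarith
    next
      assume "i \<le> m"
      then have "real i \<le> real m" by simp
      then show "real i \<le> real N * z" using m1 by linarith
    qed
    finally show ?thesis by (simp add: indicator_def)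
  qed
  have "(\<Sum>i=1..N. indicator {real i / real N..} z :: real) = (\<Sum>i=1..N. of_bool (i \<le> m))"
    by (simp only: eq)
  also have "\<dots> = real (card ({1..N} \<inter> {i. i \<le> m}))"
    by (simp add: of_bool_def sum.If_cases)
  also have "{1..N} \<inter> {i. i \<le> m} = {1..m}" using mN by auto
  finally have S: "(\<Sum>i=1..N. indicator {real i / real N..} z :: real) = real m" by simp
  have "z - real m / real N = (real N * z - real m) / real N" using N by (simp add: field_simps)
  moreover have "\<bar>(real N * z - real m) / real N\<bar> \<le> 1 / real N"
    using m1 m2 N by (simp add: divide_simps)
  ultimately show ?thesis unfolding S by simp
qed

text \<open>
  If superlevel sets are almost independent, so are the functions: by the discretised layer-cake
  formula both are, uniformly, averages of indicators of superlevel sets, and the covariance is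
  bilinear.
\<close>

lemma (in prob_space) covariance_le_unit:
  assumes [measurable]: "f1 \<in> borel_measurable M" "f2 \<in> borel_measurable M"
    and f: "\<And>\<omega>. 0 \<le> f1 \<omega>" "\<And>\<omega>. f1 \<omega> \<le> 1" "\<And>\<omega>. 0 \<le> f2 \<omega>" "\<And>\<omega>. f2 \<omega> \<le> 1"
    and mix: "\<And>s t. \<bar>prob ({\<omega>\<in>space M. s \<le> f1 \<omega>} \<inter> {\<omega>\<in>space M. t \<le> f2 \<omega>})
        - prob {\<omega>\<in>space M. s \<le> f1 \<omega>} * prob {\<omega>\<in>space M. t \<le> f2 \<omega>}\<bar> \<le> \<alpha>"
  shows "\<bar>expectation (\<lambda>\<omega>. f1 \<omega> * f2 \<omega>) - expectation f1 * expectation f2\<bar> \<le> \<alpha>"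
proof (rule field_le_epsilon)
  fix e :: real assume e: "e > 0"
  obtain N where N: "N \<ge> 1" "4 / real N \<le> e"
  proof -
    obtain N where "4 / e < real N" using reals_Archimedean2 by blast
    moreover have "0 < 4 / e" using e by simp
    ultimately have N: "real N > 0" by linarith
    then have "4 / real N \<le> e" using \<open>4 / e < real N\<close> e by (simp add: field_simps)
    moreover have "N \<ge> 1" using N by simp
    ultimately have "N \<ge> 1" "4 / real N \<le> e" by auto
    then show thesis by (rule that)
  qed
  define D where "D z = (\<Sum>i=1..N. indicator {real i / real N..} z) / real N" for z :: real
  have Dm [measurable]: "D \<in> borel_measurable borel" unfolding D_def by measurable
  have D01: "0 \<le> D z" "D z \<le> 1" for z
  proof -
    have "(\<Sum>i=1..N. indicator {real i / real N..} z :: real) \<le> (\<Sum>i=1..N. 1)"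
      by (intro sum_mono) (simp add: indicator_def)
    then show "D z \<le> 1" using N unfolding D_def by (simp add: divide_simps)
    show "0 \<le> D z" unfolding D_def by (intro divide_nonneg_nonneg sum_nonneg) auto
  qed
  have D1: "\<bar>f1 \<omega> - D (f1 \<omega>)\<bar> \<le> 1 / real N" and D2: "\<bar>f2 \<omega> - D (f2 \<omega>)\<bar> \<le> 1 / real N" for \<omega>
    unfolding D_def using layer_cake_approx f N by blast+
  have int: "integrable M f" if "f \<in> borel_measurable M" "\<And>\<omega>. \<bar>f \<omega>\<bar> \<le> 1" for f :: "'a \<Rightarrow> real"
    using that by (intro integrable_const_bound[where B=1]) auto
  have I: "integrable M f1" "integrable M f2" "integrable M (\<lambda>\<omega>. D (f1 \<omega>))" "integrable M (\<lambda>\<omega>. D (f2 \<omega>))"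
    "integrable M (\<lambda>\<omega>. f1 \<omega> * f2 \<omega>)" "integrable M (\<lambda>\<omega>. D (f1 \<omega>) * D (f2 \<omega>))"
    using f D01 by (auto intro!: int simp: abs_mult mult_le_one)
  have near: "\<bar>expectation u - expectation v\<bar> \<le> c"
    if "integrable M u" "integrable M v" "\<And>\<omega>. \<bar>u \<omega> - v \<omega>\<bar> \<le> c" for u v :: "'a \<Rightarrow> real" and c
  proof -
    have "\<bar>expectation (\<lambda>\<omega>. u \<omega> - v \<omega>)\<bar> \<le> expectation (\<lambda>\<omega>. \<bar>u \<omega> - v \<omega>\<bar>)" by (rule integral_abs_bound)
    also have "\<dots> \<le> expectation (\<lambda>_. c)" by (rule integral_mono) (use that in auto)
    finally show ?thesis using that by (simp add: prob_space)
  qed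
  have prod_near: "\<bar>a * b - a' * b'\<bar> \<le> 2 / real N"
    if "\<bar>a - a'\<bar> \<le> 1 / real N" "\<bar>b - b'\<bar> \<le> 1 / real N" "0 \<le> a" "a \<le> 1" "0 \<le> b'" "b' \<le> 1" for a b a' b'
  proof -
    have "a * b - a' * b' = a * (b - b') + (a - a') * b'" by (simp add: algebra_simps)
    moreover have "\<bar>a * (b - b')\<bar> \<le> 1 * (1 / real N)"
      unfolding abs_mult by (rule mult_mono) (use that in auto)
    moreover have "\<bar>(a - a') * b'\<bar> \<le> (1 / real N) * 1"
      unfolding abs_mult by (rule mult_mono) (use that in auto)
    ultimately show ?thesis by linarith
  qed
  have E01: "0 \<le> expectation u" "expectation u \<le> 1" if "integrable M u" "\<And>\<omega>. 0 \<le> u \<omega>" "\<And>\<omega>. u \<omega> \<le> 1" for u :: "'a \<Rightarrow> real"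
    using that integral_mono[OF that(1), of "\<lambda>_. 1"] by (auto simp: prob_space)
  have e1: "\<bar>expectation (\<lambda>\<omega>. f1 \<omega> * f2 \<omega>) - expectation (\<lambda>\<omega>. D (f1 \<omega>) * D (f2 \<omega>))\<bar> \<le> 2 / real N"
    by (rule near[OF I(5,6)]) (intro prod_near D1 D2 f D01)
  have e2: "\<bar>expectation f1 * expectation f2 - expectation (\<lambda>\<omega>. D (f1 \<omega>)) * expectation (\<lambda>\<omega>. D (f2 \<omega>))\<bar> \<le> 2 / real N"
    by (intro prod_near near I D1 D2 E01 f D01)
  define A where "A i = {\<omega>\<in>space M. real i / real N \<le> f1 \<omega>}" for i :: nat
  define A' where "A' i = {\<omega>\<in>space M. real i / real N \<le> f2 \<omega>}" for i :: nat
  have [measurable]: "A i \<in> events" "A' i \<in> events" for i unfolding A_def A'_def by measurable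
  have int_ind: "integrable M (indicator E :: 'a \<Rightarrow> real)" if "E \<in> events" for E
    using that by (intro integrable_real_indicator) (auto simp: emeasure_eq_measure)
  have ind: "D (f1 \<omega>) = (\<Sum>i=1..N. indicator (A i) \<omega>) / real N"
    "D (f2 \<omega>) = (\<Sum>i=1..N. indicator (A' i) \<omega>) / real N" if "\<omega> \<in> space M" for \<omega>
    unfolding D_def A_def A'_def using that by (auto simp: indicator_def)
  have "expectation (\<lambda>\<omega>. D (f1 \<omega>)) = expectation (\<lambda>\<omega>. (\<Sum>i=1..N. indicator (A i) \<omega>) / real N)"
    by (rule Bochner_Integration.integral_cong) (auto simp: ind)
  also have "\<dots> = (\<Sum>i=1..N. prob (A i)) / real N"
    by (simp add: Bochner_Integration.integral_sum int_ind del: One_nat_def)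
  finally have m1: "expectation (\<lambda>\<omega>. D (f1 \<omega>)) = (\<Sum>i=1..N. prob (A i)) / real N" .
  have "expectation (\<lambda>\<omega>. D (f2 \<omega>)) = expectation (\<lambda>\<omega>. (\<Sum>i=1..N. indicator (A' i) \<omega>) / real N)"
    by (rule Bochner_Integration.integral_cong) (auto simp: ind)
  also have "\<dots> = (\<Sum>i=1..N. prob (A' i)) / real N"
    by (simp add: Bochner_Integration.integral_sum int_ind del: One_nat_def)
  finally have m2: "expectation (\<lambda>\<omega>. D (f2 \<omega>)) = (\<Sum>i=1..N. prob (A' i)) / real N" .
  have "expectation (\<lambda>\<omega>. D (f1 \<omega>) * D (f2 \<omega>))
      = expectation (\<lambda>\<omega>. (\<Sum>i=1..N. \<Sum>j=1..N. indicator (A i \<inter> A' j) \<omega>) / (real N * real N))"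
    by (rule Bochner_Integration.integral_cong)
       (auto simp: ind sum_product indicator_inter_arith)
  also have "\<dots> = (\<Sum>i=1..N. \<Sum>j=1..N. prob (A i \<inter> A' j)) / (real N * real N)"
    by (simp add: Bochner_Integration.integral_sum int_ind del: One_nat_def)
  finally have m12: "expectation (\<lambda>\<omega>. D (f1 \<omega>) * D (f2 \<omega>)) = (\<Sum>i=1..N. \<Sum>j=1..N. prob (A i \<inter> A' j)) / (real N * real N)" .
  have "\<bar>expectation (\<lambda>\<omega>. D (f1 \<omega>) * D (f2 \<omega>)) - expectation (\<lambda>\<omega>. D (f1 \<omega>)) * expectation (\<lambda>\<omega>. D (f2 \<omega>))\<bar>
     = \<bar>\<Sum>i=1..N. \<Sum>j=1..N. prob (A i \<inter> A' j) - prob (A i) * prob (A' j)\<bar> / (real N * real N)"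
    unfolding m1 m2 m12 by (simp add: sum_product sum_subtractf diff_divide_distrib[symmetric] abs_divide)
  also have "\<dots> \<le> (\<Sum>i=1..N. \<Sum>j=1..N. \<alpha>) / (real N * real N)"
  proof (intro divide_right_mono order_trans[OF sum_abs] sum_mono)
    show "\<bar>prob (A i \<inter> A' j) - prob (A i) * prob (A' j)\<bar> \<le> \<alpha>" for i j
      unfolding A_def A'_def by (rule mix)
  qed auto
  also have "\<dots> = \<alpha>" using N by simp
  finally have "\<bar>expectation (\<lambda>\<omega>. D (f1 \<omega>) * D (f2 \<omega>)) - expectation (\<lambda>\<omega>. D (f1 \<omega>)) * expectation (\<lambda>\<omega>. D (f2 \<omega>))\<bar> \<le> \<alpha>" .
  then show "\<bar>expectation (\<lambda>\<omega>. f1 \<omega> * f2 \<omega>) - expectation f1 * expectation f2\<bar> \<le> \<alpha> + e"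
    using e1 e2 N(2) by (simp add: abs_le_iff)
qed

lemma alpha_coeff_upper:
  fixes Z :: "int \<Rightarrow> 'a \<Rightarrow> 'b::topological_space"
  assumes M: "prob_space M"
    and A: "A \<in> gen_events M Z {..0}" and B: "B \<in> gen_events M Z {int n..}"
  shows "\<bar>measure M (A \<inter> B) - measure M A * measure M B\<bar> \<le> alpha_coeff M Z n"
proof -
  interpret prob_space M by (rule M)
  have "\<bar>measure M (A \<inter> B) - measure M A * measure M B\<bar> \<le> 1" for A B
  proof -
    have "0 \<le> prob A * prob B" "prob A * prob B \<le> 1" by (auto simp: mult_le_one)
    moreover have "0 \<le> prob (A \<inter> B)" "prob (A \<inter> B) \<le> 1" by auto
    ultimately show ?thesis by linarith
  qed
  then have "bdd_above {\<bar>measure M (A \<inter> B) - measure M A * measure M B\<bar> | A B.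
            A \<in> gen_events M Z {..0} \<and> B \<in> gen_events M Z {int n..}}"
    by (auto intro!: bdd_aboveI[where M=1])
  then show ?thesis unfolding alpha_coeff_def by (rule cSup_upper[rotated]) (use A B in blast)
qed

lemma gen_events_vimage:
  assumes "j \<in> J" "\<phi> \<in> borel_measurable borel"
  shows "{\<omega> \<in> space M. (s::real) \<le> \<phi> (Z j \<omega>)} \<in> gen_events M Z J"
proof -
  have "{z. s \<le> \<phi> z} \<in> sets borel" using assms(2) by measurable
  moreover have "{\<omega> \<in> space M. s \<le> \<phi> (Z j \<omega>)} = Z j -` {z. s \<le> \<phi> z} \<inter> space M" by auto
  ultimately show ?thesis unfolding gen_events_def using assms(1) by (intro sigma_sets.Basic) blast
qed

lemma covariance_le_alpha_coeff:
  fixes Z :: "int \<Rightarrow> 'a \<Rightarrow> 'b::topological_space" and \<phi> \<psi> :: "'b \<Rightarrow> real"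
  assumes M: "prob_space M" and Z [measurable]: "\<And>j. Z j \<in> borel_measurable M"
    and \<phi>\<psi> [measurable]: "\<phi> \<in> borel_measurable borel" "\<psi> \<in> borel_measurable borel"
    and B: "B > 0" "\<And>z. 0 \<le> \<phi> z" "\<And>z. \<phi> z \<le> B" "\<And>z. 0 \<le> \<psi> z" "\<And>z. \<psi> z \<le> B"
  shows "\<bar>(LINT \<omega>|M. \<phi> (Z 0 \<omega>) * \<psi> (Z (int d) \<omega>)) - (LINT \<omega>|M. \<phi> (Z 0 \<omega>)) * (LINT \<omega>|M. \<psi> (Z (int d) \<omega>))\<bar>
     \<le> B\<^sup>2 * alpha_coeff M Z d"
proof -
  interpret prob_space M by (rule M)
  have "\<bar>expectation (\<lambda>\<omega>. (\<phi> (Z 0 \<omega>) / B) * (\<psi> (Z (int d) \<omega>) / B))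
      - expectation (\<lambda>\<omega>. \<phi> (Z 0 \<omega>) / B) * expectation (\<lambda>\<omega>. \<psi> (Z (int d) \<omega>) / B)\<bar> \<le> alpha_coeff M Z d"
  proof (rule covariance_le_unit)
    fix s t
    show "\<bar>prob ({\<omega>\<in>space M. s \<le> \<phi> (Z 0 \<omega>) / B} \<inter> {\<omega>\<in>space M. t \<le> \<psi> (Z (int d) \<omega>) / B})
        - prob {\<omega>\<in>space M. s \<le> \<phi> (Z 0 \<omega>) / B} * prob {\<omega>\<in>space M. t \<le> \<psi> (Z (int d) \<omega>) / B}\<bar>
        \<le> alpha_coeff M Z d"
      by (rule alpha_coeff_upper[OF M]) (rule gen_events_vimage; simp)+
  qed (use B in \<open>auto simp: divide_simps\<close>)
  then have "\<bar>(expectation (\<lambda>\<omega>. \<phi> (Z 0 \<omega>) * \<psi> (Z (int d) \<omega>))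
      - expectation (\<lambda>\<omega>. \<phi> (Z 0 \<omega>)) * expectation (\<lambda>\<omega>. \<psi> (Z (int d) \<omega>)))\<bar> / B\<^sup>2 \<le> alpha_coeff M Z d"
    using B(1) by (simp add: power2_eq_square diff_divide_distrib[symmetric] abs_divide)
  then show ?thesis using B(1) by (simp add: divide_le_eq mult.commute)
qed

section \<open>Stationarity\<close>

lemma strictly_stationary_marginal:
  fixes Z :: "int \<Rightarrow> 'a \<Rightarrow> 'b::topological_space"
  assumes st: "strictly_stationary M Z" and Z [measurable]: "\<And>j. Z j \<in> borel_measurable M"
  shows "distr M borel (Z j) = distr M borel (Z 0)"
proof -
  have [measurable]: "(\<lambda>\<omega> i. Z (f i) \<omega>) \<in> M \<rightarrow>\<^sub>M (\<Pi>\<^sub>M j\<in>UNIV. borel)" for f :: "int \<Rightarrow> int"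
    by (rule measurable_PiM_single') auto
  have "distr (distr M (\<Pi>\<^sub>M j\<in>UNIV. borel) (\<lambda>\<omega> i. Z (i + j) \<omega>)) borel (\<lambda>f. f 0)
      = distr (distr M (\<Pi>\<^sub>M j\<in>UNIV. borel) (\<lambda>\<omega> i. Z i \<omega>)) borel (\<lambda>f. f 0)"
    using st unfolding strictly_stationary_def by metis
  then show ?thesis by (simp add: distr_distr comp_def)
qed

lemma strictly_stationary_pair:
  fixes Z :: "int \<Rightarrow> 'a \<Rightarrow> 'b::second_countable_topology"
  assumes st: "strictly_stationary M Z" and Z [measurable]: "\<And>j. Z j \<in> borel_measurable M"
  shows "distr M (borel \<Otimes>\<^sub>M borel) (\<lambda>\<omega>. (Z i \<omega>, Z j \<omega>)) = distr M (borel \<Otimes>\<^sub>M borel) (\<lambda>\<omega>. (Z 0 \<omega>, Z (j - i) \<omega>))"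
proof -
  have [measurable]: "(\<lambda>\<omega> i. Z (f i) \<omega>) \<in> M \<rightarrow>\<^sub>M (\<Pi>\<^sub>M j\<in>UNIV. borel)" for f :: "int \<Rightarrow> int"
    by (rule measurable_PiM_single') auto
  have "distr (distr M (\<Pi>\<^sub>M j\<in>UNIV. borel) (\<lambda>\<omega> k. Z (k + i) \<omega>)) (borel \<Otimes>\<^sub>M borel) (\<lambda>f. (f 0, f (j - i)))
      = distr (distr M (\<Pi>\<^sub>M j\<in>UNIV. borel) (\<lambda>\<omega> k. Z k \<omega>)) (borel \<Otimes>\<^sub>M borel) (\<lambda>f. (f 0, f (j - i)))"
    using st unfolding strictly_stationary_def by metis
  then show ?thesis by (simp add: distr_distr comp_def)
qed

section \<open>Integration against a regular conditional law\<close>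

text \<open>
  Weighting \<open>M\<close> with \<open>1{Z \<in> B}\<close>, or with the conditional probability of this event, and pushing forward
  along \<open>W\<close> gives two measures that agree on all Borel sets by definition of a conditional law;
  hence they have the same integrals.
\<close>

lemma regular_cond_law_nn_integral:
  fixes W :: "'a \<Rightarrow> 'b::topological_space" and Z :: "'a \<Rightarrow> 'c::topological_space"
  assumes M: "prob_space M" and \<kappa>: "regular_cond_law M W Z \<kappa>"
    and [measurable]: "W \<in> borel_measurable M" "Z \<in> borel_measurable M" "B \<in> sets borel" "\<phi> \<in> borel_measurable borel"
  shows "(\<integral>\<^sup>+ \<omega>. \<phi> (W \<omega>) * indicator B (Z \<omega>) \<partial>M) = (\<integral>\<^sup>+ \<omega>. \<phi> (W \<omega>) * ennreal (measure (\<kappa> (W \<omega>)) B) \<partial>M)"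
proof -
  interpret prob_space M by (rule M)
  have \<kappa>m: "\<kappa> \<in> borel \<rightarrow>\<^sub>M prob_algebra borel" using \<kappa> by (simp add: regular_cond_law_def)
  then have [measurable]: "(\<lambda>w. measure (\<kappa> w) B) \<in> borel_measurable borel" by measurable
  have le1: "measure (\<kappa> w) B \<le> 1" for w
  proof -
    have "\<kappa> w \<in> space (prob_algebra borel)" using \<kappa>m by (auto simp: measurable_def)
    then interpret k: prob_space "\<kappa> w" by (simp add: space_prob_algebra)
    show ?thesis by (rule k.prob_le_1)
  qed
  let ?\<mu> = "distr (density M (\<lambda>\<omega>. indicator B (Z \<omega>))) borel W"
  let ?\<nu> = "distr (density M (\<lambda>\<omega>. ennreal (measure (\<kappa> (W \<omega>)) B))) borel W"
  have "?\<mu> = ?\<nu>"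
  proof (rule measure_eqI)
    fix A assume "A \<in> sets ?\<mu>"
    then have [measurable]: "A \<in> sets borel" by simp
    have "emeasure ?\<mu> A = (\<integral>\<^sup>+\<omega>. indicator B (Z \<omega>) * indicator (W -` A \<inter> space M) \<omega> \<partial>M)"
      by (subst emeasure_distr) (auto simp: emeasure_density)
    also have "\<dots> = (\<integral>\<^sup>+\<omega>. indicator {\<omega> \<in> space M. W \<omega> \<in> A \<and> Z \<omega> \<in> B} \<omega> \<partial>M)"
      by (rule nn_integral_cong) (auto simp: indicator_def)
    also have "\<dots> = ennreal (measure M {\<omega> \<in> space M. W \<omega> \<in> A \<and> Z \<omega> \<in> B})"
      by (simp add: emeasure_eq_measure)
    also have "measure M {\<omega> \<in> space M. W \<omega> \<in> A \<and> Z \<omega> \<in> B} = (LINT \<omega>|M. indicator A (W \<omega>) * measure (\<kappa> (W \<omega>)) B)"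
      using \<kappa> by (simp add: regular_cond_law_def)
    also have "ennreal \<dots> = (\<integral>\<^sup>+\<omega>. ennreal (indicator A (W \<omega>) * measure (\<kappa> (W \<omega>)) B) \<partial>M)"
      by (rule nn_integral_eq_integral[symmetric], rule integrable_const_bound[where B=1])
         (auto simp: indicator_def le1)
    also have "\<dots> = (\<integral>\<^sup>+\<omega>. ennreal (measure (\<kappa> (W \<omega>)) B) * indicator (W -` A \<inter> space M) \<omega> \<partial>M)"
      by (rule nn_integral_cong) (auto simp: indicator_def)
    also have "\<dots> = emeasure ?\<nu> A"
      by (subst emeasure_distr) (auto simp: emeasure_density)
    finally show "emeasure ?\<mu> A = emeasure ?\<nu> A" .
  qed simp
  then have "(\<integral>\<^sup>+ w. \<phi> w \<partial>?\<mu>) = (\<integral>\<^sup>+ w. \<phi> w \<partial>?\<nu>)" by simp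
  then show ?thesis by (simp add: nn_integral_distr nn_integral_density mult.commute)
qed

section \<open>Tails depending on a covariate\<close>

lemma abs_exp_minus_one_le: "\<bar>exp z - 1\<bar> \<le> \<bar>z\<bar> * exp \<bar>z\<bar>" for z :: real
proof (cases "z \<ge> 0")
  case True
  have "1 - z \<le> exp (- z)" using exp_ge_add_one_self[of "- z"] by simp
  then have "(1 - z) * exp z \<le> exp (- z) * exp z" by (rule mult_right_mono) simp
  then have "exp z - 1 \<le> z * exp z" by (simp add: exp_minus algebra_simps)
  then show ?thesis using True by simp
next
  case False
  have "1 + z \<le> exp z" by (rule exp_ge_add_one_self)
  moreover have "- z * 1 \<le> - z * exp (- z)" using False by (intro mult_left_mono) auto
  ultimately have "1 - exp z \<le> - z * exp (- z)" by linarith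
  then show ?thesis using False by simp
qed

lemma powr_half_decay:
  fixes t :: real
  assumes "0 < s" "s \<le> t" "\<alpha> \<ge> 0"
  shows "t powr (- \<alpha>) \<le> s powr (- \<alpha> / 2) * t powr (- \<alpha> / 2)"
proof -
  have "t powr (- \<alpha> / 2) * t powr (- \<alpha> / 2) \<le> s powr (- \<alpha> / 2) * t powr (- \<alpha> / 2)"
    using assms by (intro mult_right_mono powr_mono2') auto
  then show ?thesis by (simp add: powr_add[symmetric])
qed

text \<open>
  \<open>T v\<close> is the tail function at covariate \<open>v\<close>. The three last assumptions say that tails stay positive
  near \<open>x\<close>, that \<open>v \<mapsto> ln (T v y) / ln y\<close> is Lipschitz at \<open>x\<close> uniformly in \<open>y\<close>, and that \<open>T x\<close> is a power
  tail with a remainder of strictly smaller order.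
\<close>

locale power_tail_family =
  fixes T :: "real \<Rightarrow> real \<Rightarrow> real" and x d c y\<^sub>0 \<alpha> \<zeta> b D :: real
  assumes d_pos: "d > 0" and c_nonneg: "c \<ge> 0" and y0_gt_1: "y\<^sub>0 > 1" and alpha_pos: "\<alpha> > 0"
    and zeta_gt: "\<zeta> > \<alpha>" and b_pos: "b > 0" and D_nonneg: "D \<ge> 0"
    and tail_pos: "\<And>v y. \<bar>v - x\<bar> \<le> d \<Longrightarrow> y \<ge> y\<^sub>0 \<Longrightarrow> T v y > 0"
    and tail_close: "\<And>v y. \<bar>v - x\<bar> \<le> d \<Longrightarrow> y \<ge> y\<^sub>0 \<Longrightarrow> \<bar>ln (T v y) - ln (T x y)\<bar> \<le> c * \<bar>v - x\<bar> * ln y"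
    and tail_second_order: "\<And>y. y \<ge> 1 \<Longrightarrow> \<bar>T x y - b * y powr (- \<alpha>)\<bar> \<le> D * y powr (- \<zeta>)"
begin

lemma tail_at_x_bounds:
  obtains y\<^sub>1 where "y\<^sub>1 \<ge> y\<^sub>0"
    "\<And>y. y \<ge> y\<^sub>1 \<Longrightarrow> b / 2 * y powr (- \<alpha>) \<le> T x y"
    "\<And>y. y \<ge> y\<^sub>1 \<Longrightarrow> T x y \<le> 2 * b * y powr (- \<alpha>)"
proof -
  define y\<^sub>1 where "y\<^sub>1 = max y\<^sub>0 ((2 * D / b) powr (1 / (\<zeta> - \<alpha>)))"
  have *: "D * y powr (- \<zeta>) \<le> b / 2 * y powr (- \<alpha>)" if y: "y \<ge> y\<^sub>1" for y
  proof -
    have y': "y > 1" using y y0_gt_1 unfolding y\<^sub>1_def by linarith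
    have "2 * D / b = ((2 * D / b) powr (1 / (\<zeta> - \<alpha>))) powr (\<zeta> - \<alpha>)"
      using zeta_gt D_nonneg b_pos by (simp add: powr_powr)
    also have "\<dots> \<le> y powr (\<zeta> - \<alpha>)"
      by (rule powr_mono2) (use y zeta_gt in \<open>auto simp: y\<^sub>1_def\<close>)
    finally have "D \<le> b / 2 * y powr (\<zeta> - \<alpha>)" using b_pos by (simp add: field_simps)
    then have "D * y powr (- \<zeta>) \<le> (b / 2 * y powr (\<zeta> - \<alpha>)) * y powr (- \<zeta>)"
      by (rule mult_right_mono) simp
    also have "\<dots> = b / 2 * y powr (- \<alpha>)" by (simp add: powr_add[symmetric])
    finally show ?thesis .
  qed
  show thesis
  proof (rule that)
    show "y\<^sub>1 \<ge> y\<^sub>0" by (simp add: y\<^sub>1_def)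
    fix y assume y: "y \<ge> y\<^sub>1"
    then have "y \<ge> 1" using y0_gt_1 unfolding y\<^sub>1_def by linarith
    from *[OF y] tail_second_order[OF this]
    have e: "\<bar>T x y - b * y powr (- \<alpha>)\<bar> \<le> b / 2 * y powr (- \<alpha>)" by linarith
    have p: "0 \<le> b * y powr (- \<alpha>)" using b_pos by simp
    show "b / 2 * y powr (- \<alpha>) \<le> T x y" using e unfolding abs_le_iff by linarith
    show "T x y \<le> 2 * b * y powr (- \<alpha>)" using e p unfolding abs_le_iff by linarith
  qed
qed

text \<open>
  On a small enough window moving the covariate costs at most a factor \<open>y powr (\<alpha> / 2)\<close>, so half of the
  decay survives for all \<open>y\<close> simultaneously.
\<close>

lemma tail_uniform_bound:
  obtains C \<delta> y\<^sub>1 where "C > 0" "\<delta> > 0" "y\<^sub>1 \<ge> 1"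
    "\<And>v y. \<bar>v - x\<bar> \<le> \<delta> \<Longrightarrow> y \<ge> y\<^sub>1 \<Longrightarrow> T v y \<le> C * y powr (- \<alpha> / 2)"
proof -
  obtain y\<^sub>1 where y1: "y\<^sub>1 \<ge> y\<^sub>0" "\<And>y. y \<ge> y\<^sub>1 \<Longrightarrow> T x y \<le> 2 * b * y powr (- \<alpha>)"
    using tail_at_x_bounds by metis
  define \<delta> where "\<delta> = min d (\<alpha> / 2 / (c + 1))"
  have dl: "\<delta> > 0" "\<delta> \<le> d" "c * \<delta> \<le> \<alpha> / 2"
  proof -
    have "\<delta> \<le> \<alpha> / 2 / (c + 1)" by (simp add: \<delta>_def)
    then have "(c + 1) * \<delta> \<le> \<alpha> / 2" using c_nonneg by (simp add: field_simps)
    moreover show "\<delta> > 0" using d_pos alpha_pos c_nonneg by (simp add: \<delta>_def)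
    ultimately show "c * \<delta> \<le> \<alpha> / 2" by (simp add: algebra_simps)
    show "\<delta> \<le> d" by (simp add: \<delta>_def)
  qed
  show thesis
  proof (rule that[of "2 * b" \<delta> y\<^sub>1])
    fix v y assume v: "\<bar>v - x\<bar> \<le> \<delta>" and y: "y \<ge> y\<^sub>1"
    have y0: "y \<ge> y\<^sub>0" "y > 1" using y y1(1) y0_gt_1 by linarith+
    have pv: "T v y > 0" and px: "T x y > 0" using tail_pos v dl d_pos y0 by auto
    have "c * \<bar>v - x\<bar> \<le> c * \<delta>" using v c_nonneg by (rule mult_left_mono)
    then have "c * \<bar>v - x\<bar> * ln y \<le> \<alpha> / 2 * ln y"
      using dl(3) y0 by (intro mult_right_mono) auto
    moreover have "\<bar>ln (T v y) - ln (T x y)\<bar> \<le> c * \<bar>v - x\<bar> * ln y"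
      using tail_close v dl y0 by auto
    ultimately have "ln (T v y) \<le> ln (T x y) + \<alpha> / 2 * ln y" by linarith
    then have "exp (ln (T v y)) \<le> exp (ln (T x y) + \<alpha> / 2 * ln y)" by simp
    then have "T v y \<le> T x y * y powr (\<alpha> / 2)" using pv px y0 by (simp add: exp_add powr_def)
    also have "\<dots> \<le> 2 * b * y powr (- \<alpha>) * y powr (\<alpha> / 2)"
      by (rule mult_right_mono[OF y1(2)[OF y]]) simp
    also have "\<dots> = 2 * b * y powr (- \<alpha> / 2)" by (simp add: powr_add[symmetric])
    finally show "T v y \<le> 2 * b * y powr (- \<alpha> / 2)" .
  qed (use b_pos dl y1 y0_gt_1 in auto)
qed

text \<open>
  The relative error of \<open>T v (t u)\<close> against \<open>t powr (- \<alpha>) * T x u\<close> has two sources. Moving the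
  covariate from \<open>v\<close> to \<open>x\<close> multiplies the tail by \<open>exp z\<close> with \<open>\<bar>z\<bar> \<le> c h ln (t u)\<close>, which is
  \<open>O (h ln u)\<close> up to a small power of \<open>t\<close>; the second-order expansion at \<open>x\<close> costs
  \<open>u powr (- (\<zeta> - \<alpha>))\<close>. Half of the decay in \<open>t\<close> is kept, which is what makes the bound
  both uniform in \<open>t\<close> and integrable against \<open>dt / t\<close>.
\<close>

lemma scaled_tail_error:
  assumes s0: "0 < s\<^sub>0" "s\<^sub>0 \<le> 1"
  obtains C \<delta> u\<^sub>1 where "C > 0" "\<delta> > 0" "u\<^sub>1 \<ge> exp 1" 
    "\<And>u h v t. u \<ge> u\<^sub>1 \<Longrightarrow> 0 < h \<Longrightarrow> h \<le> \<delta> \<Longrightarrow> h * ln u \<le> \<delta> \<Longrightarrow> \<bar>v - x\<bar> \<le> h \<Longrightarrow> t \<ge> s\<^sub>0 \<Longrightarrow>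
      \<bar>T v (t * u) / T x u - t powr (- \<alpha>)\<bar> \<le> C * (h * ln u + u powr (- (\<zeta> - \<alpha>))) * t powr (- \<alpha> / 2)"
proof -
  obtain y\<^sub>1 where y1: "y\<^sub>1 \<ge> y\<^sub>0" "\<And>y. y \<ge> y\<^sub>1 \<Longrightarrow> b / 2 * y powr (- \<alpha>) \<le> T x y"
    using tail_at_x_bounds by metis
  define \<delta> where "\<delta> = min d (min (\<alpha> / 4 / (c + 1)) (1 / (c + 1)))"
  have dl: "\<delta> > 0" "\<delta> \<le> d" "c * \<delta> \<le> \<alpha> / 4" "c * \<delta> \<le> 1"
  proof -
    have "\<delta> \<le> \<alpha> / 4 / (c + 1)" "\<delta> \<le> 1 / (c + 1)" by (simp_all add: \<delta>_def)
    then have *: "(c + 1) * \<delta> \<le> \<alpha> / 4" "(c + 1) * \<delta> \<le> 1" using c_nonneg by (simp_all add: field_simps)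
    show "\<delta> > 0" using d_pos alpha_pos c_nonneg by (simp add: \<delta>_def)
    with * show "c * \<delta> \<le> \<alpha> / 4" "c * \<delta> \<le> 1" by (simp_all add: algebra_simps)
    show "\<delta> \<le> d" by (simp add: \<delta>_def)
  qed
  define C\<^sub>1 where "C\<^sub>1 = 2 * D / b * (s\<^sub>0 powr (- (\<zeta> - \<alpha>)) + 1)"
  define C\<^sub>2 where "C\<^sub>2 = c * exp 1 * (1 + 4 / \<alpha>) * s\<^sub>0 powr (- \<alpha> / 2)"
  define C where "C = (1 + C\<^sub>1) * C\<^sub>2 + C\<^sub>1 * s\<^sub>0 powr (- \<alpha> / 2) + 1"
  define u\<^sub>1 where "u\<^sub>1 = max (exp 1) (y\<^sub>1 / s\<^sub>0)"
  have C12: "C\<^sub>1 \<ge> 0" "C\<^sub>2 \<ge> 0" using D_nonneg b_pos c_nonneg alpha_pos by (auto simp: C\<^sub>1_def C\<^sub>2_def)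
  show thesis
  proof (rule that[of C \<delta> u\<^sub>1])
    have "0 \<le> (1 + C\<^sub>1) * C\<^sub>2 + C\<^sub>1 * s\<^sub>0 powr (- \<alpha> / 2)" using C12 by auto
    then show "C > 0" unfolding C_def by linarith
    show "\<delta> > 0" by (rule dl)
    show "u\<^sub>1 \<ge> exp 1" by (simp add: u\<^sub>1_def)
    fix u h v t
    assume u: "u \<ge> u\<^sub>1" and h: "0 < h" "h \<le> \<delta>" "h * ln u \<le> \<delta>" and v: "\<bar>v - x\<bar> \<le> h" and t: "t \<ge> s\<^sub>0"
    have ue: "u \<ge> exp 1" and uy: "s\<^sub>0 * u \<ge> y\<^sub>1" using u s0 by (auto simp: u\<^sub>1_def field_simps)
    have e1: "exp 1 > (1::real)" by simp
    have u1: "u > 1" using ue e1 by linarith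
    have lnu: "ln u \<ge> 1" using ue u1 by (simp add: ln_ge_iff)
    have t0: "t > 0" using t s0 by linarith
    have "s\<^sub>0 * u \<le> t * u" using t u1 by (intro mult_right_mono) auto
    then have tu: "t * u \<ge> y\<^sub>1" "t * u \<ge> y\<^sub>0" "t * u > 1" using uy y1 y0_gt_1 by linarith+
    have "s\<^sub>0 * u \<le> 1 * u" using s0 u1 by (intro mult_right_mono) auto
    then have uu: "u \<ge> y\<^sub>1" "u \<ge> y\<^sub>0" using uy y1 by linarith+
    have vd: "\<bar>v - x\<bar> \<le> d" using v h dl by linarith
    have pos: "T x u > 0" "T x (t * u) > 0" "T v (t * u) > 0"
      using tail_pos vd d_pos uu tu by auto
    define e where "e = u powr (- (\<zeta> - \<alpha>))"
    have e01: "0 \<le> e" "e \<le> 1" unfolding e_def using u1 zeta_gt powr_mono[of "- (\<zeta> - \<alpha>)" 0 u] by auto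
    define R where "R = T x (t * u) / T x u"
    define q where "q = T v (t * u) / T x (t * u)"
    have decay: "t powr (- \<alpha>) \<le> s\<^sub>0 powr (- \<alpha> / 2) * t powr (- \<alpha> / 2)"
      using powr_half_decay[OF s0(1) t] alpha_pos by simp
    have R: "\<bar>R - t powr (- \<alpha>)\<bar> \<le> C\<^sub>1 * t powr (- \<alpha>) * e"
    proof -
      have "T x (t * u) - t powr (- \<alpha>) * T x u
          = (T x (t * u) - b * (t * u) powr (- \<alpha>)) - t powr (- \<alpha>) * (T x u - b * u powr (- \<alpha>))"
        using t0 u1 by (simp add: powr_mult algebra_simps)
      also have "\<bar>\<dots>\<bar> \<le> \<bar>T x (t * u) - b * (t * u) powr (- \<alpha>)\<bar> + t powr (- \<alpha>) * \<bar>T x u - b * u powr (- \<alpha>)\<bar>"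
        by (rule order_trans[OF abs_triangle_ineq4]) (simp add: abs_mult)
      also have "\<dots> \<le> D * (t * u) powr (- \<zeta>) + t powr (- \<alpha>) * (D * u powr (- \<zeta>))"
        by (intro add_mono mult_left_mono tail_second_order) (use tu u1 in auto)
      also have "(t * u) powr (- \<zeta>) = t powr (- (\<zeta> - \<alpha>)) * t powr (- \<alpha>) * u powr (- \<zeta>)"
        using t0 u1 by (simp add: powr_mult powr_add[symmetric])
      also have "D * (t powr (- (\<zeta> - \<alpha>)) * t powr (- \<alpha>) * u powr (- \<zeta>)) \<le> D * (s\<^sub>0 powr (- (\<zeta> - \<alpha>)) * t powr (- \<alpha>) * u powr (- \<zeta>))"
        using D_nonneg s0 t zeta_gt by (intro mult_left_mono mult_right_mono powr_mono2') auto
      finally have n: "\<bar>T x (t * u) - t powr (- \<alpha>) * T x u\<bar> \<le> D * (s\<^sub>0 powr (- (\<zeta> - \<alpha>)) + 1) * t powr (- \<alpha>) * u powr (- \<zeta>)"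
        by (simp add: algebra_simps)
      have "R - t powr (- \<alpha>) = (T x (t * u) - t powr (- \<alpha>) * T x u) / T x u"
        unfolding R_def using pos by (simp add: field_simps)
      also have "\<bar>\<dots>\<bar> = \<bar>T x (t * u) - t powr (- \<alpha>) * T x u\<bar> / T x u" using pos by simp
      also have "\<dots> \<le> (D * (s\<^sub>0 powr (- (\<zeta> - \<alpha>)) + 1) * t powr (- \<alpha>) * u powr (- \<zeta>)) / (b / 2 * u powr (- \<alpha>))"
        by (rule frac_le) (use n y1(2)[OF uu(1)] b_pos u1 D_nonneg in auto)
      also have "\<dots> = C\<^sub>1 * t powr (- \<alpha>) * (u powr (- \<zeta>) / u powr (- \<alpha>))"
        unfolding C\<^sub>1_def using b_pos by (simp add: field_simps)
      also have "u powr (- \<zeta>) / u powr (- \<alpha>) = e" unfolding e_def using u1 by (simp add: powr_diff[symmetric])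
      finally show ?thesis .
    qed
    have R': "0 \<le> R" "R \<le> (1 + C\<^sub>1) * t powr (- \<alpha>)"
    proof -
      show "0 \<le> R" unfolding R_def using pos by simp
      have "C\<^sub>1 * t powr (- \<alpha>) * e \<le> C\<^sub>1 * t powr (- \<alpha>) * 1" using C12 e01 by (intro mult_left_mono) auto
      then show "R \<le> (1 + C\<^sub>1) * t powr (- \<alpha>)" using R by (simp add: abs_le_iff algebra_simps)
    qed
    \<comment> \<open>for \<open>t < 1\<close> the factor \<open>ln t\<close> is negative and is replaced by \<open>0\<close>; then powers of \<open>m\<close> cost powers of \<open>t / s\<^sub>0\<close>\<close>
    define m where "m = max 1 t"
    have m1: "m \<ge> 1" by (simp add: m_def)
    have q: "\<bar>q - 1\<bar> \<le> C\<^sub>2 * (h * ln u) * t powr (\<alpha> / 2)"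
    proof -
      define z where "z = ln (T v (t * u)) - ln (T x (t * u))"
      have qz: "q = exp z" unfolding q_def z_def using pos by (simp add: exp_diff)
      have lt: "ln (t * u) \<le> ln m + ln u"
      proof -
        have "t * u \<le> m * u" unfolding m_def using u1 by (intro mult_right_mono) auto
        then have "ln (t * u) \<le> ln (m * u)" using tu by (intro iffD2[OF ln_le_cancel_iff]) auto
        then show ?thesis using u1 m1 by (simp add: ln_mult)
      qed
      have z1: "\<bar>z\<bar> \<le> c * h * ln (t * u)"
      proof -
        have "\<bar>z\<bar> \<le> c * \<bar>v - x\<bar> * ln (t * u)" unfolding z_def by (rule tail_close[OF vd tu(2)])
        also have "\<dots> \<le> c * h * ln (t * u)" using v c_nonneg tu by (intro mult_right_mono mult_left_mono) auto
        finally show ?thesis .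
      qed
      have lm: "ln m \<ge> 0" using m1 by simp
      have ch: "c * h \<le> \<alpha> / 4" "c * (h * ln u) \<le> 1"
        using mult_left_mono[OF h(2) c_nonneg] mult_left_mono[OF h(3) c_nonneg] dl by linarith+
      have ch0: "c * h \<ge> 0" using c_nonneg h by simp
      have z2: "\<bar>z\<bar> \<le> \<alpha> / 4 * ln m + 1"
      proof -
        have "c * h * ln (t * u) \<le> c * h * (ln m + ln u)" by (rule mult_left_mono[OF lt ch0])
        also have "\<dots> \<le> \<alpha> / 4 * ln m + 1" using mult_right_mono[OF ch(1) lm] ch(2) by (simp add: algebra_simps)
        finally show ?thesis using z1 by linarith
      qed
      have z3: "\<bar>z\<bar> \<le> c * (h * ln u) * ((1 + 4 / \<alpha>) * m powr (\<alpha> / 4))"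
      proof -
        have "ln m \<le> m powr (\<alpha> / 4) / (\<alpha> / 4)" using m1 alpha_pos by (intro ln_powr_bound) auto
        moreover have "1 \<le> m powr (\<alpha> / 4)" using m1 alpha_pos by (intro ge_one_powr_ge_zero) auto
        ultimately have l: "1 + ln m \<le> (1 + 4 / \<alpha>) * m powr (\<alpha> / 4)" by (simp add: algebra_simps)
        have "ln m * 1 \<le> ln m * ln u" using lm lnu by (rule mult_left_mono[rotated])
        then have "ln (t * u) \<le> ln u * (1 + ln m)" using lt by (simp add: algebra_simps)
        also have "\<dots> \<le> ln u * ((1 + 4 / \<alpha>) * m powr (\<alpha> / 4))" using l lnu by (intro mult_left_mono) auto
        finally have "c * h * ln (t * u) \<le> c * h * (ln u * ((1 + 4 / \<alpha>) * m powr (\<alpha> / 4)))"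
          by (rule mult_left_mono[OF _ ch0])
        then show ?thesis using z1 by (simp add: mult.assoc)
      qed
      have "\<bar>q - 1\<bar> \<le> \<bar>z\<bar> * exp \<bar>z\<bar>" unfolding qz by (rule abs_exp_minus_one_le)
      also have "\<dots> \<le> (c * (h * ln u) * ((1 + 4 / \<alpha>) * m powr (\<alpha> / 4))) * exp (\<alpha> / 4 * ln m + 1)"
        using z2 z3 by (intro mult_mono) auto
      also have "exp (\<alpha> / 4 * ln m + 1) = m powr (\<alpha> / 4) * exp 1"
        using m1 by (simp add: powr_def exp_add)
      also have "c * (h * ln u) * ((1 + 4 / \<alpha>) * m powr (\<alpha> / 4)) * (m powr (\<alpha> / 4) * exp 1)
          = c * exp 1 * (1 + 4 / \<alpha>) * (h * ln u) * m powr (\<alpha> / 2)"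
        by (simp add: powr_add[symmetric] algebra_simps)
      also have "\<dots> \<le> c * exp 1 * (1 + 4 / \<alpha>) * (h * ln u) * (s\<^sub>0 powr (- \<alpha> / 2) * t powr (\<alpha> / 2))"
      proof (rule mult_left_mono)
        have "m \<le> t / s\<^sub>0" unfolding m_def using s0 t by (auto simp: field_simps)
        then have "m powr (\<alpha> / 2) \<le> (t / s\<^sub>0) powr (\<alpha> / 2)" using m1 alpha_pos by (intro powr_mono2) auto
        also have "\<dots> = s\<^sub>0 powr (- \<alpha> / 2) * t powr (\<alpha> / 2)"
          using s0 t0 by (simp add: powr_divide powr_minus_divide)
        finally show "m powr (\<alpha> / 2) \<le> s\<^sub>0 powr (- \<alpha> / 2) * t powr (\<alpha> / 2)" .
        show "0 \<le> c * exp 1 * (1 + 4 / \<alpha>) * (h * ln u)" using c_nonneg alpha_pos h lnu by simp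
      qed
      also have "\<dots> = C\<^sub>2 * (h * ln u) * t powr (\<alpha> / 2)" unfolding C\<^sub>2_def by (simp add: algebra_simps)
      finally show ?thesis .
    qed
    have "T v (t * u) / T x u = R * q" unfolding R_def q_def using pos by simp
    then have "\<bar>T v (t * u) / T x u - t powr (- \<alpha>)\<bar> = \<bar>R * (q - 1) + (R - t powr (- \<alpha>))\<bar>"
      by (simp add: algebra_simps)
    also have "\<dots> \<le> R * \<bar>q - 1\<bar> + \<bar>R - t powr (- \<alpha>)\<bar>"
      using R'(1) by (intro order_trans[OF abs_triangle_ineq]) (simp add: abs_mult)
    also have "\<dots> \<le> ((1 + C\<^sub>1) * t powr (- \<alpha>)) * (C\<^sub>2 * (h * ln u) * t powr (\<alpha> / 2)) + C\<^sub>1 * t powr (- \<alpha>) * e"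
      by (intro add_mono mult_mono R' q R) (use C12 in auto)
    also have "((1 + C\<^sub>1) * t powr (- \<alpha>)) * (C\<^sub>2 * (h * ln u) * t powr (\<alpha> / 2)) = (1 + C\<^sub>1) * C\<^sub>2 * (h * ln u) * t powr (- \<alpha> / 2)"
      by (simp add: powr_add[symmetric] algebra_simps)
    also have "C\<^sub>1 * t powr (- \<alpha>) * e \<le> C\<^sub>1 * (s\<^sub>0 powr (- \<alpha> / 2) * t powr (- \<alpha> / 2)) * e"
      using decay C12 e01 by (intro mult_right_mono mult_left_mono) auto
    also have "(1 + C\<^sub>1) * C\<^sub>2 * (h * ln u) * t powr (- \<alpha> / 2) + C\<^sub>1 * (s\<^sub>0 powr (- \<alpha> / 2) * t powr (- \<alpha> / 2)) * e
        = ((1 + C\<^sub>1) * C\<^sub>2 * (h * ln u) + C\<^sub>1 * s\<^sub>0 powr (- \<alpha> / 2) * e) * t powr (- \<alpha> / 2)"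
      by (simp add: algebra_simps)
    also have "\<dots> \<le> (C * (h * ln u) + C * e) * t powr (- \<alpha> / 2)"
    proof (intro mult_right_mono add_mono)
      have nn: "0 \<le> (1 + C\<^sub>1) * C\<^sub>2" "0 \<le> C\<^sub>1 * s\<^sub>0 powr (- \<alpha> / 2)" using C12 by auto
      show "(1 + C\<^sub>1) * C\<^sub>2 \<le> C" "C\<^sub>1 * s\<^sub>0 powr (- \<alpha> / 2) \<le> C" unfolding C_def using nn by linarith+
    qed (use h lnu e01 in auto)
    finally show "\<bar>T v (t * u) / T x u - t powr (- \<alpha>)\<bar> \<le> C * (h * ln u + u powr (- (\<zeta> - \<alpha>))) * t powr (- \<alpha> / 2)"
      unfolding e_def by (simp add: algebra_simps)
  qed
qed

text \<open>
  Inverting \<open>T x u \<approx> b u powr (- \<alpha>)\<close>: an upper bound on \<open>u powr (- \<alpha>)\<close> turns the second-order error into a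
  power of the level, and a lower bound on the level shows that \<open>ln u\<close> is at most logarithmic in \<open>n\<close>.
\<close>

lemma quantile_rates:
  obtains C y\<^sub>1 where "C > 0" "\<And>u \<phi>. u \<ge> y\<^sub>1 \<Longrightarrow> T x u = \<phi> \<Longrightarrow> u powr (- (\<zeta> - \<alpha>)) \<le> C * \<phi> powr ((\<zeta> - \<alpha>) / \<alpha>)"
    "\<And>u N. u \<ge> y\<^sub>1 \<Longrightarrow> N \<ge> 2 * b \<Longrightarrow> 1 / N \<le> T x u \<Longrightarrow> ln u \<le> 2 / \<alpha> * ln N"
proof -
  obtain y\<^sub>1 where y1: "y\<^sub>1 \<ge> y\<^sub>0" "\<And>y. y \<ge> y\<^sub>1 \<Longrightarrow> b / 2 * y powr (- \<alpha>) \<le> T x y"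
    "\<And>y. y \<ge> y\<^sub>1 \<Longrightarrow> T x y \<le> 2 * b * y powr (- \<alpha>)"
    using tail_at_x_bounds by metis
  show thesis
  proof (rule that[of "(2 / b) powr ((\<zeta> - \<alpha>) / \<alpha>)" y\<^sub>1])
    show "(2 / b) powr ((\<zeta> - \<alpha>) / \<alpha>) > 0" using b_pos by simp
  next
    fix u \<phi> :: real assume u: "u \<ge> y\<^sub>1" and \<phi>: "T x u = \<phi>"
    have "0 \<le> b / 2 * u powr (- \<alpha>)" using b_pos by simp
    then have \<phi>0: "0 \<le> \<phi>" using y1(2)[OF u] \<phi> by linarith
    have "u powr (- (\<zeta> - \<alpha>)) = (u powr (- \<alpha>)) powr ((\<zeta> - \<alpha>) / \<alpha>)" using alpha_pos by (simp add: powr_powr)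
    also have "\<dots> \<le> (2 / b * \<phi>) powr ((\<zeta> - \<alpha>) / \<alpha>)"
      using y1(2)[OF u] b_pos alpha_pos zeta_gt \<phi> by (intro powr_mono2) (auto simp: field_simps)
    also have "\<dots> = (2 / b) powr ((\<zeta> - \<alpha>) / \<alpha>) * \<phi> powr ((\<zeta> - \<alpha>) / \<alpha>)"
      using \<phi>0 b_pos powr_mult[of "2 / b" \<phi> "(\<zeta> - \<alpha>) / \<alpha>"] by simp
    finally show "u powr (- (\<zeta> - \<alpha>)) \<le> (2 / b) powr ((\<zeta> - \<alpha>) / \<alpha>) * \<phi> powr ((\<zeta> - \<alpha>) / \<alpha>)" .
  next
    fix u N :: real assume u: "u \<ge> y\<^sub>1" and N: "N \<ge> 2 * b" "1 / N \<le> T x u"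
    have N0: "N > 0" using N b_pos by linarith
    have u1: "u > 1" using u y1 y0_gt_1 by linarith
    have "1 / N \<le> 2 * b * u powr (- \<alpha>)" using y1(3)[OF u] N by linarith
    also have "\<dots> \<le> N * u powr (- \<alpha>)" using N by (intro mult_right_mono) auto
    finally have "u powr \<alpha> \<le> N * N" using N0 u1 by (simp add: powr_minus field_simps)
    then have "ln (u powr \<alpha>) \<le> ln (N * N)" using u1 N0 by (intro iffD2[OF ln_le_cancel_iff]) auto
    then have "\<alpha> * ln u \<le> 2 * ln N" using u1 N0 by (simp add: ln_powr ln_mult)
    then show "ln u \<le> 2 / \<alpha> * ln N" using alpha_pos by (simp add: field_simps)
  qed
qed

end

section \<open>Sums over lags and rounded powers\<close>

lemma sum_over_lags_le:
  fixes c :: "nat \<Rightarrow> real"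
  assumes c: "\<And>d. 0 \<le> c d" and i: "i \<in> {1..int n}"
  shows "(\<Sum>j=1..int n. c (nat \<bar>i - j\<bar>)) \<le> c 0 + 2 * (\<Sum>d=1..n. c d)"
proof -
  have part: "(\<Sum>j\<in>A. c (nat \<bar>i - j\<bar>)) \<le> (\<Sum>d=1..n. c d)"
    if "inj_on (\<lambda>j. nat \<bar>i - j\<bar>) A" "(\<lambda>j. nat \<bar>i - j\<bar>) ` A \<subseteq> {1..n}" for A
  proof -
    have "(\<Sum>j\<in>A. c (nat \<bar>i - j\<bar>)) = sum c ((\<lambda>j. nat \<bar>i - j\<bar>) ` A)"
      using that(1) by (simp add: sum.reindex)
    also have "\<dots> \<le> (\<Sum>d=1..n. c d)" by (rule sum_mono2) (use that c in auto)
    finally show ?thesis .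
  qed
  have "{1..int n} = {1..<i} \<union> insert i {i<..int n}" using i by auto
  then have "(\<Sum>j=1..int n. c (nat \<bar>i - j\<bar>)) = (\<Sum>j\<in>{1..<i}. c (nat \<bar>i - j\<bar>)) + (c 0 + (\<Sum>j\<in>{i<..int n}. c (nat \<bar>i - j\<bar>)))"
    by (simp only:) (subst sum.union_disjoint, auto)
  moreover have "(\<Sum>j\<in>{1..<i}. c (nat \<bar>i - j\<bar>)) \<le> (\<Sum>d=1..n. c d)"
    by (rule part) (use i in \<open>auto simp: inj_on_def\<close>)
  moreover have "(\<Sum>j\<in>{i<..int n}. c (nat \<bar>i - j\<bar>)) \<le> (\<Sum>d=1..n. c d)"
    by (rule part) (use i in \<open>auto simp: inj_on_def\<close>)
  ultimately show ?thesis by linarith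
qed

text \<open>
  Small lags are counted, large lags are summed. Splitting \<open>d powr (- \<eta>)\<close> into two equal powers
  leaves a convergent series, as \<open>\<eta> / 2 > 1\<close>, and a factor that is small beyond lag \<open>p\<close>.
\<close>

lemma sum_near_far_le:
  fixes a :: "nat \<Rightarrow> real"
  assumes \<eta>: "\<eta> > 2" and p: "p \<ge> 1" and P: "P \<ge> 0" and E: "E \<ge> 0" and Q: "Q \<ge> 0"
    and near: "\<And>d. 1 \<le> d \<Longrightarrow> d \<le> p \<Longrightarrow> a d \<le> P"
    and far: "\<And>d. d > p \<Longrightarrow> a d \<le> E + Q * real d powr (- \<eta>)"
  shows "(\<Sum>d=1..r. a d) \<le> real p * P + real r * E + Q * real p powr (- \<eta> / 2) * (\<Sum>d. real d powr (- \<eta> / 2))"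
proof -
  have sm: "summable (\<lambda>d. real d powr (- \<eta> / 2))" using \<eta> by (simp add: summable_real_powr_iff)
  define q where "q = Q * real p powr (- \<eta> / 2)"
  have q0: "q \<ge> 0" using Q by (simp add: q_def)
  have "a d \<le> of_bool (d \<le> p) * P + (E + q * real d powr (- \<eta> / 2))" if "d \<in> {1..r}" for d
  proof (cases "d \<le> p")
    case True
    have "0 \<le> E + q * real d powr (- \<eta> / 2)" using E q0 by simp
    then show ?thesis using near[of d] True that by simp
  next
    case False
    have "real d powr (- \<eta>) = real d powr (- \<eta> / 2) * real d powr (- \<eta> / 2)"
      by (simp add: powr_add[symmetric])
    also have "\<dots> \<le> real p powr (- \<eta> / 2) * real d powr (- \<eta> / 2)"
      using False p \<eta> by (intro mult_right_mono powr_mono2') auto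
    finally have "Q * real d powr (- \<eta>) \<le> q * real d powr (- \<eta> / 2)"
      unfolding q_def using Q by (simp add: mult.assoc mult_left_mono)
    then show ?thesis using far[of d] False by simp
  qed
  then have "(\<Sum>d=1..r. a d) \<le> (\<Sum>d=1..r. of_bool (d \<le> p) * P + (E + q * real d powr (- \<eta> / 2)))"
    by (rule sum_mono)
  also have "\<dots> = (\<Sum>d=1..r. of_bool (d \<le> p)) * P + real r * E + q * (\<Sum>d=1..r. real d powr (- \<eta> / 2))"
    by (simp add: sum.distrib sum_distrib_right sum_distrib_left)
  also have "\<dots> \<le> real p * P + real r * E + q * (\<Sum>d. real d powr (- \<eta> / 2))"
  proof (intro add_mono mult_right_mono mult_left_mono order_refl)
    have "(\<Sum>d=1..r. of_bool (d \<le> p) :: real) = real (card ({1..r} \<inter> {d. d \<le> p}))"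
      by (simp add: of_bool_def sum.If_cases)
    also have "\<dots> \<le> real (card {1..p})"
      unfolding of_nat_le_iff by (rule card_mono) auto
    finally show "(\<Sum>d=1..r. of_bool (d \<le> p) :: real) \<le> real p" by simp
    show "(\<Sum>d=1..r. real d powr (- \<eta> / 2)) \<le> (\<Sum>d. real d powr (- \<eta> / 2))"
      by (rule sum_le_suminf[OF sm]) auto
  qed (use P q0 E in auto)
  finally show ?thesis by (simp add: q_def)
qed

definition floor_powr :: "real \<Rightarrow> nat \<Rightarrow> nat" where
  "floor_powr e n = nat \<lfloor>real n powr e\<rfloor>"

lemma floor_powr_bounds:
  assumes "n \<ge> 1" "e \<ge> 0"
  shows "real n powr e / 2 \<le> real (floor_powr e n)" "real (floor_powr e n) \<le> real n powr e" "floor_powr e n \<ge> 1"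
proof -
  have 1: "real n powr e \<ge> 1" using assms by (intro ge_one_powr_ge_zero) auto
  then have f: "real (floor_powr e n) = of_int \<lfloor>real n powr e\<rfloor>" "\<lfloor>real n powr e\<rfloor> \<ge> 1"
    by (auto simp: floor_powr_def le_floor_iff)
  then have g: "real (floor_powr e n) \<ge> 1" by simp
  show "real (floor_powr e n) \<le> real n powr e" unfolding f(1) by (rule of_int_floor_le)
  have "real n powr e < real (floor_powr e n) + 1" unfolding f(1) by (simp add: floor_correct)
  then show "real n powr e / 2 \<le> real (floor_powr e n)" using g by linarith
  show "floor_powr e n \<ge> 1" using g by linarith
qed

lemma powr_neg_tendsto_0: "e > 0 \<Longrightarrow> (\<lambda>n. real n powr (- e)) \<longlonglongrightarrow> 0"
  using tendsto_neg_powr[OF _ filterlim_real_sequentially, of "- e"] by simp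

lemma filterlim_floor_powr:
  assumes "e > 0"
  shows "filterlim (\<lambda>n. real (floor_powr e n)) at_top sequentially"
proof (rule filterlim_at_top_mono)
  show "filterlim (\<lambda>n. real n powr e / 2) at_top sequentially" using assms by real_asymp
  show "\<forall>\<^sub>F n in sequentially. real n powr e / 2 \<le> real (floor_powr e n)"
    using eventually_ge_at_top[of 1] by eventually_elim (use floor_powr_bounds assms in auto)
qed

lemma intermediate_floor_powr:
  assumes "0 < e" "e < 1"
  shows "intermediate (floor_powr e)"
  unfolding intermediate_def
proof (intro conjI allI)
  fix n show "floor_powr e n \<le> n"
  proof (cases "n = 0")
    case False
    then have "real (floor_powr e n) \<le> real n powr e" using assms by (intro floor_powr_bounds) auto
    also have "\<dots> \<le> real n powr 1" using False assms by (intro powr_mono) auto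
    finally show ?thesis using False by simp
  qed (simp add: floor_powr_def)
next
  show "filterlim (floor_powr e) at_top sequentially"
    using filterlim_floor_powr[OF assms(1)] filterlim_sequentially_iff_filterlim_real by blast
next
  have "(\<lambda>n. real n powr (- (1 - e))) \<longlonglongrightarrow> 0" using assms by (intro powr_neg_tendsto_0) simp
  moreover have "\<forall>\<^sub>F n in sequentially. norm (real (floor_powr e n) / real n) \<le> real n powr (- (1 - e))"
    using eventually_ge_at_top[of 1]
  proof eventually_elim
    case (elim n)
    have "real (floor_powr e n) / real n \<le> real n powr e / real n powr 1"
      using elim assms floor_powr_bounds(2)[of n e] by (simp add: divide_right_mono)
    then show ?case using elim by (simp add: powr_diff)
  qed
  ultimately show "(\<lambda>n. real (floor_powr e n) / real n) \<longlonglongrightarrow> 0" by (rule Lim_null_comparison[rotated])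
qed

section \<open>Quantiles\<close>

lemma cdf_gen_inverse:
  assumes P: "prob_space P" and s: "sets P = sets borel" and cont: "continuous_on UNIV (cdf P)" and p: "0 < p" "p < 1"
  shows "cdf P (gen_inverse (cdf P) p) = p"
proof -
  interpret real_distribution P
    using P s sets_eq_imp_space_eq[OF s] by (simp add: real_distribution_def real_distribution_axioms_def)
  have "\<forall>\<^sub>F y in at_top. p < cdf P y" using cdf_lim_at_top_prob p by (intro order_tendstoD) auto
  then obtain y1 where y1: "p < cdf P y1" by (auto simp: eventually_at_top_linorder)
  have "\<forall>\<^sub>F y in at_bot. cdf P y < p" using cdf_lim_at_bot p by (intro order_tendstoD) auto
  then obtain y2 where y2: "\<And>y. y \<le> y2 \<Longrightarrow> cdf P y < p" by (auto simp: eventually_at_bot_linorder)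
  define S where "S = {y. p \<le> cdf P y}"
  have ne: "S \<noteq> {}" using y1 by (auto simp: S_def intro: less_imp_le)
  have low: "y2 \<le> y" if "y \<in> S" for y
    using y2[of y] that unfolding S_def by fastforce
  then have bd: "bdd_below S" by (rule bdd_belowI)
  have cl: "closed S" unfolding S_def by (rule closed_Collect_le) (auto intro: cont)
  have "Inf S \<in> S" by (rule closed_contains_Inf[OF ne bd cl])
  then have ge: "p \<le> cdf P (Inf S)" by (simp add: S_def)
  have "y2 \<le> Inf S" by (rule cInf_greatest[OF ne low])
  then obtain y where y: "y2 \<le> y" "y \<le> Inf S" "cdf P y = p"
    using IVT'[of "cdf P" y2 p "Inf S"] y2[of y2] ge continuous_on_subset[OF cont] by auto
  have "Inf S \<le> y" by (rule cInf_lower[OF _ bd]) (use y in \<open>simp add: S_def\<close>)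
  then show ?thesis using y by (simp add: gen_inverse_def S_def)
qed

section \<open>Localised moments of the series\<close>

text \<open>
  The constants are: \<open>B\<close> bounds the kernel, \<open>J\<close> all joint densities, \<open>G\<close> is a Lipschitz constant of the
  density on the unit window around \<open>x\<close>, and \<open>A\<close> is the constant in the polynomial decay of the
  \<open>\<alpha>\<close>-mixing coefficients.
\<close>

locale kernel_series = prob_space M for M :: "'a measure" +
  fixes X Y :: "int \<Rightarrow> 'a \<Rightarrow> real" and g K :: "real \<Rightarrow> real" and \<kappa> :: "real \<Rightarrow> real measure"
    and x B J G A \<eta> :: real
  assumes rv_X [measurable]: "\<And>j. X j \<in> borel_measurable M"
    and rv_Y [measurable]: "\<And>j. Y j \<in> borel_measurable M"
    and stationary: "strictly_stationary M (\<lambda>j \<omega>. (X j \<omega>, Y j \<omega>))"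
    and g_nonneg: "\<And>u. g u \<ge> 0"
    and g_density: "distributed M lborel (X 0) (\<lambda>u. ennreal (g u))"
    and g_meas [measurable]: "g \<in> borel_measurable borel"
    and g_lipschitz: "\<And>v. \<bar>v - x\<bar> \<le> 1 \<Longrightarrow> \<bar>g v - g x\<bar> \<le> G * \<bar>v - x\<bar>"
    and G_nonneg: "G \<ge> 0"
    and J_nonneg: "J \<ge> 0"
    and joint_density: "\<And>i j. i \<noteq> j \<Longrightarrow> \<exists>f. (\<forall>p. 0 \<le> f p \<and> f p \<le> J) \<and>
             distributed M (lborel \<Otimes>\<^sub>M lborel) (\<lambda>\<omega>. (X i \<omega>, X j \<omega>)) (\<lambda>p. ennreal (f p))"
    and cond_law: "regular_cond_law M (X 0) (Y 0) \<kappa>"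
    and kernel: "bounded_kernel K"
    and B_pos: "B > 0"
    and K_le: "\<And>z. K z \<le> B"
    and eta: "\<eta> > 2"
    and A_nonneg: "A \<ge> 0"
    and alpha_le: "\<And>d. d \<ge> 1 \<Longrightarrow> alpha_coeff M (\<lambda>j \<omega>. (X j \<omega>, Y j \<omega>)) d \<le> A * real d powr (- \<eta>)"
begin

definition local_mass :: "real \<Rightarrow> real set \<Rightarrow> int \<Rightarrow> 'a \<Rightarrow> real" where
  "local_mass h S j \<omega> = K ((x - X j \<omega>) / h) * indicator S (Y j \<omega>)"

definition g_bound :: real where "g_bound = g x + G"

lemma g_bound_nonneg: "g_bound \<ge> 0"
  using g_nonneg[of x] G_nonneg by (simp add: g_bound_def)

lemma g_le: "\<bar>v - x\<bar> \<le> 1 \<Longrightarrow> g v \<le> g_bound"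
  using g_lipschitz[of v] mult_left_mono[of "\<bar>v - x\<bar>" 1 G] G_nonneg unfolding g_bound_def by (simp add: abs_le_iff)

lemma K_meas [measurable]: "K \<in> borel_measurable borel"
  using kernel by (simp add: bounded_kernel_def)

lemma K_nonneg: "0 \<le> K z"
  using kernel by (simp add: bounded_kernel_def)

lemma local_mass_bounds: "0 \<le> local_mass h S j \<omega>" "local_mass h S j \<omega> \<le> B"
  using K_nonneg K_le B_pos by (auto simp: local_mass_def indicator_def less_imp_le)

lemma local_mass_meas [measurable]:
  assumes [measurable]: "S \<in> sets borel"
  shows "local_mass h S j \<in> borel_measurable M"
  unfolding local_mass_def by measurable

lemma integrable_bounded:
  fixes f :: "'a \<Rightarrow> real"
  assumes "f \<in> borel_measurable M" "\<And>\<omega>. \<bar>f \<omega>\<bar> \<le> c"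
  shows "integrable M f"
  using assms by (intro integrable_const_bound[where B=c]) auto

lemma integrable_local_mass [simp]: "S \<in> sets borel \<Longrightarrow> integrable M (local_mass h S j)"
  by (rule integrable_bounded[where c=B]) (use local_mass_bounds in \<open>auto simp: abs_of_nonneg\<close>)

lemma integrable_local_mass_mult [simp]:
  "S \<in> sets borel \<Longrightarrow> S' \<in> sets borel \<Longrightarrow> integrable M (\<lambda>\<omega>. local_mass h S i \<omega> * local_mass h S' j \<omega>)"
  by (rule integrable_bounded[where c="B * B"])
     (use local_mass_bounds B_pos in \<open>auto simp: abs_mult abs_of_nonneg intro!: mult_mono\<close>)

lemma cond_prob_space: "prob_space (\<kappa> v)" and cond_sets: "sets (\<kappa> v) = sets borel"
proof -
  have "\<kappa> \<in> borel \<rightarrow>\<^sub>M prob_algebra borel" using cond_law by (simp add: regular_cond_law_def)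
  then have "\<kappa> v \<in> space (prob_algebra borel)" by (auto simp: measurable_def)
  then show "prob_space (\<kappa> v)" "sets (\<kappa> v) = sets borel" by (auto simp: space_prob_algebra)
qed

lemma cond_measure_le_1: "measure (\<kappa> v) S \<le> 1"
  by (rule prob_space.prob_le_1[OF cond_prob_space])

lemma cond_measure_meas [measurable]: "S \<in> sets borel \<Longrightarrow> (\<lambda>v. measure (\<kappa> v) S) \<in> borel_measurable borel"
proof -
  assume [measurable]: "S \<in> sets borel"
  have [measurable]: "\<kappa> \<in> borel \<rightarrow>\<^sub>M prob_algebra borel" using cond_law by (simp add: regular_cond_law_def)
  show ?thesis by measurable
qed

lemma pair_process_meas [measurable]: "(\<lambda>\<omega>. (X j \<omega>, Y j \<omega>)) \<in> borel_measurable M"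
  by (rule borel_measurable_Pair) auto

lemma expectation_shift:
  fixes \<phi> :: "real \<times> real \<Rightarrow> real"
  assumes [measurable]: "\<phi> \<in> borel_measurable borel"
  shows "expectation (\<lambda>\<omega>. \<phi> (X j \<omega>, Y j \<omega>)) = expectation (\<lambda>\<omega>. \<phi> (X 0 \<omega>, Y 0 \<omega>))"
proof -
  have "distr M borel (\<lambda>\<omega>. (X j \<omega>, Y j \<omega>)) = distr M borel (\<lambda>\<omega>. (X 0 \<omega>, Y 0 \<omega>))"
    using strictly_stationary_marginal[OF stationary pair_process_meas] by simp
  then have "integral\<^sup>L (distr M borel (\<lambda>\<omega>. (X j \<omega>, Y j \<omega>))) \<phi> = integral\<^sup>L (distr M borel (\<lambda>\<omega>. (X 0 \<omega>, Y 0 \<omega>))) \<phi>"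
    by simp
  then show ?thesis by (simp add: integral_distr)
qed

lemma expectation_pair_shift:
  fixes \<phi> \<psi> :: "real \<times> real \<Rightarrow> real"
  assumes [measurable]: "\<phi> \<in> borel_measurable borel" "\<psi> \<in> borel_measurable borel"
  shows "expectation (\<lambda>\<omega>. \<phi> (X i \<omega>, Y i \<omega>) * \<psi> (X j \<omega>, Y j \<omega>))
      = expectation (\<lambda>\<omega>. \<phi> (X 0 \<omega>, Y 0 \<omega>) * \<psi> (X (j - i) \<omega>, Y (j - i) \<omega>))"
proof -
  let ?Z = "\<lambda>j \<omega>. (X j \<omega>, Y j \<omega>)"
  let ?f = "\<lambda>p. \<phi> (fst p) * \<psi> (snd p)"
  have "distr M (borel \<Otimes>\<^sub>M borel) (\<lambda>\<omega>. (?Z i \<omega>, ?Z j \<omega>)) = distr M (borel \<Otimes>\<^sub>M borel) (\<lambda>\<omega>. (?Z 0 \<omega>, ?Z (j - i) \<omega>))"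
    by (rule strictly_stationary_pair[OF stationary pair_process_meas])
  then have "integral\<^sup>L (distr M (borel \<Otimes>\<^sub>M borel) (\<lambda>\<omega>. (?Z i \<omega>, ?Z j \<omega>))) ?f
      = integral\<^sup>L (distr M (borel \<Otimes>\<^sub>M borel) (\<lambda>\<omega>. (?Z 0 \<omega>, ?Z (j - i) \<omega>))) ?f"
    by simp
  then show ?thesis by (simp add: integral_distr)
qed

abbreviation mass_of :: "real \<Rightarrow> real set \<Rightarrow> real \<times> real \<Rightarrow> real" where
  "mass_of h S p \<equiv> K ((x - fst p) / h) * indicator S (snd p)"

lemma mass_of_meas [measurable]:
  assumes [measurable]: "S \<in> sets borel"
  shows "mass_of h S \<in> borel_measurable borel"
  unfolding borel_prod[symmetric] by measurable

lemma local_mass_eq: "local_mass h S j = (\<lambda>\<omega>. mass_of h S (X j \<omega>, Y j \<omega>))"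
  by (simp add: local_mass_def fun_eq_iff)

lemma expectation_local_mass_shift:
  "S \<in> sets borel \<Longrightarrow> expectation (local_mass h S j) = expectation (local_mass h S 0)"
  unfolding local_mass_eq by (rule expectation_shift, rule mass_of_meas)

lemma expectation_local_mass:
  assumes S [measurable]: "S \<in> sets borel" and h: "0 < h" "h \<le> 1"
  shows "expectation (local_mass h S j) = (LINT v|lborel. K ((x - v) / h) * (measure (\<kappa> v) S * g v))"
    and "integrable lborel (\<lambda>v. K ((x - v) / h) * (measure (\<kappa> v) S * g v))"
proof -
  have bd: "\<bar>measure (\<kappa> v) S * g v\<bar> \<le> 1 * g_bound" if "\<bar>v - x\<bar> \<le> h" for v
    unfolding abs_mult by (rule mult_mono) (use that g_le[of v] h cond_measure_le_1 g_nonneg in auto)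
  show i: "integrable lborel (\<lambda>v. K ((x - v) / h) * (measure (\<kappa> v) S * g v))"
    by (rule kernel_average_bound(1)[OF kernel h(1) _ bd]) auto
  have "ennreal (expectation (local_mass h S j)) = ennreal (expectation (local_mass h S 0))"
    by (simp only: expectation_local_mass_shift[OF S, of h j])
  also have "\<dots> = (\<integral>\<^sup>+ \<omega>. ennreal (local_mass h S 0 \<omega>) \<partial>M)"
    by (rule nn_integral_eq_integral[symmetric]) (auto simp: local_mass_bounds)
  also have "\<dots> = (\<integral>\<^sup>+ \<omega>. ennreal (K ((x - X 0 \<omega>) / h)) * indicator S (Y 0 \<omega>) \<partial>M)"
    by (rule nn_integral_cong) (auto simp: local_mass_def indicator_def)
  also have "\<dots> = (\<integral>\<^sup>+ \<omega>. ennreal (K ((x - X 0 \<omega>) / h)) * ennreal (measure (\<kappa> (X 0 \<omega>)) S) \<partial>M)"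
    by (rule regular_cond_law_nn_integral[OF prob_space_axioms cond_law, where \<phi>="\<lambda>v. ennreal (K ((x - v) / h))"]) auto
  also have "\<dots> = (\<integral>\<^sup>+ v. ennreal (g v) * (ennreal (K ((x - v) / h)) * ennreal (measure (\<kappa> v) S)) \<partial>lborel)"
    by (rule distributed_nn_integral[OF g_density, symmetric]) auto
  also have "\<dots> = (\<integral>\<^sup>+ v. ennreal (K ((x - v) / h) * (measure (\<kappa> v) S * g v)) \<partial>lborel)"
    by (rule nn_integral_cong) (simp add: ennreal_mult[symmetric] K_nonneg g_nonneg mult_ac)
  also have "\<dots> = ennreal (LINT v|lborel. K ((x - v) / h) * (measure (\<kappa> v) S * g v))"
    by (rule nn_integral_eq_integral[OF i]) (auto simp: K_nonneg g_nonneg)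
  finally show "expectation (local_mass h S j) = (LINT v|lborel. K ((x - v) / h) * (measure (\<kappa> v) S * g v))"
    by (subst (asm) ennreal_inj)
       (auto intro!: Bochner_Integration.integral_nonneg simp: local_mass_bounds K_nonneg g_nonneg)
qed

lemma expectation_local_mass_le:
  assumes S [measurable]: "S \<in> sets borel" and h: "0 < h" "h \<le> 1"
    and \<tau>: "\<And>v. \<bar>v - x\<bar> \<le> h \<Longrightarrow> measure (\<kappa> v) S \<le> \<tau>"
  shows "expectation (local_mass h S j) \<le> \<tau> * g_bound * h"
proof -
  have bd: "\<bar>measure (\<kappa> v) S * g v\<bar> \<le> \<tau> * g_bound" if v: "\<bar>v - x\<bar> \<le> h" for v
  proof -
    have "0 \<le> \<tau>" using \<tau>[OF v] measure_nonneg[of "\<kappa> v" S] by linarith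
    then show ?thesis unfolding abs_mult
      by (intro mult_mono) (use v \<tau> g_le[of v] h g_nonneg in auto)
  qed
  then show ?thesis using kernel_average_bound(2)[OF kernel h(1) _ bd] expectation_local_mass(1)[OF S h, of j]
    by (auto simp: abs_le_iff)
qed

text \<open>
  A normalised local mean is the kernel average of a conditional probability times the density, so
  it inherits every error bound that holds pointwise on the window.
\<close>

lemma local_mean_error:
  assumes S [measurable]: "S \<in> sets borel" and h: "0 < h" "h \<le> 1" and \<phi>: "\<phi> > 0"
    and ptw: "\<And>v. \<bar>v - x\<bar> \<le> h \<Longrightarrow> \<bar>measure (\<kappa> v) S / \<phi> * g v - c\<bar> \<le> \<epsilon>"
  shows "\<bar>expectation (local_mass h S j) / (h * \<phi>) - c\<bar> \<le> \<epsilon>"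
proof -
  let ?k = "\<lambda>v. K ((x - v) / h)"
  let ?F = "\<lambda>v. measure (\<kappa> v) S / \<phi> * g v"
  note I = kernel_rescaled_has_bochner_integral[OF kernel h(1), of x]
  note E = expectation_local_mass[OF S h]
  have eq: "?k v * ?F v = ?k v * (measure (\<kappa> v) S * g v) / \<phi>" for v by simp
  have iF: "integrable lborel (\<lambda>v. ?k v * ?F v)" unfolding eq by (rule integrable_divide[OF E(2)])
  have ic: "integrable lborel (\<lambda>v. ?k v * c)"
    using I by (intro integrable_mult_left) (auto intro: integrable.intros)
  have "expectation (local_mass h S j) / \<phi> = (LINT v|lborel. ?k v * ?F v)" unfolding eq E(1) by simp
  moreover have "h * c = (LINT v|lborel. ?k v * c)" using has_bochner_integral_integral_eq[OF I] by simp
  ultimately have "expectation (local_mass h S j) / \<phi> - h * c = (LINT v|lborel. ?k v * (?F v - c))"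
    by (simp only: right_diff_distrib Bochner_Integration.integral_diff[OF iF ic])
  also have "\<bar>\<dots>\<bar> \<le> \<epsilon> * h" by (rule kernel_average_bound(2)[OF kernel h(1) _ ptw]) auto
  finally have "\<bar>expectation (local_mass h S j) / \<phi> - h * c\<bar> / h \<le> \<epsilon>" using h by (simp add: divide_le_eq)
  moreover have "expectation (local_mass h S j) / (h * \<phi>) - c = (expectation (local_mass h S j) / \<phi> - h * c) / h"
    using h \<phi> by (simp add: field_simps)
  ultimately show ?thesis using h by (simp add: abs_divide)
qed

text \<open>
  Two distinct observations lie in the window together with probability of order \<open>h\<^sup>2\<close>. For lags that
  are too short for mixing to help, this is the estimate used.
\<close>

lemma expectation_pair_le:
  assumes [measurable]: "S \<in> sets borel" "S' \<in> sets borel" and h: "h > 0" and ij: "i \<noteq> j"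
  shows "expectation (\<lambda>\<omega>. local_mass h S i \<omega> * local_mass h S' j \<omega>) \<le> J * h\<^sup>2"
proof -
  obtain f where f: "\<And>p. 0 \<le> f p" "\<And>p. f p \<le> J"
    "distributed M (lborel \<Otimes>\<^sub>M lborel) (\<lambda>\<omega>. (X i \<omega>, X j \<omega>)) (\<lambda>p. ennreal (f p))"
    using joint_density[OF ij] by blast
  define k where "k v = K ((x - v) / h)" for v
  have [measurable]: "k \<in> borel_measurable borel" unfolding k_def by measurable
  have k0: "0 \<le> k v" for v by (simp add: k_def K_nonneg)
  have ki: "(\<integral>\<^sup>+ v. ennreal (k v) \<partial>lborel) = ennreal h"
  proof -
    have "has_bochner_integral lborel k h"
      unfolding k_def by (rule kernel_rescaled_has_bochner_integral[OF kernel h])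
    then show ?thesis
      using nn_integral_eq_integral[of lborel k] k0 by (auto simp: has_bochner_integral_iff)
  qed
  have "ennreal (expectation (\<lambda>\<omega>. local_mass h S i \<omega> * local_mass h S' j \<omega>))
      = (\<integral>\<^sup>+ \<omega>. ennreal (local_mass h S i \<omega> * local_mass h S' j \<omega>) \<partial>M)"
    by (rule nn_integral_eq_integral[symmetric]) (auto simp: local_mass_bounds)
  also have "\<dots> \<le> (\<integral>\<^sup>+ \<omega>. ennreal (k (fst (X i \<omega>, X j \<omega>))) * ennreal (k (snd (X i \<omega>, X j \<omega>))) \<partial>M)"
    unfolding k_def local_mass_def
    by (rule nn_integral_mono) (auto simp: ennreal_mult[symmetric] K_nonneg indicator_def)
  also have "\<dots> = (\<integral>\<^sup>+ p. ennreal (f p) * (ennreal (k (fst p)) * ennreal (k (snd p))) \<partial>(lborel \<Otimes>\<^sub>M lborel))"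
    by (rule distributed_nn_integral[OF f(3), symmetric]) auto
  also have "\<dots> \<le> (\<integral>\<^sup>+ p. ennreal J * (ennreal (k (fst p)) * ennreal (k (snd p))) \<partial>(lborel \<Otimes>\<^sub>M lborel))"
    by (intro nn_integral_mono mult_right_mono ennreal_leI f) auto
  also have "\<dots> = ennreal J * (\<integral>\<^sup>+ p. ennreal (k (fst p)) * ennreal (k (snd p)) \<partial>(lborel \<Otimes>\<^sub>M lborel))"
    by (rule nn_integral_cmult) measurable
  also have "(\<integral>\<^sup>+ p. ennreal (k (fst p)) * ennreal (k (snd p)) \<partial>(lborel \<Otimes>\<^sub>M lborel))
      = (\<integral>\<^sup>+ v. (\<integral>\<^sup>+ w. ennreal (k v) * ennreal (k w) \<partial>lborel) \<partial>lborel)"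
    by (subst lborel.nn_integral_fst[symmetric]) auto
  also have "\<dots> = ennreal h * ennreal h"
    by (simp add: nn_integral_cmult nn_integral_multc ki)
  also have "ennreal J * (ennreal h * ennreal h) = ennreal (J * h\<^sup>2)"
    using h J_nonneg by (simp add: ennreal_mult[symmetric] power2_eq_square)
  finally show ?thesis using J_nonneg h by (subst (asm) ennreal_le_iff) auto
qed

lemma covariance_le:
  assumes [measurable]: "S \<in> sets borel" "S' \<in> sets borel" and d: "d \<ge> 1"
  shows "\<bar>expectation (\<lambda>\<omega>. local_mass h S 0 \<omega> * local_mass h S' (int d) \<omega>)
      - expectation (local_mass h S 0) * expectation (local_mass h S' 0)\<bar> \<le> B\<^sup>2 * A * real d powr (- \<eta>)"
proof -
  have "\<bar>expectation (\<lambda>\<omega>. local_mass h S 0 \<omega> * local_mass h S' (int d) \<omega>)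
      - expectation (local_mass h S 0) * expectation (local_mass h S' (int d))\<bar>
      \<le> B\<^sup>2 * alpha_coeff M (\<lambda>j \<omega>. (X j \<omega>, Y j \<omega>)) d"
    unfolding local_mass_eq
    by (rule covariance_le_alpha_coeff[OF prob_space_axioms pair_process_meas mass_of_meas mass_of_meas])
       (use assms B_pos K_nonneg K_le in \<open>auto simp: indicator_def less_imp_le\<close>)
  also have "\<dots> \<le> B\<^sup>2 * (A * real d powr (- \<eta>))" by (intro mult_left_mono alpha_le d) auto
  finally show ?thesis by (simp add: expectation_local_mass_shift[of S' h "int d"] mult.assoc)
qed

definition lag_series :: real where "lag_series = (\<Sum>d. real d powr (- \<eta> / 2))"

lemma sum_pair_expectations_le:
  assumes S [measurable]: "S \<in> sets borel" "S' \<in> sets borel" and h: "h > 0" and p: "p \<ge> 1"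
    and m: "expectation (local_mass h S 0) \<le> m" "expectation (local_mass h S' 0) \<le> m"
  shows "(\<Sum>d=1..r. expectation (\<lambda>\<omega>. local_mass h S 0 \<omega> * local_mass h S' (int d) \<omega>))
    \<le> real p * (J * h\<^sup>2) + real r * m\<^sup>2 + B\<^sup>2 * A * real p powr (- \<eta> / 2) * lag_series"
  unfolding lag_series_def
proof (rule sum_near_far_le[OF eta p])
  fix d :: nat
  show "expectation (\<lambda>\<omega>. local_mass h S 0 \<omega> * local_mass h S' (int d) \<omega>) \<le> J * h\<^sup>2" if "1 \<le> d" "d \<le> p"
    using that by (intro expectation_pair_le S h) auto
  show "expectation (\<lambda>\<omega>. local_mass h S 0 \<omega> * local_mass h S' (int d) \<omega>) \<le> m\<^sup>2 + B\<^sup>2 * A * real d powr (- \<eta>)" if "p < d"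
  proof -
    have n: "0 \<le> expectation (local_mass h S 0)" "0 \<le> expectation (local_mass h S' 0)"
      by (auto intro!: Bochner_Integration.integral_nonneg simp: local_mass_bounds)
    have "expectation (local_mass h S 0) * expectation (local_mass h S' 0) \<le> m * m"
      by (rule mult_mono) (use n m in auto)
    moreover have "d \<ge> 1" using that by simp
    ultimately show ?thesis using covariance_le[OF S, of d h] by (simp add: power2_eq_square abs_le_iff)
  qed
qed (use J_nonneg A_nonneg in auto)

text \<open>
  The second moment of a kernel sum: the diagonal contributes \<open>n h\<close>, the lags up to \<open>p\<close> at most
  \<open>n p h\<^sup>2\<close> by the bounded joint densities, and the remaining lags are summable by mixing.
\<close>

lemma kernel_sum_variance_le:
  assumes h: "0 < h" "h \<le> 1" and p: "p \<ge> 1"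
  shows "expectation (\<lambda>\<omega>. (\<Sum>j=1..int n. local_mass h UNIV j \<omega> - expectation (local_mass h UNIV 0))\<^sup>2)
    \<le> real n * (B * g_bound * h + 2 * (real p * ((J + g_bound\<^sup>2) * h\<^sup>2) + B\<^sup>2 * A * real p powr (- \<eta> / 2) * lag_series))"
proof -
  let ?W = "local_mass h UNIV"
  define m where "m = expectation (?W 0)"
  have m0: "0 \<le> m" unfolding m_def by (auto intro!: Bochner_Integration.integral_nonneg simp: local_mass_bounds)
  have m1: "m \<le> g_bound * h"
    unfolding m_def using expectation_local_mass_le[of UNIV h 1 0] h cond_measure_le_1 by simp
  have mj: "expectation (?W j) = m" for j unfolding m_def by (rule expectation_local_mass_shift) simp
  have cov: "expectation (\<lambda>\<omega>. (?W i \<omega> - m) * (?W j \<omega> - m)) = expectation (\<lambda>\<omega>. ?W i \<omega> * ?W j \<omega>) - m * m" for i j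
    by (simp add: algebra_simps mj prob_space)
  define c where "c d = \<bar>expectation (\<lambda>\<omega>. (?W 0 \<omega> - m) * (?W (int d) \<omega> - m))\<bar>" for d :: nat
  have icov: "integrable M (\<lambda>\<omega>. (?W i \<omega> - m) * (?W j \<omega> - m))" for i j
    by (simp add: algebra_simps)
  have lag: "expectation (\<lambda>\<omega>. (?W i \<omega> - m) * (?W j \<omega> - m)) \<le> c (nat \<bar>i - j\<bar>)" for i j
  proof -
    have *: "expectation (\<lambda>\<omega>. (?W i \<omega> - m) * (?W j \<omega> - m)) = expectation (\<lambda>\<omega>. (?W 0 \<omega> - m) * (?W (j - i) \<omega> - m))" for i j
      unfolding local_mass_eq
      by (rule expectation_pair_shift) (intro borel_measurable_diff mass_of_meas borel_measurable_const; simp)+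
    show ?thesis
    proof (cases "i \<le> j")
      case True
      then show ?thesis using *[of i j] unfolding c_def by simp
    next
      case False
      then show ?thesis using *[of j i] unfolding c_def by (simp add: mult.commute)
    qed
  qed
  have c0: "c 0 \<le> B * g_bound * h"
  proof -
    have "expectation (\<lambda>\<omega>. (?W 0 \<omega> - m) * (?W 0 \<omega> - m)) \<ge> 0" by (rule Bochner_Integration.integral_nonneg) simp
    then have "c 0 = expectation (\<lambda>\<omega>. (?W 0 \<omega> - m) * (?W 0 \<omega> - m))" unfolding c_def by simp
    also have "\<dots> \<le> expectation (\<lambda>\<omega>. ?W 0 \<omega> * ?W 0 \<omega>)" unfolding cov by simp
    also have "\<dots> \<le> expectation (\<lambda>\<omega>. B * ?W 0 \<omega>)"
      by (rule integral_mono) (auto intro!: mult_right_mono simp: local_mass_bounds)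
    also have "\<dots> \<le> B * (g_bound * h)" using m1 B_pos unfolding m_def by simp
    finally show ?thesis by (simp add: mult.assoc)
  qed
  have cs: "(\<Sum>d=1..n. c d) \<le> real p * ((J + g_bound\<^sup>2) * h\<^sup>2) + real n * 0 + B\<^sup>2 * A * real p powr (- \<eta> / 2) * lag_series"
    unfolding lag_series_def
  proof (rule sum_near_far_le[OF eta p])
    fix d :: nat
    show "c d \<le> (J + g_bound\<^sup>2) * h\<^sup>2" if "1 \<le> d" "d \<le> p"
    proof -
      have "expectation (\<lambda>\<omega>. ?W 0 \<omega> * ?W (int d) \<omega>) \<le> J * h\<^sup>2" using that h by (intro expectation_pair_le) auto
      moreover have "0 \<le> expectation (\<lambda>\<omega>. ?W 0 \<omega> * ?W (int d) \<omega>)"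
        by (auto intro!: Bochner_Integration.integral_nonneg simp: local_mass_bounds)
      moreover have "m * m \<le> (g_bound * h) * (g_bound * h)" using m0 m1 by (intro mult_mono) auto
      moreover have "0 \<le> m * m" "0 \<le> J * h\<^sup>2" using J_nonneg by auto
      moreover have "(J + g_bound\<^sup>2) * h\<^sup>2 = J * h\<^sup>2 + (g_bound * h) * (g_bound * h)"
        by (simp add: algebra_simps power2_eq_square)
      ultimately show ?thesis unfolding c_def cov abs_le_iff by linarith
    qed
    show "c d \<le> 0 + B\<^sup>2 * A * real d powr (- \<eta>)" if "p < d"
      using covariance_le[of UNIV UNIV d h, folded m_def] that unfolding c_def cov by simp
  qed (use J_nonneg A_nonneg in auto)
  have "expectation (\<lambda>\<omega>. (\<Sum>j=1..int n. ?W j \<omega> - m)\<^sup>2)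
      = expectation (\<lambda>\<omega>. \<Sum>i=1..int n. \<Sum>j=1..int n. (?W i \<omega> - m) * (?W j \<omega> - m))"
    by (simp add: power2_eq_square sum_product)
  also have "\<dots> = (\<Sum>i=1..int n. \<Sum>j=1..int n. expectation (\<lambda>\<omega>. (?W i \<omega> - m) * (?W j \<omega> - m)))"
    by (simp only: Bochner_Integration.integral_sum Bochner_Integration.integrable_sum icov)
  also have "\<dots> \<le> (\<Sum>i=1..int n. \<Sum>j=1..int n. c (nat \<bar>i - j\<bar>))" by (intro sum_mono lag)
  also have "\<dots> \<le> (\<Sum>i=1..int n. c 0 + 2 * (\<Sum>d=1..n. c d))"
    by (intro sum_mono sum_over_lags_le) (auto simp: c_def)
  also have "\<dots> = real n * (c 0 + 2 * (\<Sum>d=1..n. c d))" by simp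
  also have "\<dots> \<le> real n * (B * g_bound * h + 2 * (real p * ((J + g_bound\<^sup>2) * h\<^sup>2) + B\<^sup>2 * A * real p powr (- \<eta> / 2) * lag_series))"
    using c0 cs by (intro mult_left_mono) auto
  finally show ?thesis unfolding m_def .
qed

section \<open>Logarithmic excesses\<close>

definition excess_series :: "real \<Rightarrow> real" where
  "excess_series \<delta> = (\<Sum>i. (real i + 1)\<^sup>2 * exp (- \<delta> / 2 * real i))"

lemma summable_excess_series: "\<delta> > 0 \<Longrightarrow> summable (\<lambda>i. (real i + 1)\<^sup>2 * exp (- \<delta> / 2 * real i))"
  by (rule summable_comparison_test_bigo[of "\<lambda>i. real i powr (- 2)"])
     (simp_all add: summable_real_powr_iff, real_asymp)

lemma excess_series_nonneg: "\<delta> > 0 \<Longrightarrow> excess_series \<delta> \<ge> 0"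
  unfolding excess_series_def by (intro suminf_nonneg summable_excess_series) auto

lemma log_plus_meas [measurable]: "log_plus \<in> borel_measurable borel"
  unfolding log_plus_def[abs_def] by measurable

lemma log_plus_nonneg: "0 \<le> log_plus z"
  by (simp add: log_plus_def)

lemma log_plus_gt_iff:
  assumes "a > 0" "t \<ge> 0"
  shows "t < log_plus (y / a) \<longleftrightarrow> a * exp t < y"
proof -
  have "t < log_plus (y / a) \<longleftrightarrow> exp t < max 1 (y / a)"
    unfolding log_plus_def using ln_less_cancel_iff[of "exp t" "max 1 (y / a)"] by simp
  also have "\<dots> \<longleftrightarrow> exp t < y / a" using assms by (auto simp: less_max_iff_disj)
  also have "\<dots> \<longleftrightarrow> a * exp t < y" using assms by (simp add: field_simps)
  finally show ?thesis .
qed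

abbreviation log_product :: "real \<Rightarrow> real \<Rightarrow> int \<Rightarrow> 'a \<Rightarrow> real" where
  "log_product h a j \<equiv> \<lambda>\<omega>. K ((x - X 0 \<omega>) / h) * K ((x - X j \<omega>) / h) * log_plus (Y 0 \<omega> / a) * log_plus (Y j \<omega> / a)"

definition large_excess :: "real \<Rightarrow> real \<Rightarrow> nat \<Rightarrow> int \<Rightarrow> 'a \<Rightarrow> real" where
  "large_excess h a T j \<omega> =
     K ((x - X j \<omega>) / h) * ((log_plus (Y j \<omega> / a))\<^sup>2 * of_bool (real T < log_plus (Y j \<omega> / a)))"

lemma large_excess_meas [measurable]: "large_excess h a T j \<in> borel_measurable M"
  unfolding large_excess_def[abs_def] of_bool_def by measurable

lemma large_excess_nonneg: "0 \<le> large_excess h a T j \<omega>"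
  by (simp add: large_excess_def K_nonneg)

text \<open>
  Slicing the excess \<open>Z\<close> at the integers gives \<open>Z\<^sup>2 1{Z > T} \<le> (\<Sum>i\<ge>T. (i + 1)\<^sup>2 1{Z > i})\<close>, so
  geometric decay of the slices makes the part above \<open>T\<close> exponentially small in \<open>T\<close>.
\<close>

lemma large_excess_moment:
  assumes a: "a > 0" and h: "h > 0" and \<delta>: "\<delta> > 0" and Q: "Q \<ge> 0"
    and slices: "\<And>i::nat. expectation (local_mass h {a * exp (real i)<..} 0) \<le> Q * exp (- \<delta> * real i) * h"
  shows "integrable M (large_excess h a T j)"
    and "expectation (large_excess h a T j) \<le> Q * h * exp (- \<delta> / 2 * real T) * excess_series \<delta>"
proof -
  define F where "F i \<omega> = (if i < T then 0 else ennreal ((real i + 1)\<^sup>2 * local_mass h {a * exp (real i)<..} j \<omega>))" for i :: nat and \<omega>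
  have Fm [measurable]: "F i \<in> borel_measurable M" for i unfolding F_def[abs_def] by measurable
  define q where "q = Q * h * exp (- \<delta> / 2 * real T)"
  have q0: "q \<ge> 0" using Q h by (simp add: q_def)
  have "ennreal (large_excess h a T j \<omega>) \<le> (\<Sum>i. F i \<omega>)" for \<omega>
  proof (cases "real T < log_plus (Y j \<omega> / a)")
    case True
    define z where "z = log_plus (Y j \<omega> / a)"
    define i where "i = nat (\<lceil>z\<rceil> - 1)"
    have "int T < \<lceil>z\<rceil>" using True unfolding z_def[symmetric] by (simp add: less_ceiling_iff)
    then have i: "real i < z" "z \<le> real i + 1" "T \<le> i" unfolding i_def by (auto simp: nat_le_iff) linarith+
    have "a * exp (real i) < Y j \<omega>" using i(1) a by (simp add: z_def log_plus_gt_iff)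
    then have Fi: "F i \<omega> = ennreal ((real i + 1)\<^sup>2 * K ((x - X j \<omega>) / h))" using i by (simp add: F_def local_mass_def)
    have "z\<^sup>2 \<le> (real i + 1)\<^sup>2" using i by (intro power_mono) auto
    then have "large_excess h a T j \<omega> \<le> (real i + 1)\<^sup>2 * K ((x - X j \<omega>) / h)"
      using True mult_right_mono[OF _ K_nonneg[of "(x - X j \<omega>) / h"]]
      by (simp add: large_excess_def z_def[symmetric] mult.commute[of "K _"])
    then have "ennreal (large_excess h a T j \<omega>) \<le> F i \<omega>" unfolding Fi by (rule ennreal_leI)
    also have "\<dots> \<le> (\<Sum>i. F i \<omega>)" using sum_le_suminf[of "\<lambda>i. F i \<omega>" "{i}"] by simp
    finally show ?thesis .
  qed (simp add: large_excess_def)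
  then have "(\<integral>\<^sup>+ \<omega>. ennreal (large_excess h a T j \<omega>) \<partial>M) \<le> (\<integral>\<^sup>+ \<omega>. (\<Sum>i. F i \<omega>) \<partial>M)" by (rule nn_integral_mono)
  also have "\<dots> = (\<Sum>i. \<integral>\<^sup>+ \<omega>. F i \<omega> \<partial>M)" by (rule nn_integral_suminf) measurable
  also have "\<dots> \<le> (\<Sum>i. ennreal (q * ((real i + 1)\<^sup>2 * exp (- \<delta> / 2 * real i))))"
  proof (rule suminf_le)
    fix i
    show "(\<integral>\<^sup>+ \<omega>. F i \<omega> \<partial>M) \<le> ennreal (q * ((real i + 1)\<^sup>2 * exp (- \<delta> / 2 * real i)))"
    proof (cases "i < T")
      case True
      then show ?thesis by (simp add: F_def)
    next
      case False
      have "(\<integral>\<^sup>+ \<omega>. F i \<omega> \<partial>M) = (\<integral>\<^sup>+ \<omega>. ennreal ((real i + 1)\<^sup>2 * local_mass h {a * exp (real i)<..} j \<omega>) \<partial>M)"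
        using False by (simp add: F_def)
      also have "\<dots> = ennreal (expectation (\<lambda>\<omega>. (real i + 1)\<^sup>2 * local_mass h {a * exp (real i)<..} j \<omega>))"
        by (rule nn_integral_eq_integral) (auto simp: local_mass_bounds)
      also have "\<dots> \<le> ennreal ((real i + 1)\<^sup>2 * (Q * exp (- \<delta> * real i) * h))"
        using slices[of i] by (auto intro!: ennreal_leI mult_left_mono simp: expectation_local_mass_shift[of _ h j])
      also have "\<dots> \<le> ennreal (q * ((real i + 1)\<^sup>2 * exp (- \<delta> / 2 * real i)))"
      proof (rule ennreal_leI)
        have "exp (- \<delta> * real i) = exp (- \<delta> / 2 * real i) * exp (- \<delta> / 2 * real i)"
          by (simp add: exp_add[symmetric])
        also have "\<dots> \<le> exp (- \<delta> / 2 * real T) * exp (- \<delta> / 2 * real i)"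
          using False \<delta> by (intro mult_right_mono) auto
        finally have "(Q * h * (real i + 1)\<^sup>2) * exp (- \<delta> * real i)
            \<le> (Q * h * (real i + 1)\<^sup>2) * (exp (- \<delta> / 2 * real T) * exp (- \<delta> / 2 * real i))"
          using Q h by (intro mult_left_mono) auto
        then show "(real i + 1)\<^sup>2 * (Q * exp (- \<delta> * real i) * h) \<le> q * ((real i + 1)\<^sup>2 * exp (- \<delta> / 2 * real i))"
          unfolding q_def by (simp add: mult_ac)
      qed
      finally show ?thesis .
    qed
  qed auto
  also have "\<dots> = ennreal (\<Sum>i. q * ((real i + 1)\<^sup>2 * exp (- \<delta> / 2 * real i)))"
    by (rule suminf_ennreal2) (use q0 summable_excess_series[OF \<delta>] in auto)
  also have "(\<Sum>i. q * ((real i + 1)\<^sup>2 * exp (- \<delta> / 2 * real i))) = q * excess_series \<delta>"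
    unfolding excess_series_def by (rule suminf_mult[OF summable_excess_series[OF \<delta>]])
  finally have le: "(\<integral>\<^sup>+ \<omega>. ennreal (large_excess h a T j \<omega>) \<partial>M) \<le> ennreal (q * excess_series \<delta>)" .
  show i: "integrable M (large_excess h a T j)"
  proof (rule integrableI_bounded)
    show "(\<integral>\<^sup>+ \<omega>. ennreal (norm (large_excess h a T j \<omega>)) \<partial>M) < \<infinity>"
      using le large_excess_nonneg by (auto intro: le_less_trans)
  qed simp
  have "ennreal (expectation (large_excess h a T j)) \<le> ennreal (q * excess_series \<delta>)"
    using le nn_integral_eq_integral[OF i] large_excess_nonneg by simp
  then show "expectation (large_excess h a T j) \<le> Q * h * exp (- \<delta> / 2 * real T) * excess_series \<delta>"
    unfolding q_def[symmetric] using q0 excess_series_nonneg[OF \<delta>] by (subst (asm) ennreal_le_iff) auto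
qed

text \<open>
  Truncating both excesses at \<open>T\<close> bounds their product by \<open>T\<^sup>2\<close> times the joint exceedance, up to
  \<open>Z\<^sup>2 1{Z > T}\<close> for the larger of the two.
\<close>

lemma log_excess_product_le:
  assumes a: "a > 0"
  shows "log_product h a j \<omega>
    \<le> (real T)\<^sup>2 * (local_mass h {a<..} 0 \<omega> * local_mass h {a<..} j \<omega>)
      + B * large_excess h a T 0 \<omega> + B * large_excess h a T j \<omega>"
proof -
  define k where "k = K ((x - X 0 \<omega>) / h)"
  define k' where "k' = K ((x - X j \<omega>) / h)"
  define z where "z = log_plus (Y 0 \<omega> / a)"
  define z' where "z' = log_plus (Y j \<omega> / a)"
  note defs = k_def k'_def z_def z'_def
  have k: "0 \<le> k" "k \<le> B" "0 \<le> k'" "k' \<le> B" and z: "0 \<le> z" "0 \<le> z'"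
    by (auto simp: defs K_nonneg K_le log_plus_nonneg)
  have ind: "indicator {a<..} (Y i \<omega>) = (of_bool (0 < log_plus (Y i \<omega> / a)) :: real)" for i
    using log_plus_gt_iff[OF a, of 0 "Y i \<omega>"] by (simp add: indicator_def)
  have "z * z' \<le> (real T)\<^sup>2 * (of_bool (0 < z) * of_bool (0 < z')) + z\<^sup>2 * of_bool (real T < z) + z'\<^sup>2 * of_bool (real T < z')"
  proof (cases "real T < max z z'")
    case True
    have nn: "0 \<le> (real T)\<^sup>2 * (of_bool (0 < z) * of_bool (0 < z'))" "0 \<le> z\<^sup>2 * of_bool (real T < z)" "0 \<le> z'\<^sup>2 * of_bool (real T < z')"
      by auto
    show ?thesis
    proof (cases "z' \<le> z")
      case True
      then have "z * z' \<le> z\<^sup>2 * of_bool (real T < z)" using z \<open>real T < max z z'\<close> by (auto simp: power2_eq_square mult_left_mono)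
      then show ?thesis using nn by linarith
    next
      case False
      then have "z * z' \<le> z'\<^sup>2 * of_bool (real T < z')" using z \<open>real T < max z z'\<close> by (auto simp: power2_eq_square mult_right_mono)
      then show ?thesis using nn by linarith
    qed
  next
    case False
    then have "z * z' \<le> (real T)\<^sup>2" using z unfolding power2_eq_square by (intro mult_mono) auto
    then show ?thesis using z False by (cases "z = 0 \<or> z' = 0") auto
  qed
  then have "(k * k') * (z * z') \<le> (k * k') * ((real T)\<^sup>2 * (of_bool (0 < z) * of_bool (0 < z')) + z\<^sup>2 * of_bool (real T < z) + z'\<^sup>2 * of_bool (real T < z'))"
    using k by (intro mult_left_mono) auto
  also have "\<dots> = (real T)\<^sup>2 * ((k * of_bool (0 < z)) * (k' * of_bool (0 < z')))
      + k' * (k * (z\<^sup>2 * of_bool (real T < z))) + k * (k' * (z'\<^sup>2 * of_bool (real T < z')))"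
    by (simp add: algebra_simps)
  also have "\<dots> \<le> (real T)\<^sup>2 * ((k * of_bool (0 < z)) * (k' * of_bool (0 < z')))
      + B * (k * (z\<^sup>2 * of_bool (real T < z))) + B * (k' * (z'\<^sup>2 * of_bool (real T < z')))"
    using k by (intro add_mono mult_right_mono) auto
  finally show ?thesis by (simp add: defs local_mass_def large_excess_def ind mult.assoc)
qed

lemma log_excess_product_expectation:
  assumes a: "a > 0" and h: "h > 0" and \<delta>: "\<delta> > 0" and Q: "Q \<ge> 0"
    and slices: "\<And>i::nat. expectation (local_mass h {a * exp (real i)<..} 0) \<le> Q * exp (- \<delta> * real i) * h"
  shows "integrable M (log_product h a j)"
    and "expectation (log_product h a j)
      \<le> (real T)\<^sup>2 * expectation (\<lambda>\<omega>. local_mass h {a<..} 0 \<omega> * local_mass h {a<..} j \<omega>)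
        + 2 * B * (Q * h * exp (- \<delta> / 2 * real T) * excess_series \<delta>)"
proof -
  let ?f = "log_product h a j"
  let ?g = "\<lambda>T \<omega>. (real T)\<^sup>2 * (local_mass h {a<..} 0 \<omega> * local_mass h {a<..} j \<omega>)
      + B * large_excess h a T 0 \<omega> + B * large_excess h a T j \<omega>"
  note L = large_excess_moment[OF a h \<delta> Q slices]
  have ig: "integrable M (?g T)" for T using L(1) by auto
  have le: "?f \<omega> \<le> ?g T \<omega>" for \<omega> T by (rule log_excess_product_le[OF a])
  have f0: "0 \<le> ?f \<omega>" for \<omega> by (simp add: K_nonneg log_plus_nonneg)
  show i: "integrable M ?f"
  proof (rule Bochner_Integration.integrable_bound[OF ig[of 0]])
    have "norm (?f \<omega>) \<le> norm (?g 0 \<omega>)" for \<omega>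
      unfolding real_norm_def abs_of_nonneg[OF f0] by (rule order_trans[OF le abs_ge_self])
    then show "AE \<omega> in M. norm (?f \<omega>) \<le> norm (?g 0 \<omega>)" by simp
  qed measurable
  have "expectation ?f \<le> expectation (?g T)" by (rule integral_mono[OF i ig le])
  also have "\<dots> = (real T)\<^sup>2 * expectation (\<lambda>\<omega>. local_mass h {a<..} 0 \<omega> * local_mass h {a<..} j \<omega>)
      + B * expectation (large_excess h a T 0) + B * expectation (large_excess h a T j)"
    using L(1) by simp
  also have "\<dots> \<le> (real T)\<^sup>2 * expectation (\<lambda>\<omega>. local_mass h {a<..} 0 \<omega> * local_mass h {a<..} j \<omega>)
      + B * (Q * h * exp (- \<delta> / 2 * real T) * excess_series \<delta>) + B * (Q * h * exp (- \<delta> / 2 * real T) * excess_series \<delta>)"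
    by (intro add_mono mult_left_mono L(2) order_refl) (use B_pos in auto)
  finally show "expectation ?f \<le> (real T)\<^sup>2 * expectation (\<lambda>\<omega>. local_mass h {a<..} 0 \<omega> * local_mass h {a<..} j \<omega>)
        + 2 * B * (Q * h * exp (- \<delta> / 2 * real T) * excess_series \<delta>)"
    by (simp add: algebra_simps)
qed

end

section \<open>A power integral and limits of tail sums\<close>

lemma set_integrable_powr_atLeast_1:
  assumes "\<beta> > 0"
  shows "set_integrable lborel {1..} (\<lambda>t::real. t powr (- \<beta> - 1))"
    and "(LINT t:{1..}|lborel. t powr (- \<beta> - 1)) = 1 / \<beta>"
proof -
  have nn: "(\<integral>\<^sup>+ t. ennreal (t powr (- \<beta> - 1)) * indicator {1..} t \<partial>lborel) = ennreal (0 - (- (1 / \<beta>) * 1 powr (- \<beta>)))"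
  proof (rule nn_integral_FTC_atLeast[where F = "\<lambda>t. - (1 / \<beta>) * t powr (- \<beta>)" and T = 0])
    fix t :: real assume t: "1 \<le> t"
    show "((\<lambda>t. - (1 / \<beta>) * t powr (- \<beta>)) has_real_derivative t powr (- \<beta> - 1)) (at t)"
      using t assms by (auto intro!: derivative_eq_intros simp: field_simps powr_diff)
  next
    show "((\<lambda>t. - (1 / \<beta>) * t powr (- \<beta>)) \<longlongrightarrow> 0) at_top"
      using tendsto_mult[OF tendsto_const[of "- (1 / \<beta>)"] tendsto_neg_powr[of "- \<beta>" "\<lambda>t. t" at_top]] assms
      by (simp add: filterlim_ident)
  qed auto
  have nn': "(\<integral>\<^sup>+ t. ennreal (indicator {1..} t *\<^sub>R t powr (- \<beta> - 1)) \<partial>lborel) = ennreal (1 / \<beta>)"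
    using nn by (simp add: mult.commute indicator_mult_ennreal)
  then have "has_bochner_integral lborel (\<lambda>t. indicator {1..} t *\<^sub>R t powr (- \<beta> - 1)) (1 / \<beta>)"
    using assms by (intro has_bochner_integral_nn_integral) auto
  then show "set_integrable lborel {1..} (\<lambda>t::real. t powr (- \<beta> - 1))"
    and "(LINT t:{1..}|lborel. t powr (- \<beta> - 1)) = 1 / \<beta>"
    by (auto simp: set_integrable_def set_lebesgue_integral_def has_bochner_integral_iff)
qed

lemma limsup_of_tail_sums:
  fixes a :: "nat \<Rightarrow> nat \<Rightarrow> real"
  assumes nonneg: "\<And>n j. 0 \<le> a n j" and lim: "(\<lambda>n. \<Sum>j=1..r n. a n j) \<longlonglongrightarrow> 0"
  shows "(\<lambda>m. limsup (\<lambda>n. ereal (\<Sum>j=m..r n. a n j))) \<longlonglongrightarrow> 0"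
proof (rule tendsto_eventually)
  show "\<forall>\<^sub>F m in sequentially. limsup (\<lambda>n. ereal (\<Sum>j=m..r n. a n j)) = 0"
    using eventually_ge_at_top[of 1]
  proof eventually_elim
    case (elim m)
    have "norm (\<Sum>j=m..r n. a n j) \<le> (\<Sum>j=1..r n. a n j)" for n
      using sum_mono2[of "{1..r n}" "{m..r n}" "a n"] elim nonneg by (simp add: sum_nonneg)
    then have "(\<lambda>n. \<Sum>j=m..r n. a n j) \<longlonglongrightarrow> 0" by (intro Lim_null_comparison[OF _ lim]) simp
    then have "(\<lambda>n. ereal (\<Sum>j=m..r n. a n j)) \<longlonglongrightarrow> 0" by (simp add: zero_ereal_def)
    then show ?case by (rule lim_imp_Limsup[OF sequentially_bot])
  qed
qed

section \<open>Mean square error of the density estimator\<close>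

context kernel_series begin

lemma cond_tail_eq: "cond_tail \<kappa> v y = measure (\<kappa> v) {y<..}"
proof -
  interpret k: prob_space "\<kappa> v" by (rule cond_prob_space)
  have sp: "space (\<kappa> v) = UNIV" using sets_eq_imp_space_eq[OF cond_sets] by simp
  have "measure (\<kappa> v) (space (\<kappa> v) - {..y}) = 1 - measure (\<kappa> v) {..y}"
    by (rule k.prob_compl) (simp add: cond_sets)
  moreover have "space (\<kappa> v) - {..y} = {y<..}" using sp by auto
  ultimately show ?thesis by (simp add: cond_tail_def cond_cdf_def cdf_def)
qed

lemma cond_tail_antimono: "y \<le> y' \<Longrightarrow> cond_tail \<kappa> v y' \<le> cond_tail \<kappa> v y"
proof -
  assume "y \<le> y'"
  interpret k: prob_space "\<kappa> v" by (rule cond_prob_space)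
  show ?thesis unfolding cond_tail_eq
    by (rule k.finite_measure_mono) (use \<open>y \<le> y'\<close> in \<open>auto simp: cond_sets\<close>)
qed

lemma cond_tail_nonneg: "0 \<le> cond_tail \<kappa> v y"
  by (simp add: cond_tail_eq)

text \<open>
  With \<open>p\<close> the lag beyond which mixing takes over from the joint densities, the mean square
  error of the density estimator is governed by \<open>1 / (n h)\<close> times a bounded factor and by the
  squared bias \<open>(G h)\<^sup>2\<close>.
\<close>

lemma density_estimator_mse:
  assumes h: "0 < h n" "h n \<le> 1" and p: "p \<ge> 1" and n: "n \<ge> 1"
  shows "integrable M (\<lambda>\<omega>. (g x - density_estimator K x h X n \<omega>)\<^sup>2)"
    and "expectation (\<lambda>\<omega>. (g x - density_estimator K x h X n \<omega>)\<^sup>2)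
      \<le> 2 / (real n * h n) * (B * g_bound + 2 * (real p * h n * (J + g_bound\<^sup>2)
          + real p powr (- \<eta> / 2) / h n * (B\<^sup>2 * A * lag_series))) + 2 * (G * h n)\<^sup>2"
proof -
  let ?W = "local_mass (h n) UNIV"
  define m where "m = expectation (?W 0)"
  define S where "S \<omega> = (\<Sum>j=1..int n. ?W j \<omega> - m)" for \<omega>
  have est: "density_estimator K x h X n \<omega> = (\<Sum>j=1..int n. ?W j \<omega>) / (real n * h n)" for \<omega>
    by (simp add: density_estimator_def kernel_weight_def local_mass_def)
  have nh: "real n * h n > 0" using h n by simp
  have dec: "g x - density_estimator K x h X n \<omega> = (g x - m / h n) - S \<omega> / (real n * h n)" for \<omega>
    unfolding est S_def using nh n h by (simp add: sum_subtractf field_simps)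
  have bias: "\<bar>g x - m / h n\<bar> \<le> G * h n"
  proof -
    have u: "measure (\<kappa> v) UNIV = 1" for v
      using prob_space.prob_space[OF cond_prob_space[of v]] sets_eq_imp_space_eq[OF cond_sets[of v]] by simp
    have "\<bar>m / (h n * 1) - g x\<bar> \<le> G * h n"
      unfolding m_def
    proof (rule local_mean_error[OF _ h])
      fix v assume v: "\<bar>v - x\<bar> \<le> h n"
      show "\<bar>measure (\<kappa> v) UNIV / 1 * g v - g x\<bar> \<le> G * h n"
        using g_lipschitz[of v] mult_left_mono[OF v G_nonneg] v h by (simp add: u)
    qed auto
    then show ?thesis by (simp add: abs_minus_commute)
  qed
  have sq: "(a - b)\<^sup>2 \<le> 2 * a\<^sup>2 + 2 * b\<^sup>2" for a b :: real
    using zero_le_power2[of "a + b"] by (simp add: power2_eq_square algebra_simps)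
  have le: "(g x - density_estimator K x h X n \<omega>)\<^sup>2 \<le> 2 * (G * h n)\<^sup>2 + 2 / (real n * h n)\<^sup>2 * (S \<omega>)\<^sup>2" for \<omega>
  proof -
    have "(g x - density_estimator K x h X n \<omega>)\<^sup>2 \<le> 2 * (g x - m / h n)\<^sup>2 + 2 * (S \<omega> / (real n * h n))\<^sup>2"
      unfolding dec by (rule sq)
    also have "(g x - m / h n)\<^sup>2 \<le> (G * h n)\<^sup>2" using bias by (metis abs_ge_zero power2_abs power_mono)
    finally show ?thesis by (simp add: power_divide)
  qed
  have [measurable]: "S \<in> borel_measurable M" unfolding S_def[abs_def] by measurable
  have Sb: "\<bar>S \<omega>\<bar> \<le> real n * (B + \<bar>m\<bar>)" for \<omega>
  proof -
    have "\<bar>S \<omega>\<bar> \<le> (\<Sum>j=1..int n. \<bar>?W j \<omega> - m\<bar>)" unfolding S_def by (rule sum_abs)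
    also have "\<dots> \<le> (\<Sum>j=1..int n. B + \<bar>m\<bar>)"
    proof (rule sum_mono)
      fix j show "\<bar>?W j \<omega> - m\<bar> \<le> B + \<bar>m\<bar>" using local_mass_bounds[of "h n" UNIV j \<omega>] by linarith
    qed
    finally show ?thesis by simp
  qed
  have iS: "integrable M (\<lambda>\<omega>. (S \<omega>)\<^sup>2)"
  proof (rule integrable_bounded)
    fix \<omega>
    show "\<bar>(S \<omega>)\<^sup>2\<bar> \<le> (real n * (B + \<bar>m\<bar>))\<^sup>2" using Sb[of \<omega>] by (metis abs_ge_zero abs_power2 power2_abs power_mono)
  qed simp
  have iR: "integrable M (\<lambda>\<omega>. 2 * (G * h n)\<^sup>2 + 2 / (real n * h n)\<^sup>2 * (S \<omega>)\<^sup>2)" using iS by auto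
  have [measurable]: "density_estimator K x h X n \<in> borel_measurable M"
    unfolding est[abs_def] by measurable
  show i: "integrable M (\<lambda>\<omega>. (g x - density_estimator K x h X n \<omega>)\<^sup>2)"
  proof (rule Bochner_Integration.integrable_bound[OF iR])
    show "AE \<omega> in M. norm ((g x - density_estimator K x h X n \<omega>)\<^sup>2) \<le> norm (2 * (G * h n)\<^sup>2 + 2 / (real n * h n)\<^sup>2 * (S \<omega>)\<^sup>2)"
      by (rule AE_I2) (use order_trans[OF le abs_ge_self] in simp)
  qed measurable
  have "expectation (\<lambda>\<omega>. (g x - density_estimator K x h X n \<omega>)\<^sup>2)
      \<le> expectation (\<lambda>\<omega>. 2 * (G * h n)\<^sup>2 + 2 / (real n * h n)\<^sup>2 * (S \<omega>)\<^sup>2)"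
    by (rule integral_mono[OF i iR le])
  also have "\<dots> = 2 * (G * h n)\<^sup>2 + 2 / (real n * h n)\<^sup>2 * expectation (\<lambda>\<omega>. (S \<omega>)\<^sup>2)"
    using iS by (simp add: prob_space)
  also have "\<dots> \<le> 2 * (G * h n)\<^sup>2 + 2 / (real n * h n)\<^sup>2 * (real n * (B * g_bound * h n
      + 2 * (real p * ((J + g_bound\<^sup>2) * (h n)\<^sup>2) + B\<^sup>2 * A * real p powr (- \<eta> / 2) * lag_series)))"
    unfolding S_def m_def by (intro add_left_mono mult_left_mono kernel_sum_variance_le h p) auto
  also have "2 / (real n * h n)\<^sup>2 * (real n * (B * g_bound * h n
      + 2 * (real p * ((J + g_bound\<^sup>2) * (h n)\<^sup>2) + B\<^sup>2 * A * real p powr (- \<eta> / 2) * lag_series)))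
    = 2 / (real n * h n) * (B * g_bound + 2 * (real p * h n * (J + g_bound\<^sup>2)
          + real p powr (- \<eta> / 2) / h n * (B\<^sup>2 * A * lag_series)))"
    using h n by (simp add: field_simps power2_eq_square)
  finally show "expectation (\<lambda>\<omega>. (g x - density_estimator K x h X n \<omega>)\<^sup>2)
      \<le> 2 / (real n * h n) * (B * g_bound + 2 * (real p * h n * (J + g_bound\<^sup>2)
          + real p powr (- \<eta> / 2) / h n * (B\<^sup>2 * A * lag_series))) + 2 * (G * h n)\<^sup>2"
    by linarith
qed

lemma density_estimator_consistent:
  assumes h: "\<And>n. h n > 0" "\<forall>\<^sub>F n in sequentially. h n \<le> 1" and p: "\<forall>\<^sub>F n in sequentially. p n \<ge> 1"
    and N: "\<And>n. N n \<ge> 0"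
    and lims: "(\<lambda>n. N n / (real n * h n)) \<longlonglongrightarrow> 0" "(\<lambda>n. real (p n) * h n) \<longlonglongrightarrow> 0"
      "(\<lambda>n. real (p n) powr (- \<eta> / 2) / h n) \<longlonglongrightarrow> 0" "(\<lambda>n. N n * (h n)\<^sup>2) \<longlonglongrightarrow> 0"
  shows "tends_to_zero_in_prob M (\<lambda>n \<omega>. sqrt (N n) * (g x - density_estimator K x h X n \<omega>))"
  unfolding tends_to_zero_in_prob_def
proof (intro allI impI)
  fix \<epsilon> :: real assume \<epsilon>: "\<epsilon> > 0"
  define R where "R n = 2 * (N n / (real n * h n)) * (B * g_bound + 2 * (real (p n) * h n * (J + g_bound\<^sup>2)
          + real (p n) powr (- \<eta> / 2) / h n * (B\<^sup>2 * A * lag_series))) + 2 * G\<^sup>2 * (N n * (h n)\<^sup>2)" for n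
  have "R \<longlonglongrightarrow> 2 * 0 * (B * g_bound + 2 * (0 * (J + g_bound\<^sup>2) + 0 * (B\<^sup>2 * A * lag_series))) + 2 * G\<^sup>2 * 0"
    unfolding R_def by (intro tendsto_intros lims)
  then have R: "(\<lambda>n. R n / \<epsilon>\<^sup>2) \<longlonglongrightarrow> 0" using tendsto_divide_zero by auto
  have "\<forall>\<^sub>F n in sequentially. norm (prob {\<omega> \<in> space M. \<bar>sqrt (N n) * (g x - density_estimator K x h X n \<omega>)\<bar> > \<epsilon>}) \<le> R n / \<epsilon>\<^sup>2"
    using h(2) p eventually_ge_at_top[of 1]
  proof eventually_elim
    case (elim n)
    let ?D = "\<lambda>\<omega>. g x - density_estimator K x h X n \<omega>"
    note mse = density_estimator_mse[where h = h and n = n and p = "p n", OF h(1) elim]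
    have eq: "(sqrt (N n) * ?D \<omega>)\<^sup>2 = N n * (?D \<omega>)\<^sup>2" for \<omega> using N[of n] by (simp add: power_mult_distrib)
    have [measurable]: "?D \<in> borel_measurable M"
      unfolding density_estimator_def kernel_weight_def by measurable
    have "prob {\<omega> \<in> space M. \<bar>sqrt (N n) * ?D \<omega>\<bar> > \<epsilon>} \<le> prob {\<omega> \<in> space M. \<bar>sqrt (N n) * ?D \<omega>\<bar> \<ge> \<epsilon>}"
      by (intro finite_measure_mono) auto
    also have "\<dots> \<le> expectation (\<lambda>\<omega>. (sqrt (N n) * ?D \<omega>)\<^sup>2) / \<epsilon>\<^sup>2"
      by (rule second_moment_method) (use \<epsilon> mse(1) in \<open>auto simp: eq\<close>)
    also have "\<dots> = N n * expectation (\<lambda>\<omega>. (?D \<omega>)\<^sup>2) / \<epsilon>\<^sup>2" by (simp add: eq)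
    also have "\<dots> \<le> N n * (2 / (real n * h n) * (B * g_bound + 2 * (real (p n) * h n * (J + g_bound\<^sup>2)
          + real (p n) powr (- \<eta> / 2) / h n * (B\<^sup>2 * A * lag_series))) + 2 * (G * h n)\<^sup>2) / \<epsilon>\<^sup>2"
      by (intro divide_right_mono mult_left_mono mse(2) N) auto
    also have "\<dots> = R n / \<epsilon>\<^sup>2" by (simp add: R_def algebra_simps power_mult_distrib)
    finally show ?case by simp
  qed
  then show "(\<lambda>n. prob {\<omega> \<in> space M. \<bar>sqrt (N n) * (g x - density_estimator K x h X n \<omega>)\<bar> > \<epsilon>}) \<longlonglongrightarrow> 0"
    by (rule Lim_null_comparison[OF _ R])
qed

end

section \<open>Limits along a diverging threshold\<close>

locale kernel_tail_series = kernel_series M X Y g K \<kappa> x B J G A \<eta>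
    + power_tail_family "cond_tail \<kappa>" x d c y\<^sub>0 \<alpha> \<zeta> b D
  for M :: "'a measure" and X Y g K \<kappa> x B J G A \<eta> d c y\<^sub>0 \<alpha> \<zeta> b D +
  fixes h u :: "nat \<Rightarrow> real"
  assumes h_pos: "\<And>n. h n > 0"
    and h_lim: "h \<longlonglongrightarrow> 0"
    and u_lim: "filterlim u at_top sequentially"
    and hu_lim: "(\<lambda>n. h n * ln (u n)) \<longlonglongrightarrow> 0"
begin

definition tail_level :: "nat \<Rightarrow> real" where "tail_level n = cond_tail \<kappa> x (u n)"

definition bias_rate :: "nat \<Rightarrow> real" where
  "bias_rate n = h n * ln (u n) + u n powr (- (\<zeta> - \<alpha>))"

abbreviation tail_mass :: "nat \<Rightarrow> real \<Rightarrow> real" where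
  "tail_mass n t \<equiv> expectation (local_mass (h n) {t * u n<..} 0)"

abbreviation joint_tail_mass :: "nat \<Rightarrow> real \<Rightarrow> real \<Rightarrow> nat \<Rightarrow> real" where
  "joint_tail_mass n s t j \<equiv>
     expectation (\<lambda>\<omega>. local_mass (h n) {s * u n<..} 0 \<omega> * local_mass (h n) {t * u n<..} (int j) \<omega>)"

lemma eventually_u_ge: "\<forall>\<^sub>F n in sequentially. u n \<ge> c'"
  using u_lim by (simp add: filterlim_at_top)

lemma eventually_h_le: "\<delta> > 0 \<Longrightarrow> \<forall>\<^sub>F n in sequentially. h n \<le> \<delta>"
  using order_tendstoD(2)[OF h_lim, of \<delta>] by (auto elim: eventually_mono)

lemma eventually_hu_le: "\<delta> > 0 \<Longrightarrow> \<forall>\<^sub>F n in sequentially. h n * ln (u n) \<le> \<delta>"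
  using order_tendstoD(2)[OF hu_lim, of \<delta>] by (auto elim: eventually_mono)

lemma eventually_tail_level_pos: "\<forall>\<^sub>F n in sequentially. tail_level n > 0"
  using eventually_u_ge[of y\<^sub>0] by eventually_elim (use tail_pos[of x] d_pos in \<open>auto simp: tail_level_def\<close>)

lemma bias_rate_lim: "bias_rate \<longlonglongrightarrow> 0"
proof -
  have "(\<lambda>n. u n powr (- (\<zeta> - \<alpha>))) \<longlonglongrightarrow> 0"
    by (rule tendsto_neg_powr[OF _ u_lim]) (use zeta_gt in simp)
  then show ?thesis unfolding bias_rate_def using tendsto_add[OF hu_lim] by force
qed

text \<open>
  The normalised mean is a kernel average over the window of \<open>T v (t u) / T x u \<cdot> g v\<close>. Replacing \<open>v\<close> by \<open>x\<close>
  costs the error of the scaled tail and \<open>O (h)\<close> for the density, and \<open>h \<le> h ln u\<close> once \<open>u \<ge> exp 1\<close>.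
\<close>

lemma local_tail_mean:
  assumes s0: "0 < s\<^sub>0" "s\<^sub>0 \<le> 1"
  obtains C where "C > 0" "\<forall>\<^sub>F n in sequentially. \<forall>t\<ge>s\<^sub>0.
     \<bar>tail_mass n t / (h n * tail_level n) - t powr (- \<alpha>) * g x\<bar>
       \<le> C * bias_rate n * t powr (- \<alpha> / 2)"
proof -
  obtain C \<delta> u\<^sub>1 where C: "C > 0" "\<delta> > 0" "u\<^sub>1 \<ge> exp 1" 
    and err: "\<And>u h v t. u \<ge> u\<^sub>1 \<Longrightarrow> 0 < h \<Longrightarrow> h \<le> \<delta> \<Longrightarrow> h * ln u \<le> \<delta> \<Longrightarrow> \<bar>v - x\<bar> \<le> h \<Longrightarrow> t \<ge> s\<^sub>0 \<Longrightarrow>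
      \<bar>cond_tail \<kappa> v (t * u) / cond_tail \<kappa> x u - t powr (- \<alpha>)\<bar> \<le> C * (h * ln u + u powr (- (\<zeta> - \<alpha>))) * t powr (- \<alpha> / 2)"
    using scaled_tail_error[OF s0] by metis
  define C' where "C' = C * g_bound + G * s\<^sub>0 powr (- \<alpha> / 2) + 1"
  have C': "C' > 0" unfolding C'_def using C g_bound_nonneg G_nonneg by (simp add: add_nonneg_pos)
  show thesis
  proof (rule that[OF C'])
    show "\<forall>\<^sub>F n in sequentially. \<forall>t\<ge>s\<^sub>0.
     \<bar>tail_mass n t / (h n * tail_level n) - t powr (- \<alpha>) * g x\<bar>
       \<le> C' * bias_rate n * t powr (- \<alpha> / 2)"
      using eventually_u_ge[of u\<^sub>1] eventually_h_le[OF C(2)] eventually_h_le[of 1, OF zero_less_one]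
        eventually_hu_le[OF C(2)] eventually_tail_level_pos
    proof eventually_elim
      case (elim n)
      note hn = h_pos[of n]
      have "(1::real) < exp 1" by simp
      then have u1: "u n > 1" "u n \<ge> exp 1" using elim(1) C(3) by linarith+
      then have lnu: "ln (u n) \<ge> 1" by (simp add: ln_ge_iff)
      have rate: "h n \<le> bias_rate n" "0 \<le> bias_rate n"
        using mult_left_mono[OF lnu, of "h n"] hn unfolding bias_rate_def by (auto intro: add_increasing2)
      show ?case
      proof (intro allI impI)
        fix t assume t: "t \<ge> s\<^sub>0"
        then have t0: "t > 0" using s0 by linarith
        define F where "F v = cond_tail \<kappa> v (t * u n) / tail_level n" for v
        have ptw: "\<bar>F v * g v - t powr (- \<alpha>) * g x\<bar> \<le> C' * bias_rate n * t powr (- \<alpha> / 2)" if v: "\<bar>v - x\<bar> \<le> h n" for v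
        proof -
          have v1: "\<bar>v - x\<bar> \<le> 1" using v elim by linarith
          have decay: "t powr (- \<alpha>) \<le> s\<^sub>0 powr (- \<alpha> / 2) * t powr (- \<alpha> / 2)"
            using powr_half_decay[OF s0(1) t] alpha_pos by simp
          have "F v * g v - t powr (- \<alpha>) * g x = (F v - t powr (- \<alpha>)) * g v + t powr (- \<alpha>) * (g v - g x)"
            by (simp add: algebra_simps)
          also have "\<bar>\<dots>\<bar> \<le> \<bar>F v - t powr (- \<alpha>)\<bar> * g v + t powr (- \<alpha>) * \<bar>g v - g x\<bar>"
            by (rule order_trans[OF abs_triangle_ineq]) (simp add: abs_mult g_nonneg)
          also have "\<dots> \<le> (C * bias_rate n * t powr (- \<alpha> / 2)) * g_bound + (s\<^sub>0 powr (- \<alpha> / 2) * t powr (- \<alpha> / 2)) * (G * bias_rate n)"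
          proof (intro add_mono mult_mono decay)
            show "\<bar>F v - t powr (- \<alpha>)\<bar> \<le> C * bias_rate n * t powr (- \<alpha> / 2)"
              unfolding F_def tail_level_def bias_rate_def by (rule err) (use elim hn v t in auto)
            show "g v \<le> g_bound" by (rule g_le[OF v1])
            have "\<bar>v - x\<bar> \<le> bias_rate n" using v rate by linarith
            then show "\<bar>g v - g x\<bar> \<le> G * bias_rate n"
              using g_lipschitz[OF v1] mult_left_mono[OF _ G_nonneg] by (meson order_trans)
          qed (use C rate g_nonneg in auto)
          also have "\<dots> = (C * g_bound + G * s\<^sub>0 powr (- \<alpha> / 2)) * (bias_rate n * t powr (- \<alpha> / 2))"
            by (simp add: algebra_simps)
          also have "\<dots> \<le> C' * (bias_rate n * t powr (- \<alpha> / 2))"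
            unfolding C'_def using rate by (intro mult_right_mono) auto
          finally show ?thesis by (simp add: mult.assoc)
        qed
        show "\<bar>tail_mass n t / (h n * tail_level n) - t powr (- \<alpha>) * g x\<bar> \<le> C' * bias_rate n * t powr (- \<alpha> / 2)"
          by (rule local_mean_error[OF _ hn elim(3,5)]) (use ptw in \<open>auto simp: F_def cond_tail_eq\<close>)
      qed
    qed
  qed
qed

lemma local_tail_mass_le:
  assumes s: "s > 0"
  obtains C where "C \<ge> 0" "\<forall>\<^sub>F n in sequentially. tail_mass n s \<le> C * (h n * tail_level n)"
proof -
  define s\<^sub>0 where "s\<^sub>0 = min s 1"
  have s0: "0 < s\<^sub>0" "s\<^sub>0 \<le> 1" using s by (auto simp: s\<^sub>0_def)
  obtain C where C: "C > 0" "\<forall>\<^sub>F n in sequentially. \<forall>t\<ge>s\<^sub>0.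
     \<bar>tail_mass n t / (h n * tail_level n) - t powr (- \<alpha>) * g x\<bar>
       \<le> C * bias_rate n * t powr (- \<alpha> / 2)"
    by (rule local_tail_mean[OF s0])
  have r1: "\<forall>\<^sub>F n in sequentially. bias_rate n < 1" using order_tendstoD(2)[OF bias_rate_lim] by simp
  show thesis
  proof (rule that)
    show "0 \<le> s powr (- \<alpha>) * g x + C * s powr (- \<alpha> / 2)" using C g_nonneg by simp
    show "\<forall>\<^sub>F n in sequentially. tail_mass n s
        \<le> (s powr (- \<alpha>) * g x + C * s powr (- \<alpha> / 2)) * (h n * tail_level n)"
      using C(2) r1 eventually_tail_level_pos
    proof eventually_elim
      case (elim n)
      have "s \<ge> s\<^sub>0" by (simp add: s\<^sub>0_def)
      then have "\<bar>tail_mass n s / (h n * tail_level n) - s powr (- \<alpha>) * g x\<bar>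
          \<le> C * bias_rate n * s powr (- \<alpha> / 2)" using elim by blast
      also have "\<dots> \<le> C * 1 * s powr (- \<alpha> / 2)" using C elim by (intro mult_right_mono mult_left_mono) auto
      finally have "tail_mass n s / (h n * tail_level n)
          \<le> s powr (- \<alpha>) * g x + C * s powr (- \<alpha> / 2)" by (simp add: abs_le_iff)
      then show ?case using elim h_pos[of n] by (simp add: pos_divide_le_eq)
    qed
  qed
qed

text \<open>
  The anticlustering estimate. Relative to \<open>h \<cdot> tail_level\<close>, the lags up to \<open>p\<close> cost
  \<open>p h / tail_level\<close>, by the bounded joint densities, and the larger lags cost the product of the
  means plus the mixing remainder. The weight \<open>w\<close> leaves room for squared truncation levels.
\<close>

lemma joint_exceedance_sum_lim:
  assumes s: "s > 0" and t: "t > 0" and w: "\<And>n. w n \<ge> 0" and p: "\<forall>\<^sub>F n in sequentially. p n \<ge> 1"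
    and lims: "(\<lambda>n. w n * (real (p n) * h n / tail_level n)) \<longlonglongrightarrow> 0"
      "(\<lambda>n. w n * (real (r n) * (h n * tail_level n))) \<longlonglongrightarrow> 0"
      "(\<lambda>n. w n * (real (p n) powr (- \<eta> / 2) / (h n * tail_level n))) \<longlonglongrightarrow> 0"
  shows "(\<lambda>n. w n * ((\<Sum>j=1..r n. joint_tail_mass n s t j)
      / (h n * tail_level n))) \<longlonglongrightarrow> 0"
proof -
  obtain C1 where C1: "C1 \<ge> 0" "\<forall>\<^sub>F n in sequentially. tail_mass n s \<le> C1 * (h n * tail_level n)"
    by (rule local_tail_mass_le[OF s])
  obtain C2 where C2: "C2 \<ge> 0" "\<forall>\<^sub>F n in sequentially. tail_mass n t \<le> C2 * (h n * tail_level n)"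
    by (rule local_tail_mass_le[OF t])
  define C where "C = max C1 C2"
  define R where "R n = J * (w n * (real (p n) * h n / tail_level n)) + C\<^sup>2 * (w n * (real (r n) * (h n * tail_level n)))
      + B\<^sup>2 * A * lag_series * (w n * (real (p n) powr (- \<eta> / 2) / (h n * tail_level n)))" for n
  have "R \<longlonglongrightarrow> J * 0 + C\<^sup>2 * 0 + B\<^sup>2 * A * lag_series * 0"
    unfolding R_def by (intro tendsto_intros lims)
  then have R: "R \<longlonglongrightarrow> 0" by simp
  show ?thesis
  proof (rule Lim_null_comparison[OF _ R])
    show "\<forall>\<^sub>F n in sequentially. norm (w n * ((\<Sum>j=1..r n. joint_tail_mass n s t j)
      / (h n * tail_level n))) \<le> R n"
      using C1(2) C2(2) p eventually_tail_level_pos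
    proof eventually_elim
      case (elim n)
      define H where "H = h n * tail_level n"
      have H: "H > 0" using elim h_pos[of n] by (simp add: H_def)
      define \<Sigma> where "\<Sigma> = (\<Sum>j=1..r n. joint_tail_mass n s t j)"
      have S0: "\<Sigma> \<ge> 0" unfolding \<Sigma>_def
        by (intro sum_nonneg Bochner_Integration.integral_nonneg) (simp add: local_mass_bounds)
      have "C1 * H \<le> C * H" "C2 * H \<le> C * H" using H by (auto simp: C_def intro!: mult_right_mono)
      then have m: "tail_mass n s \<le> C * H" "tail_mass n t \<le> C * H"
        using elim(1,2) unfolding H_def by linarith+
      have "\<Sigma> \<le> real (p n) * (J * (h n)\<^sup>2) + real (r n) * (C * H)\<^sup>2 + B\<^sup>2 * A * real (p n) powr (- \<eta> / 2) * lag_series"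
        unfolding \<Sigma>_def by (rule sum_pair_expectations_le) (use m h_pos[of n] elim in auto)
      then have "w n * (\<Sigma> / H) \<le> w n * ((real (p n) * (J * (h n)\<^sup>2) + real (r n) * (C * H)\<^sup>2 + B\<^sup>2 * A * real (p n) powr (- \<eta> / 2) * lag_series) / H)"
        using w[of n] H by (intro mult_left_mono divide_right_mono) auto
      also have "\<dots> = J * (w n * (real (p n) * (h n)\<^sup>2 / H)) + C\<^sup>2 * (w n * (real (r n) * H)) + B\<^sup>2 * A * lag_series * (w n * (real (p n) powr (- \<eta> / 2) / H))"
        using H by (simp add: field_simps power2_eq_square)
      also have "real (p n) * (h n)\<^sup>2 / H = real (p n) * h n / tail_level n"
        using h_pos[of n] by (simp add: H_def power2_eq_square)
      finally have "w n * (\<Sigma> / H) \<le> R n" unfolding R_def H_def .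
      then show ?case using S0 w[of n] H unfolding \<Sigma>_def[symmetric] H_def[symmetric] by simp
    qed
  qed
qed

text \<open>
  Multiplying the threshold by \<open>exp i\<close> gains \<open>exp (- \<alpha> i / 2)\<close> uniformly over the window, which is the
  geometric decay that the truncation of log-excesses relies on.
\<close>

lemma log_excess_slices:
  assumes A': "A' > 0"
  obtains Q where "Q \<ge> 0" "\<forall>\<^sub>F n in sequentially. \<forall>i::nat.
     expectation (local_mass (h n) {u n * A' * exp (real i)<..} 0) \<le> Q * exp (- (\<alpha> / 2) * real i) * h n"
proof -
  obtain C \<delta> y\<^sub>1 where C: "C > 0" "\<delta> > 0" "y\<^sub>1 \<ge> 1"
    and le: "\<And>v y. \<bar>v - x\<bar> \<le> \<delta> \<Longrightarrow> y \<ge> y\<^sub>1 \<Longrightarrow> cond_tail \<kappa> v y \<le> C * y powr (- \<alpha> / 2)"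
    using tail_uniform_bound by metis
  show thesis
  proof (rule that[of "C * g_bound"])
    show "0 \<le> C * g_bound" using C g_bound_nonneg by simp
    show "\<forall>\<^sub>F n in sequentially. \<forall>i::nat.
     expectation (local_mass (h n) {u n * A' * exp (real i)<..} 0) \<le> C * g_bound * exp (- (\<alpha> / 2) * real i) * h n"
      using eventually_u_ge[of "y\<^sub>1 / A'"] eventually_h_le[OF C(2)] eventually_h_le[of 1, OF zero_less_one]
    proof eventually_elim
      case (elim n)
      have a: "u n * A' \<ge> y\<^sub>1" using elim(1) A' by (simp add: field_simps)
      show ?case
      proof
        fix i :: nat
        have "expectation (local_mass (h n) {u n * A' * exp (real i)<..} 0) \<le> (C * exp (- (\<alpha> / 2) * real i)) * g_bound * h n"
        proof (rule expectation_local_mass_le)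
          fix v assume v: "\<bar>v - x\<bar> \<le> h n"
          have e1: "1 \<le> exp (real i)" by simp
          have "y\<^sub>1 * 1 \<le> u n * A' * exp (real i)" using a C e1 by (intro mult_mono) auto
          then have "cond_tail \<kappa> v (u n * A' * exp (real i)) \<le> C * (u n * A' * exp (real i)) powr (- \<alpha> / 2)"
            using v elim by (intro le) auto
          also have "\<dots> \<le> C * (exp (real i)) powr (- \<alpha> / 2)"
          proof (intro mult_left_mono powr_mono2')
            show "exp (real i) \<le> u n * A' * exp (real i)" using a C by simp
          qed (use C alpha_pos in auto)
          also have "(exp (real i)) powr (- \<alpha> / 2) = exp (- (\<alpha> / 2) * real i)" by (simp add: powr_def)
          finally show "measure (\<kappa> v) {u n * A' * exp (real i)<..} \<le> C * exp (- (\<alpha> / 2) * real i)"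
            by (simp add: cond_tail_eq)
        qed (use h_pos elim in auto)
        then show "expectation (local_mass (h n) {u n * A' * exp (real i)<..} 0) \<le> C * g_bound * exp (- (\<alpha> / 2) * real i) * h n"
          by (simp add: mult_ac)
      qed
    qed
  qed
qed

text \<open>
  Below the truncation level the joint exceedances at threshold \<open>A' u\<close> take over with weight \<open>T\<^sup>2\<close>.
  Above it there are \<open>r\<close> lags, each exponentially small in \<open>T\<close>, which explains the fourth limit
  assumed.
\<close>

lemma log_excess_sum_lim:
  assumes A': "A' > 0" and p: "\<forall>\<^sub>F n in sequentially. p n \<ge> 1"
    and lims: "(\<lambda>n. (real (T n))\<^sup>2 * (real (p n) * h n / tail_level n)) \<longlonglongrightarrow> 0"
      "(\<lambda>n. (real (T n))\<^sup>2 * (real (r n) * (h n * tail_level n))) \<longlonglongrightarrow> 0"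
      "(\<lambda>n. (real (T n))\<^sup>2 * (real (p n) powr (- \<eta> / 2) / (h n * tail_level n))) \<longlonglongrightarrow> 0"
      "(\<lambda>n. real (r n) * exp (- (\<alpha> / 4) * real (T n)) / tail_level n) \<longlonglongrightarrow> 0"
  defines "L \<equiv> \<lambda>n j. log_product (h n) (u n * A') (int j)"
  shows "\<forall>\<^sub>F n in sequentially. \<forall>j. integrable M (L n j)"
    and "(\<lambda>n. (\<Sum>j=1..r n. expectation (L n j) / (h n * tail_level n))) \<longlonglongrightarrow> 0"
proof -
  obtain Q where Q: "Q \<ge> 0" and sl: "\<forall>\<^sub>F n in sequentially. \<forall>i::nat.
     expectation (local_mass (h n) {u n * A' * exp (real i)<..} 0) \<le> Q * exp (- (\<alpha> / 2) * real i) * h n"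
    by (rule log_excess_slices[OF A'])
  have a2: "\<alpha> / 2 > 0" using alpha_pos by simp
  have ev: "\<forall>\<^sub>F n in sequentially. \<forall>j. integrable M (L n j) \<and> expectation (L n j)
     \<le> (real (T n))\<^sup>2 * joint_tail_mass n A' A' j
        + 2 * B * (Q * h n * exp (- (\<alpha> / 4) * real (T n)) * excess_series (\<alpha> / 2))"
    using sl eventually_u_ge[of 1]
  proof eventually_elim
    case (elim n)
    have a: "u n * A' > 0" using elim A' by simp
    have sl': "expectation (local_mass (h n) {u n * A' * exp (real i)<..} 0) \<le> Q * exp (- (\<alpha> / 2) * real i) * h n" for i :: nat
      using elim(1) by blast
    note LE = log_excess_product_expectation[OF a h_pos a2 Q sl']
    have c: "u n * A' = A' * u n" "- (\<alpha> / 2) / 2 = - (\<alpha> / 4)" by simp_all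
    show ?case
      unfolding L_def using LE(1) LE(2)[where T = "T n"] unfolding c by blast
  qed
  then show "\<forall>\<^sub>F n in sequentially. \<forall>j. integrable M (L n j)" by (auto elim: eventually_mono)
  define V where "V n = (\<Sum>j=1..r n. joint_tail_mass n A' A' j)" for n
  define R where "R n = (real (T n))\<^sup>2 * (V n / (h n * tail_level n))
      + 2 * B * Q * excess_series (\<alpha> / 2) * (real (r n) * exp (- (\<alpha> / 4) * real (T n)) / tail_level n)" for n
  have "R \<longlonglongrightarrow> 0 + 2 * B * Q * excess_series (\<alpha> / 2) * 0"
    unfolding R_def V_def by (intro tendsto_intros joint_exceedance_sum_lim[OF A' A' _ p lims(1-3)] lims(4)) simp
  then have R: "R \<longlonglongrightarrow> 0" by simp
  show "(\<lambda>n. (\<Sum>j=1..r n. expectation (L n j) / (h n * tail_level n))) \<longlonglongrightarrow> 0"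
  proof (rule Lim_null_comparison[OF _ R])
    show "\<forall>\<^sub>F n in sequentially. norm (\<Sum>j=1..r n. expectation (L n j) / (h n * tail_level n)) \<le> R n"
      using ev eventually_tail_level_pos
    proof eventually_elim
      case (elim n)
      have H: "h n * tail_level n > 0" using elim h_pos[of n] by simp
      define q where "q = 2 * B * (Q * h n * exp (- (\<alpha> / 4) * real (T n)) * excess_series (\<alpha> / 2))"
      have "(\<Sum>j=1..r n. expectation (L n j)) \<le> (\<Sum>j=1..r n. (real (T n))\<^sup>2 * joint_tail_mass n A' A' j + q)"
        unfolding q_def by (intro sum_mono) (use elim in blast)
      also have "\<dots> = (real (T n))\<^sup>2 * V n + real (r n) * q"
        by (simp add: V_def sum.distrib sum_distrib_left)
      finally have "(\<Sum>j=1..r n. expectation (L n j)) / (h n * tail_level n) \<le> ((real (T n))\<^sup>2 * V n + real (r n) * q) / (h n * tail_level n)"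
        using H by (intro divide_right_mono) auto
      also have "\<dots> = R n" unfolding R_def q_def using h_pos[of n] elim by (simp add: field_simps)
      finally have "(\<Sum>j=1..r n. expectation (L n j) / (h n * tail_level n)) \<le> R n" by (simp add: sum_divide_distrib)
      moreover have "0 \<le> (\<Sum>j=1..r n. expectation (L n j) / (h n * tail_level n))"
        using H by (intro sum_nonneg divide_nonneg_pos Bochner_Integration.integral_nonneg)
          (auto simp: L_def K_nonneg log_plus_nonneg)
      ultimately show ?case by simp
    qed
  qed
qed

text \<open>
  By stationarity the mean of the tail estimator is the normalised local mean, whose error is
  \<open>bias_rate\<close> times \<open>t powr (- \<alpha> / 2)\<close>: bounded on \<open>t \<ge> s\<^sub>0\<close> and integrable against \<open>dt / t\<close> on \<open>t \<ge> 1\<close>.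
\<close>

lemma tail_bias_limits:
  assumes u: "u = u_seq \<kappa> x k" and \<gamma>: "\<alpha> = 1 / \<gamma> x" and N: "\<And>n. N n \<ge> 0"
    and lim: "(\<lambda>n. sqrt (N n) * bias_rate n) \<longlonglongrightarrow> 0"
  defines "T \<equiv> tail_bias M K \<kappa> \<gamma> g x k h X Y"
  shows "s\<^sub>0 > 0 \<Longrightarrow> s\<^sub>0 \<le> 1 \<Longrightarrow> (\<lambda>n. sqrt (N n) * sup_tail_bias M K \<kappa> \<gamma> g x k h X Y n s\<^sub>0) \<longlonglongrightarrow> 0"
    and "\<forall>\<^sub>F n in sequentially. set_integrable lborel {1..} (\<lambda>t. T n t / t)"
    and "(\<lambda>n. sqrt (N n) * (LINT t:{1..}|lborel. T n t / t)) \<longlonglongrightarrow> 0"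
proof -
  have T: "T n t = tail_mass n t / (h n * tail_level n) - t powr (- \<alpha>) * g x"
    if n: "n \<ge> 1" for n t
  proof -
    have "(LINT \<omega>|M. tail_estimator K \<kappa> x k h X Y n t \<omega>)
        = expectation (\<lambda>\<omega>. 1 / (real n * h n * tail_level n) * (\<Sum>j=1..int n. local_mass (h n) {t * u n<..} j \<omega>))"
      unfolding tail_estimator_def kernel_weight_def local_mass_def tail_level_def u[symmetric] ..
    also have "\<dots> = 1 / (real n * h n * tail_level n) * (\<Sum>j=1..int n. expectation (local_mass (h n) {t * u n<..} j))"
      by simp
    also have "(\<Sum>j=1..int n. expectation (local_mass (h n) {t * u n<..} j)) = (\<Sum>j=1..int n. tail_mass n t)"
      by (intro sum.cong refl expectation_local_mass_shift) simp
    also have "1 / (real n * h n * tail_level n) * \<dots> = tail_mass n t / (h n * tail_level n)"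
      using n by simp
    finally show ?thesis unfolding T_def tail_bias_def \<gamma> by simp
  qed
  have bound: "\<exists>C>0. \<forall>\<^sub>F n in sequentially. \<forall>t\<ge>s\<^sub>0. \<bar>T n t\<bar> \<le> C * bias_rate n * t powr (- \<alpha> / 2)" if s0: "0 < s\<^sub>0" "s\<^sub>0 \<le> 1" for s\<^sub>0
  proof -
    obtain C where C: "C > 0" "\<forall>\<^sub>F n in sequentially. \<forall>t\<ge>s\<^sub>0.
       \<bar>tail_mass n t / (h n * tail_level n) - t powr (- \<alpha>) * g x\<bar>
         \<le> C * bias_rate n * t powr (- \<alpha> / 2)"
      by (rule local_tail_mean[OF s0])
    have "\<forall>\<^sub>F n in sequentially. \<forall>t\<ge>s\<^sub>0. \<bar>T n t\<bar> \<le> C * bias_rate n * t powr (- \<alpha> / 2)"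
      using C(2) eventually_ge_at_top[of 1] by eventually_elim (simp add: T)
    then show ?thesis using C(1) by blast
  qed
  have cmp: "(\<lambda>n. sqrt (N n) * f n) \<longlonglongrightarrow> 0" if "\<forall>\<^sub>F n in sequentially. \<bar>f n\<bar> \<le> C * bias_rate n" for f C
  proof (rule Lim_null_comparison)
    show "(\<lambda>n. C * (sqrt (N n) * bias_rate n)) \<longlonglongrightarrow> 0" using tendsto_mult_right_zero[OF lim] by simp
    show "\<forall>\<^sub>F n in sequentially. norm (sqrt (N n) * f n) \<le> C * (sqrt (N n) * bias_rate n)"
      using that
    proof eventually_elim
      case (elim n)
      then show ?case using mult_left_mono[OF elim, of "sqrt (N n)"] N[of n] by (simp add: abs_mult mult_ac)
    qed
  qed
  show "(\<lambda>n. sqrt (N n) * sup_tail_bias M K \<kappa> \<gamma> g x k h X Y n s\<^sub>0) \<longlonglongrightarrow> 0" if s0: "s\<^sub>0 > 0" "s\<^sub>0 \<le> 1"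
  proof -
    obtain C where C: "C > 0" "\<forall>\<^sub>F n in sequentially. \<forall>t\<ge>s\<^sub>0. \<bar>T n t\<bar> \<le> C * bias_rate n * t powr (- \<alpha> / 2)"
      using bound[OF s0] by blast
    have rate: "\<forall>\<^sub>F n in sequentially. bias_rate n \<ge> 0"
      using eventually_u_ge[of 1] by eventually_elim (use h_pos in \<open>auto simp: bias_rate_def less_imp_le\<close>)
    show ?thesis
    proof (rule cmp)
      show "\<forall>\<^sub>F n in sequentially. \<bar>sup_tail_bias M K \<kappa> \<gamma> g x k h X Y n s\<^sub>0\<bar> \<le> (C * s\<^sub>0 powr (- \<alpha> / 2)) * bias_rate n"
        using C(2) rate
      proof eventually_elim
        case (elim n)
        have le: "\<bar>T n t\<bar> \<le> C * s\<^sub>0 powr (- \<alpha> / 2) * bias_rate n" if t: "t \<in> {s\<^sub>0..}" for t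
        proof -
          have "t powr (- \<alpha> / 2) \<le> s\<^sub>0 powr (- \<alpha> / 2)" by (rule powr_mono2') (use s0 t alpha_pos in auto)
          then have "C * bias_rate n * t powr (- \<alpha> / 2) \<le> C * bias_rate n * s\<^sub>0 powr (- \<alpha> / 2)"
            using C elim by (intro mult_left_mono) auto
          then show ?thesis using elim(1) t by (fastforce simp: mult_ac)
        qed
        have "sup_tail_bias M K \<kappa> \<gamma> g x k h X Y n s\<^sub>0 = (SUP t\<in>{s\<^sub>0..}. \<bar>T n t\<bar>)"
          by (simp add: sup_tail_bias_def T_def)
        moreover have "(SUP t\<in>{s\<^sub>0..}. \<bar>T n t\<bar>) \<le> C * s\<^sub>0 powr (- \<alpha> / 2) * bias_rate n"
          by (rule cSUP_least) (use le in auto)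
        moreover have "0 \<le> (SUP t\<in>{s\<^sub>0..}. \<bar>T n t\<bar>)"
          by (rule cSUP_upper2[of _ _ s\<^sub>0]) (use le in \<open>auto intro!: bdd_aboveI2\<close>)
        ultimately show ?case by simp
      qed
    qed
  qed
  obtain C where C: "C > 0" and Cb: "\<forall>\<^sub>F n in sequentially. \<forall>t\<ge>1. \<bar>T n t\<bar> \<le> C * bias_rate n * t powr (- \<alpha> / 2)"
    using bound[of 1] by auto
  have a2: "\<alpha> / 2 > 0" using alpha_pos by simp
  note P = set_integrable_powr_atLeast_1[OF a2]
  have main: "\<forall>\<^sub>F n in sequentially. set_integrable lborel {1..} (\<lambda>t. T n t / t)
      \<and> \<bar>LINT t:{1..}|lborel. T n t / t\<bar> \<le> (C * (2 / \<alpha>)) * bias_rate n"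
    using Cb eventually_ge_at_top[of 1] eventually_u_ge[of 1]
  proof eventually_elim
    case (elim n)
    \<comment> \<open>measurability of the bias in \<open>t\<close> comes from monotonicity\<close>
    have "mono (\<lambda>t. - tail_mass n t)"
    proof (rule monoI)
      fix t t' :: real assume tt: "t \<le> t'"
      have "t * u n \<le> t' * u n" using tt elim by (intro mult_right_mono) auto
      then have "tail_mass n t' \<le> tail_mass n t"
        by (intro integral_mono) (auto simp: local_mass_def indicator_def K_nonneg)
      then show "- tail_mass n t \<le> - tail_mass n t'" by simp
    qed
    then have "(\<lambda>t. - (- tail_mass n t)) \<in> borel_measurable borel"
      by (intro borel_measurable_uminus borel_measurable_mono)
    then have [measurable]: "(\<lambda>t. tail_mass n t) \<in> borel_measurable borel" by simp
    have [measurable]: "T n \<in> borel_measurable borel" unfolding T[OF elim(2), abs_def] by measurable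
    define q where "q t = C * bias_rate n * t powr (- (\<alpha> / 2) - 1)" for t :: real
    have q: "set_integrable lborel {1..} q" unfolding q_def[abs_def] by (rule set_integrable_mult_right) (rule P(1))
    have iq: "(LINT t:{1..}|lborel. q t) = C * bias_rate n * (2 / \<alpha>)"
      unfolding q_def[abs_def] by (simp add: P(2))
    have le: "\<bar>T n t / t\<bar> \<le> q t" if t: "t \<in> {1..}" for t
    proof -
      have "\<bar>T n t / t\<bar> = \<bar>T n t\<bar> / t" using t by simp
      also have "\<dots> \<le> C * bias_rate n * t powr (- \<alpha> / 2) / t" using elim(1) t by (intro divide_right_mono) auto
      also have "\<dots> = q t" using t by (simp add: q_def powr_diff)
      finally show ?thesis .
    qed
    have i: "set_integrable lborel {1..} (\<lambda>t. T n t / t)"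
      unfolding set_integrable_def
    proof (rule Bochner_Integration.integrable_bound[OF q[unfolded set_integrable_def]])
      show "AE t in lborel. norm (indicator {1..} t *\<^sub>R (T n t / t)) \<le> norm (indicator {1..} t *\<^sub>R q t)"
        by (rule AE_I2) (use order_trans[OF le abs_ge_self] in \<open>auto simp: indicator_def\<close>)
    qed measurable
    have "\<bar>LINT t:{1..}|lborel. T n t / t\<bar> \<le> (LINT t|lborel. \<bar>indicator {1..} t *\<^sub>R (T n t / t)\<bar>)"
      unfolding set_lebesgue_integral_def by (rule integral_abs_bound)
    also have "\<dots> \<le> (LINT t:{1..}|lborel. q t)"
      unfolding set_lebesgue_integral_def
    proof (rule integral_mono)
      show "integrable lborel (\<lambda>t. \<bar>indicator {1..} t *\<^sub>R (T n t / t)\<bar>)"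
        using i unfolding set_integrable_def by (rule integrable_abs)
      show "integrable lborel (\<lambda>t. indicator {1..} t *\<^sub>R q t)" using q unfolding set_integrable_def .
      show "\<bar>indicator {1..} t *\<^sub>R (T n t / t)\<bar> \<le> indicator {1..} t *\<^sub>R q t" for t
        using le[of t] by (auto simp: indicator_def)
    qed
    finally show ?case using i iq by (simp add: mult_ac)
  qed
  then show "\<forall>\<^sub>F n in sequentially. set_integrable lborel {1..} (\<lambda>t. T n t / t)" by (auto elim: eventually_mono)
  show "(\<lambda>n. sqrt (N n) * (LINT t:{1..}|lborel. T n t / t)) \<longlonglongrightarrow> 0"
    by (rule cmp, rule eventually_mono[OF main]) (erule conjunct2)
qed

end

section \<open>Choice of the tuning sequences\<close>

lemma log_powr_bounded_tendsto_0:
  assumes e: "e > 0" and bound: "\<And>n. n \<ge> 1 \<Longrightarrow> \<bar>f n\<bar> \<le> C * (1 + ln (real n))\<^sup>2 * real n powr (- e)"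
  shows "f \<longlonglongrightarrow> 0"
proof (rule Lim_null_comparison)
  have "(\<lambda>n. (1 + ln (real n))\<^sup>2 * real n powr (- e)) \<longlonglongrightarrow> 0" using e by real_asymp
  then show "(\<lambda>n. C * ((1 + ln (real n))\<^sup>2 * real n powr (- e))) \<longlonglongrightarrow> 0" by (rule tendsto_mult_right_zero)
  show "\<forall>\<^sub>F n in sequentially. norm (f n) \<le> C * ((1 + ln (real n))\<^sup>2 * real n powr (- e))"
    using eventually_ge_at_top[of 1] by eventually_elim (use bound in \<open>simp add: mult.assoc\<close>)
qed

lemma powr_bounded_tendsto_0:
  assumes e: "e > 0" and bound: "\<And>n. n \<ge> 1 \<Longrightarrow> \<bar>f n\<bar> \<le> C * real n powr (- e)"
  shows "f \<longlonglongrightarrow> 0"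
proof (rule Lim_null_comparison)
  show "(\<lambda>n. C * real n powr (- e)) \<longlonglongrightarrow> 0" by (rule tendsto_mult_right_zero[OF powr_neg_tendsto_0[OF e]])
  show "\<forall>\<^sub>F n in sequentially. norm (f n) \<le> C * real n powr (- e)"
    using eventually_ge_at_top[of 1] by eventually_elim (use bound in simp)
qed

text \<open>
  The constraints on the exponents, with bandwidth \<open>n powr (- (1 - a - e))\<close> and level \<open>n powr (- a)\<close>:
  \<open>e \<le> a \<sigma>\<close> makes the second-order bias, of order \<open>n powr (- a \<sigma>)\<close>, negligible against
  \<open>sqrt (k h)\<close>, of order \<open>n powr (e / 2)\<close>; the
  inequality with \<open>2 / \<eta>\<close> says that \<open>p h\<close> is negligible against the level when \<open>p\<close> is of order
  \<open>n powr (2 / \<eta>)\<close>; the one with \<open>\<nu>\<close> says that blocks of length \<open>n powr (1 - 2 e)\<close> separated by gaps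
  \<open>n powr (1 - 3 e)\<close> are asymptotically independent. All of them hold if \<open>a\<close> is small in terms of
  \<open>\<eta>\<close>, and \<open>e\<close> is small in terms of \<open>a\<close>, \<open>\<eta>\<close>, \<open>\<nu>\<close> and \<open>\<sigma>\<close>.
\<close>

lemma tuning_exponents:
  fixes \<eta> \<nu> \<sigma> :: real
  assumes \<eta>: "\<eta> > 2" and \<nu>: "\<nu> > 0" and \<sigma>: "\<sigma> > 0"
  obtains a e where "0 < a" "a < 1 / 4" "0 < e" "e \<le> 1 / 8" "e \<le> a * \<sigma>" "0 < 1 - 2 * a - e - 2 / \<eta>"
    "2 * e < \<nu> * (1 - 3 * e)"
proof -
  define q where "q = 1 - 2 / \<eta>"
  have q: "0 < q" "q < 1" using \<eta> by (auto simp: q_def field_simps)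
  define a where "a = q / 4"
  define e where "e = min (min (q / 4) (a * \<sigma>)) (min (\<nu> / 8) (1 / 8))"
  have a: "0 < a" "a < 1 / 4" using q by (auto simp: a_def)
  have e: "0 < e" "e \<le> q / 4" "e \<le> a * \<sigma>" "e \<le> \<nu> / 8" "e \<le> 1 / 8"
    using q a \<nu> \<sigma> by (auto simp: e_def)
  have "2 / \<eta> = 1 - q" by (simp add: q_def)
  then have "0 < 1 - 2 * a - e - 2 / \<eta>" using q e(2) unfolding a_def by linarith
  moreover have "\<nu> * (5 / 8) \<le> \<nu> * (1 - 3 * e)" using \<nu> e by (intro mult_left_mono) auto
  then have "2 * e < \<nu> * (1 - 3 * e)" using e(4) \<nu> by linarith
  ultimately show thesis using that a e by blast
qed

text \<open>
  The limits that the probabilistic estimates ask for, with \<open>p\<close> the lag at which a sum is split and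
  \<open>T\<close> the truncation level of the log-excesses.
\<close>

locale tuning =
  fixes \<eta> \<nu> \<sigma> \<alpha> :: real and k r l :: "nat \<Rightarrow> nat" and h :: "nat \<Rightarrow> real" and p T :: "nat \<Rightarrow> nat"
  assumes intermediate: "intermediate k" "intermediate r" "intermediate l"
    and bandwidth_pos: "\<And>n. h n > 0" and bandwidth_lim: "h \<longlonglongrightarrow> 0" "(\<lambda>n. h n * ln (real n)) \<longlonglongrightarrow> 0"
    and sample_lim: "filterlim (\<lambda>n. real (k n) * h n) at_top sequentially"
    and k_between: "\<forall>\<^sub>F n in sequentially. 0 < k n \<and> k n < n"
    and p_ge_1: "\<forall>\<^sub>F n in sequentially. p n \<ge> 1" and T_ge_1: "\<forall>\<^sub>F n in sequentially. T n \<ge> 1"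
    and near: "(\<lambda>n. (real (T n))\<^sup>2 * (real (p n) * h n / (real (k n) / real n))) \<longlonglongrightarrow> 0"
    and independent: "(\<lambda>n. (real (T n))\<^sup>2 * (real (r n) * (h n * (real (k n) / real n)))) \<longlonglongrightarrow> 0"
    and far: "(\<lambda>n. (real (T n))\<^sup>2 * (real (p n) powr (- \<eta> / 2) / (h n * (real (k n) / real n)))) \<longlonglongrightarrow> 0"
    and excess: "(\<lambda>n. real (r n) * exp (- (\<alpha> / 4) * real (T n)) / (real (k n) / real n)) \<longlonglongrightarrow> 0"
    and block_mass: "(\<lambda>n. real (r n) * (h n * (real (k n) / real n))) \<longlonglongrightarrow> 0"
    and variance_near: "(\<lambda>n. real (p n) * h n) \<longlonglongrightarrow> 0"
    and variance_far: "(\<lambda>n. real (p n) powr (- \<eta> / 2) / h n) \<longlonglongrightarrow> 0"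
    and density_bias: "(\<lambda>n. real (k n) * h n * (h n)\<^sup>2) \<longlonglongrightarrow> 0"
    and covariate_bias: "(\<lambda>n. sqrt (real (k n) * h n) * (h n * ln (real n))) \<longlonglongrightarrow> 0"
    and second_order_bias: "(\<lambda>n. sqrt (real (k n) * h n) * (real (k n) / real n) powr \<sigma>) \<longlonglongrightarrow> 0"
    and gap_over_block: "(\<lambda>n. real (l n) / real (r n)) \<longlonglongrightarrow> 0"
    and coupling: "(\<lambda>n. real n / real (r n) * real (l n) powr (- \<nu>)) \<longlonglongrightarrow> 0"

text \<open>
  For rounded powers of \<open>n\<close> each quantity in question is, up to a factor \<open>(1 + ln n)\<^sup>2\<close>, bounded by a
  negative power of \<open>n\<close>.
\<close>

lemma tuning_exists:
  fixes \<eta> \<nu> \<sigma> \<alpha> :: real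
  assumes \<eta>: "\<eta> > 2" and \<nu>: "\<nu> > 0" and \<sigma>: "\<sigma> > 0" and \<alpha>: "\<alpha> > 0"
  obtains k r l h p T where "tuning \<eta> \<nu> \<sigma> \<alpha> k r l h p T"
proof -
  obtain a e where a: "0 < a" "a < 1 / 4" and e: "0 < e" "e \<le> 1 / 8" "e \<le> a * \<sigma>"
    and gap: "0 < 1 - 2 * a - e - 2 / \<eta>" and gap_beta: "2 * e < \<nu> * (1 - 3 * e)"
    using tuning_exponents[OF \<eta> \<nu> \<sigma>] by metis
  define c where "c = 2 / \<eta>"
  define \<beta> where "\<beta> = 1 - a - e"
  have c: "0 < c" "c * (\<eta> / 2) = 1" and \<beta>: "\<beta> > 1 / 2" "\<beta> < 1" using \<eta> a e by (auto simp: c_def \<beta>_def)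
  define k where "k = floor_powr (1 - a)"
  define r where "r = floor_powr (1 - 2 * e)"
  define l where "l = floor_powr (1 - 3 * e)"
  define p where "p = floor_powr c"
  \<comment> \<open>\<open>0 powr z = 0\<close>, so \<open>n = 0\<close> needs a separate value to keep \<open>h\<close> positive\<close>
  define h where "h n = (if n = 0 then 1 else real n powr (- \<beta>))" for n :: nat
  \<comment> \<open>the factor 12 turns \<open>exp (- \<alpha> / 4 * T)\<close> into \<open>n powr (- 3)\<close>, which beats the number of lags over the level\<close>
  define T where "T n = nat \<lceil>12 / \<alpha> * ln (real n)\<rceil>" for n :: nat
  define \<phi> where "\<phi> n = real (k n) / real n" for n :: nat
  define D where "D = 12 / \<alpha> + 1"
  have D0: "D > 0" using \<alpha> by (simp add: D_def add_pos_pos)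
  have ev1: "\<forall>\<^sub>F n in sequentially. n \<ge> (1::nat)" by (rule eventually_ge_at_top)
  have bounds: "h n = real n powr (- \<beta>)" "real n powr (1 - a) / 2 \<le> real (k n)" "real (k n) \<le> real n powr (1 - a)"
    "real (r n) \<le> real n powr (1 - 2 * e)" "real n powr (1 - 2 * e) / 2 \<le> real (r n)"
    "real (l n) \<le> real n powr (1 - 3 * e)" "real n powr (1 - 3 * e) / 2 \<le> real (l n)"
    "real (p n) \<le> real n powr c" "real n powr c / 2 \<le> real (p n)"
    "\<phi> n \<le> real n powr (- a)" "real n powr (- a) / 2 \<le> \<phi> n"
    "real (T n) \<le> D * (1 + ln (real n))" "exp (- (\<alpha> / 4) * real (T n)) \<le> real n powr (- 3)"
    "real (p n) powr (- \<eta> / 2) \<le> 2 powr (\<eta> / 2) * real n powr (- 1)"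
    "real (l n) powr (- \<nu>) \<le> 2 powr \<nu> * real n powr (- (\<nu> * (1 - 3 * e)))"
    "0 \<le> ln (real n)"
    if n: "n \<ge> 1" for n
  proof -
    have N: "real n > 0" using n by simp
    show "h n = real n powr (- \<beta>)" using n by (simp add: h_def)
    show k: "real n powr (1 - a) / 2 \<le> real (k n)" "real (k n) \<le> real n powr (1 - a)"
      unfolding k_def using floor_powr_bounds(1,2)[OF n, of "1 - a"] a by simp_all
    show "real (r n) \<le> real n powr (1 - 2 * e)" "real n powr (1 - 2 * e) / 2 \<le> real (r n)"
      unfolding r_def using floor_powr_bounds(1,2)[OF n, of "1 - 2 * e"] e by simp_all
    show l: "real (l n) \<le> real n powr (1 - 3 * e)" "real n powr (1 - 3 * e) / 2 \<le> real (l n)"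
      unfolding l_def using floor_powr_bounds(1,2)[OF n, of "1 - 3 * e"] e by simp_all
    show p: "real (p n) \<le> real n powr c" "real n powr c / 2 \<le> real (p n)"
      unfolding p_def using floor_powr_bounds(1,2)[OF n, of "c"] c by simp_all
    have dv: "real n powr (1 - a) = real n * real n powr (- a)" using N by (simp add: powr_diff powr_minus divide_inverse)
    show "\<phi> n \<le> real n powr (- a)" "real n powr (- a) / 2 \<le> \<phi> n"
      using k N unfolding \<phi>_def dv by (simp_all add: field_simps)
    show ln0: "0 \<le> ln (real n)" using n by simp
    have tc: "12 / \<alpha> * ln (real n) \<le> real (T n)" unfolding T_def by linarith
    have "0 \<le> 12 / \<alpha> * ln (real n)" using \<alpha> ln0 by simp
    then have "real (T n) \<le> 12 / \<alpha> * ln (real n) + 1" unfolding T_def by linarith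
    also have "\<dots> \<le> D * (1 + ln (real n))"
    proof -
      have "D * (1 + ln (real n)) = (12 / \<alpha> * ln (real n) + 1) + (12 / \<alpha> + ln (real n))"
        by (simp add: D_def ring_distribs)
      moreover have "0 \<le> 12 / \<alpha> + ln (real n)" using \<alpha> ln0 by simp
      ultimately show ?thesis by linarith
    qed
    finally show "real (T n) \<le> D * (1 + ln (real n))" .
    have "\<alpha> / 4 * (12 / \<alpha> * ln (real n)) \<le> \<alpha> / 4 * real (T n)" by (rule mult_left_mono[OF tc]) (use \<alpha> in simp)
    then have "- (\<alpha> / 4) * real (T n) \<le> - 3 * ln (real n)" using \<alpha> by simp
    then show "exp (- (\<alpha> / 4) * real (T n)) \<le> real n powr (- 3)" using N by (simp add: powr_def)
    have "real (p n) powr (- \<eta> / 2) \<le> (real n powr c / 2) powr (- \<eta> / 2)"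
      by (rule powr_mono2') (use p N \<eta> in auto)
    also have "\<dots> = 2 powr (\<eta> / 2) * real n powr (- (c * (\<eta> / 2)))"
      by (simp add: powr_divide powr_powr powr_minus_divide)
    finally show "real (p n) powr (- \<eta> / 2) \<le> 2 powr (\<eta> / 2) * real n powr (- 1)" unfolding c .
    have "real (l n) powr (- \<nu>) \<le> (real n powr (1 - 3 * e) / 2) powr (- \<nu>)"
      by (rule powr_mono2') (use l N \<nu> in auto)
    also have "\<dots> = 2 powr \<nu> * real n powr (- (\<nu> * (1 - 3 * e)))"
      by (simp add: powr_divide powr_powr powr_minus_divide mult.commute)
    finally show "real (l n) powr (- \<nu>) \<le> 2 powr \<nu> * real n powr (- (\<nu> * (1 - 3 * e)))" .
  qed
  note b = bounds
  have hpos: "h n > 0" for n by (simp add: h_def)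
  have pos: "0 < real n powr z" if "n \<ge> 1" for n :: nat and z using that by simp
  have \<phi>0: "\<phi> n > 0" if n: "n \<ge> 1" for n using b(11)[OF n] pos[OF n, of "- a"] by linarith
  have T2: "\<bar>(real (T n))\<^sup>2 * f\<bar> \<le> D\<^sup>2 * C * (1 + ln (real n))\<^sup>2 * real n powr (- z)"
    if n: "n \<ge> 1" and f: "0 \<le> f" "f \<le> C * real n powr (- z)" for n f C z
  proof -
    have "(real (T n))\<^sup>2 \<le> (D * (1 + ln (real n)))\<^sup>2" using b(12)[OF n] by (intro power_mono) auto
    then have "(real (T n))\<^sup>2 * f \<le> (D * (1 + ln (real n)))\<^sup>2 * (C * real n powr (- z))"
      using f by (intro mult_mono) auto
    then show ?thesis using f(1) by (simp add: power_mult_distrib mult_ac)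
  qed
  have near: "0 \<le> real (p n) * h n / \<phi> n" "real (p n) * h n / \<phi> n \<le> 2 * real n powr (- (1 - 2 * a - e - 2 / \<eta>))" if n: "n \<ge> 1" for n
  proof -
    show "0 \<le> real (p n) * h n / \<phi> n" using hpos[of n] \<phi>0[OF n] by simp
    have "real (p n) * h n / \<phi> n \<le> real n powr c * real n powr (- \<beta>) / (real n powr (- a) / 2)"
      unfolding b(1)[OF n] by (intro frac_le mult_right_mono b n) (use n in auto)
    also have "\<dots> = 2 * real n powr (c + - \<beta> - - a)" by (simp only: powr_add powr_diff) simp
    also have "c + - \<beta> - - a = - (1 - 2 * a - e - 2 / \<eta>)" by (simp add: \<beta>_def c_def)
    finally show "real (p n) * h n / \<phi> n \<le> 2 * real n powr (- (1 - 2 * a - e - 2 / \<eta>))" .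
  qed
  have indep: "0 \<le> real (r n) * (h n * \<phi> n)" "real (r n) * (h n * \<phi> n) \<le> 1 * real n powr (- e)" if n: "n \<ge> 1" for n
  proof -
    show "0 \<le> real (r n) * (h n * \<phi> n)" using hpos[of n] \<phi>0[OF n] by simp
    have "real (r n) * (h n * \<phi> n) \<le> real n powr (1 - 2 * e) * (real n powr (- \<beta>) * real n powr (- a))"
      unfolding b(1)[OF n] by (intro mult_mono b n) (use n \<phi>0[OF n] in auto)
    also have "\<dots> = real n powr (1 - 2 * e + (- \<beta> + - a))" by (simp only: powr_add)
    also have "1 - 2 * e + (- \<beta> + - a) = - e" by (simp add: \<beta>_def)
    finally show "real (r n) * (h n * \<phi> n) \<le> 1 * real n powr (- e)" by simp
  qed
  have far: "0 \<le> real (p n) powr (- \<eta> / 2) / (h n * \<phi> n)"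
    "real (p n) powr (- \<eta> / 2) / (h n * \<phi> n) \<le> (2 * 2 powr (\<eta> / 2)) * real n powr (- e)" if n: "n \<ge> 1" for n
  proof -
    show "0 \<le> real (p n) powr (- \<eta> / 2) / (h n * \<phi> n)" using hpos[of n] \<phi>0[OF n] by simp
    have "real (p n) powr (- \<eta> / 2) / (h n * \<phi> n) \<le> 2 powr (\<eta> / 2) * real n powr (- 1) / (real n powr (- \<beta>) * (real n powr (- a) / 2))"
      unfolding b(1)[OF n] by (intro frac_le mult_left_mono b n) (use n in auto)
    also have "\<dots> = (2 * 2 powr (\<eta> / 2)) * (real n powr (- 1) / (real n powr (- \<beta>) * real n powr (- a)))" by simp
    also have "real n powr (- 1) / (real n powr (- \<beta>) * real n powr (- a)) = real n powr (- 1 - (- \<beta> + - a))"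
      by (simp only: powr_diff powr_add)
    also have "- 1 - (- \<beta> + - a) = - e" by (simp add: \<beta>_def)
    finally show "real (p n) powr (- \<eta> / 2) / (h n * \<phi> n) \<le> (2 * 2 powr (\<eta> / 2)) * real n powr (- e)" .
  qed
  have kh: "0 \<le> real (k n) * h n" "real (k n) * h n \<le> real n powr e" "real n powr e / 2 \<le> real (k n) * h n" if n: "n \<ge> 1" for n
  proof -
    show "0 \<le> real (k n) * h n" using hpos[of n] by simp
    have e': "real n powr e = real n powr (1 - a) * real n powr (- \<beta>)"
      by (simp add: powr_add[symmetric] \<beta>_def)
    show "real (k n) * h n \<le> real n powr e" unfolding b(1)[OF n] e' by (intro mult_right_mono b n) auto
    have "real n powr (1 - a) / 2 * real n powr (- \<beta>) \<le> real (k n) * real n powr (- \<beta>)" by (intro mult_right_mono b n) auto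
    then show "real n powr e / 2 \<le> real (k n) * h n" unfolding b(1)[OF n] e' by simp
  qed
  have skh: "sqrt (real (k n) * h n) \<le> real n powr (e / 2)" if n: "n \<ge> 1" for n
  proof -
    have "sqrt (real (k n) * h n) \<le> sqrt (real n powr e)" using kh[OF n] by simp
    also have "\<dots> = real n powr (e / 2)" by (simp add: powr_half_sqrt[symmetric] powr_powr)
    finally show ?thesis .
  qed
  have hln: "\<bar>h n * ln (real n)\<bar> \<le> 1 * (1 + ln (real n))\<^sup>2 * real n powr (- \<beta>)" if n1: "n \<ge> 1" for n
  proof -
    have "ln (real n) \<le> (1 + ln (real n))\<^sup>2" using b(16)[OF n1] by (simp add: power2_eq_square algebra_simps)
    then have "ln (real n) * real n powr (- \<beta>) \<le> (1 + ln (real n))\<^sup>2 * real n powr (- \<beta>)"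
      by (rule mult_right_mono) simp
    then show ?thesis using b(1)[OF n1] b(16)[OF n1] by (simp add: abs_mult mult.commute)
  qed
  show thesis
  proof (rule that[of k r l h p T], unfold_locales)
    show "intermediate k" unfolding k_def using a by (intro intermediate_floor_powr) auto
    show "intermediate r" unfolding r_def using e by (intro intermediate_floor_powr) auto
    show "intermediate l" unfolding l_def using e by (intro intermediate_floor_powr) auto
    show "h n > 0" for n by (rule hpos)
    show "h \<longlonglongrightarrow> 0"
      by (rule powr_bounded_tendsto_0[where e = \<beta> and C = 1]) (use \<beta> b(1) in auto)
    show "(\<lambda>n. h n * ln (real n)) \<longlonglongrightarrow> 0" by (rule log_powr_bounded_tendsto_0[OF _ hln]) (use \<beta> in simp)
    show "filterlim (\<lambda>n. real (k n) * h n) at_top sequentially"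
    proof (rule filterlim_at_top_mono)
      show "filterlim (\<lambda>n. real n powr e / 2) at_top sequentially" using e by real_asymp
      show "\<forall>\<^sub>F n in sequentially. real n powr e / 2 \<le> real (k n) * h n" by (rule eventually_mono[OF ev1 kh(3)])
    qed
    have "\<forall>\<^sub>F n in sequentially. \<phi> n < 1"
    proof -
      have "\<phi> \<longlonglongrightarrow> 0"
        by (rule powr_bounded_tendsto_0[where e = a and C = 1]) (use a b(10) \<phi>0 in \<open>auto simp: less_imp_le\<close>)
      then show ?thesis by (rule order_tendstoD) simp
    qed
    then show "\<forall>\<^sub>F n in sequentially. 0 < k n \<and> k n < n"
      using ev1 by eventually_elim (use \<phi>0 in \<open>force simp: \<phi>_def field_simps\<close>)
    show "\<forall>\<^sub>F n in sequentially. p n \<ge> 1"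
      by (rule eventually_mono[OF ev1]) (unfold p_def, rule floor_powr_bounds(3), use c in auto)
    show "\<forall>\<^sub>F n in sequentially. T n \<ge> 1"
      using eventually_ge_at_top[of 2]
    proof eventually_elim
      case (elim n)
      then have "0 < 12 / \<alpha> * ln (real n)" using \<alpha> by simp
      then show ?case unfolding T_def by linarith
    qed
    show "(\<lambda>n. (real (T n))\<^sup>2 * (real (p n) * h n / (real (k n) / real n))) \<longlonglongrightarrow> 0"
      unfolding \<phi>_def[symmetric]
      by (rule log_powr_bounded_tendsto_0[OF gap], rule T2[OF _ near])
    show "(\<lambda>n. (real (T n))\<^sup>2 * (real (r n) * (h n * (real (k n) / real n)))) \<longlonglongrightarrow> 0"
      unfolding \<phi>_def[symmetric]
      by (rule log_powr_bounded_tendsto_0[OF e(1)], rule T2[OF _ indep])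
    show "(\<lambda>n. (real (T n))\<^sup>2 * (real (p n) powr (- \<eta> / 2) / (h n * (real (k n) / real n)))) \<longlonglongrightarrow> 0"
      unfolding \<phi>_def[symmetric]
      by (rule log_powr_bounded_tendsto_0[OF e(1)], rule T2[OF _ far])
    show "(\<lambda>n. real (r n) * exp (- (\<alpha> / 4) * real (T n)) / (real (k n) / real n)) \<longlonglongrightarrow> 0"
      unfolding \<phi>_def[symmetric]
    proof (rule powr_bounded_tendsto_0[where e = "2 - a + 2 * e" and C = 2])
      fix n :: nat assume n1: "n \<ge> 1"
      have "real (r n) * exp (- (\<alpha> / 4) * real (T n)) / \<phi> n \<le> real n powr (1 - 2 * e) * real n powr (- 3) / (real n powr (- a) / 2)"
        by (intro frac_le mult_mono b n1) (use n1 in auto)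
      also have "\<dots> = 2 * real n powr (1 - 2 * e + - 3 - - a)" by (simp only: powr_add powr_diff) simp
      also have "1 - 2 * e + - 3 - - a = - (2 - a + 2 * e)" by simp
      finally show "\<bar>real (r n) * exp (- (\<alpha> / 4) * real (T n)) / \<phi> n\<bar> \<le> 2 * real n powr (- (2 - a + 2 * e))" using \<phi>0[OF n1] by simp
    qed (use a e in simp)
    show "(\<lambda>n. real (r n) * (h n * (real (k n) / real n))) \<longlonglongrightarrow> 0"
      unfolding \<phi>_def[symmetric]
      by (rule powr_bounded_tendsto_0[OF e(1), where C = 1]) (use indep in \<open>simp add: abs_of_nonneg\<close>)
    show "(\<lambda>n. real (p n) * h n) \<longlonglongrightarrow> 0"
    proof (rule powr_bounded_tendsto_0[where e = "\<beta> - c" and C = 1])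
      show "\<beta> - c > 0" using gap a by (simp add: \<beta>_def c_def)
      fix n :: nat assume n1: "n \<ge> 1"
      have "real (p n) * h n \<le> real n powr c * real n powr (- \<beta>)" unfolding b(1)[OF n1] by (intro mult_right_mono b n1) auto
      also have "\<dots> = real n powr (- (\<beta> - c))" by (simp add: powr_add[symmetric])
      finally show "\<bar>real (p n) * h n\<bar> \<le> 1 * real n powr (- (\<beta> - c))" using hpos[of n] by simp
    qed
    show "(\<lambda>n. real (p n) powr (- \<eta> / 2) / h n) \<longlonglongrightarrow> 0"
    proof (rule powr_bounded_tendsto_0[where e = "1 - \<beta>" and C = "2 powr (\<eta> / 2)"])
      fix n :: nat assume n1: "n \<ge> 1"
      have "real (p n) powr (- \<eta> / 2) / h n \<le> 2 powr (\<eta> / 2) * real n powr (- 1) / real n powr (- \<beta>)"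
        unfolding b(1)[OF n1] by (intro divide_right_mono b n1) auto
      also have "\<dots> = 2 powr (\<eta> / 2) * real n powr (- 1 - - \<beta>)" by (simp only: powr_diff times_divide_eq_right)
      also have "- 1 - - \<beta> = - (1 - \<beta>)" by simp
      finally show "\<bar>real (p n) powr (- \<eta> / 2) / h n\<bar> \<le> 2 powr (\<eta> / 2) * real n powr (- (1 - \<beta>))" using hpos[of n] by simp
    qed (use \<beta> in simp)
    show "(\<lambda>n. real (k n) * h n * (h n)\<^sup>2) \<longlonglongrightarrow> 0"
    proof (rule powr_bounded_tendsto_0[where e = "2 * \<beta> - e" and C = 1])
      show "2 * \<beta> - e > 0" using \<beta> e by linarith
      fix n :: nat assume n1: "n \<ge> 1"
      have "real (k n) * h n * (h n)\<^sup>2 \<le> real n powr e * (real n powr (- \<beta>))\<^sup>2"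
        using kh(2)[OF n1] unfolding b(1)[OF n1] by (rule mult_right_mono) simp
      also have "\<dots> = real n powr (- (2 * \<beta> - e))" by (simp add: power2_eq_square powr_add[symmetric])
      finally show "\<bar>real (k n) * h n * (h n)\<^sup>2\<bar> \<le> 1 * real n powr (- (2 * \<beta> - e))" using hpos[of n] by simp
    qed
    show "(\<lambda>n. sqrt (real (k n) * h n) * (h n * ln (real n))) \<longlonglongrightarrow> 0"
    proof (rule log_powr_bounded_tendsto_0[where e = "\<beta> - e / 2" and C = 1])
      show "\<beta> - e / 2 > 0" using \<beta> e by linarith
      fix n :: nat assume n1: "n \<ge> 1"
      have "\<bar>sqrt (real (k n) * h n) * (h n * ln (real n))\<bar> = sqrt (real (k n) * h n) * \<bar>h n * ln (real n)\<bar>"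
        using kh(1)[OF n1] by (simp add: abs_mult)
      also have "\<dots> \<le> real n powr (e / 2) * (1 * (1 + ln (real n))\<^sup>2 * real n powr (- \<beta>))"
        by (intro mult_mono skh hln n1) auto
      also have "\<dots> = 1 * (1 + ln (real n))\<^sup>2 * (real n powr (e / 2) * real n powr (- \<beta>))" by simp
      also have "real n powr (e / 2) * real n powr (- \<beta>) = real n powr (- (\<beta> - e / 2))" by (simp add: powr_add[symmetric])
      finally show "\<bar>sqrt (real (k n) * h n) * (h n * ln (real n))\<bar> \<le> 1 * (1 + ln (real n))\<^sup>2 * real n powr (- (\<beta> - e / 2))" .
    qed
    show "(\<lambda>n. sqrt (real (k n) * h n) * (real (k n) / real n) powr \<sigma>) \<longlonglongrightarrow> 0"
      unfolding \<phi>_def[symmetric]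
    proof (rule powr_bounded_tendsto_0[where e = "a * \<sigma> - e / 2" and C = 1])
      show "a * \<sigma> - e / 2 > 0" using e by linarith
      fix n :: nat assume n1: "n \<ge> 1"
      have "sqrt (real (k n) * h n) * \<phi> n powr \<sigma> \<le> real n powr (e / 2) * (real n powr (- a)) powr \<sigma>"
        by (intro mult_mono skh n1 powr_mono2 b) (use \<sigma> \<phi>0[OF n1] kh(1)[OF n1] in auto)
      also have "\<dots> = real n powr (- (a * \<sigma> - e / 2))" by (simp add: powr_powr powr_add[symmetric])
      finally show "\<bar>sqrt (real (k n) * h n) * \<phi> n powr \<sigma>\<bar> \<le> 1 * real n powr (- (a * \<sigma> - e / 2))" using kh(1)[OF n1] by simp
    qed
    show "(\<lambda>n. real (l n) / real (r n)) \<longlonglongrightarrow> 0"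
    proof (rule powr_bounded_tendsto_0[OF e(1), where C = 2])
      fix n :: nat assume n1: "n \<ge> 1"
      have "real (l n) / real (r n) \<le> real n powr (1 - 3 * e) / (real n powr (1 - 2 * e) / 2)"
        by (intro frac_le b n1) (use n1 in auto)
      also have "\<dots> = 2 * real n powr (1 - 3 * e - (1 - 2 * e))" by (simp only: powr_diff) simp
      also have "1 - 3 * e - (1 - 2 * e) = - e" by simp
      finally show "\<bar>real (l n) / real (r n)\<bar> \<le> 2 * real n powr (- e)" by simp
    qed
    show "(\<lambda>n. real n / real (r n) * real (l n) powr (- \<nu>)) \<longlonglongrightarrow> 0"
    proof (rule powr_bounded_tendsto_0[where e = "\<nu> * (1 - 3 * e) - 2 * e" and C = "2 * 2 powr \<nu>"])
      show "\<nu> * (1 - 3 * e) - 2 * e > 0" using gap_beta by simp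
      fix n :: nat assume n1: "n \<ge> 1"
      have "real n / real (r n) * real (l n) powr (- \<nu>) \<le> (real n powr 1 / (real n powr (1 - 2 * e) / 2)) * (2 powr \<nu> * real n powr (- (\<nu> * (1 - 3 * e))))"
        by (intro mult_mono frac_le b n1) (use n1 in auto)
      also have "\<dots> = 2 * 2 powr \<nu> * (real n powr 1 / real n powr (1 - 2 * e) * real n powr (- (\<nu> * (1 - 3 * e))))" by simp
      also have "real n powr 1 / real n powr (1 - 2 * e) * real n powr (- (\<nu> * (1 - 3 * e))) = real n powr (1 - (1 - 2 * e) + - (\<nu> * (1 - 3 * e)))"
        by (simp only: powr_add powr_diff)
      also have "1 - (1 - 2 * e) + - (\<nu> * (1 - 3 * e)) = - (\<nu> * (1 - 3 * e) - 2 * e)" by simp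
      finally show "\<bar>real n / real (r n) * real (l n) powr (- \<nu>)\<bar> \<le> 2 * 2 powr \<nu> * real n powr (- (\<nu> * (1 - 3 * e) - 2 * e))" by simp
    qed
  qed
qed

section \<open>From the model assumptions to the moment estimates\<close>

lemma twice_cont_diff_locally_lipschitz:
  assumes "twice_cont_diff g"
  obtains G where "G \<ge> 0" "\<And>v. \<bar>v - x\<bar> \<le> 1 \<Longrightarrow> \<bar>g v - g x\<bar> \<le> G * \<bar>v - x\<bar>" "g \<in> borel_measurable borel"
proof -
  obtain g' g'' where g: "\<And>u. (g has_real_derivative g' u) (at u)" "\<And>u. (g' has_real_derivative g'' u) (at u)"
    using assms unfolding twice_cont_diff_def by blast
  have "continuous_on {x - 1..x + 1} g'"
    by (rule DERIV_continuous_on) (rule has_field_derivative_at_within[OF g(2)])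
  then have "compact (g' ` {x - 1..x + 1})" by (intro compact_continuous_image) auto
  then obtain G where G: "\<And>v. v \<in> {x - 1..x + 1} \<Longrightarrow> norm (g' v) \<le> G"
    using compact_imp_bounded by (force simp: bounded_iff)
  show thesis
  proof (rule that)
    show "G \<ge> 0" using G[of x] norm_ge_zero[of "g' x"] by (simp del: norm_ge_zero)
    show "\<bar>g v - g x\<bar> \<le> G * \<bar>v - x\<bar>" if "\<bar>v - x\<bar> \<le> 1" for v
    proof -
      have "norm (g v - g x) \<le> G * norm (v - x)"
        by (rule field_differentiable_bound[of "{x - 1..x + 1}" g g'])
           (use G that in \<open>auto intro: has_field_derivative_at_within[OF g(1)] simp: abs_le_iff\<close>)
      then show ?thesis by simp
    qed
    have "continuous_on UNIV g" by (rule DERIV_continuous_on) (rule g(1))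
    then show "g \<in> borel_measurable borel" by (rule borel_measurable_continuous_onI)
  qed
qed

text \<open>
  Mixing coefficients are at most 1, so a larger constant absorbs the finitely many lags at which
  the asymptotic bound does not hold yet.
\<close>

lemma alpha_coeff_le_powr:
  assumes M: "prob_space M" and O: "alpha_coeff M Z \<in> O(\<lambda>j. real j powr (- \<eta>))" and \<eta>: "\<eta> > 0"
  obtains A where "A \<ge> 0" "\<And>d. d \<ge> 1 \<Longrightarrow> alpha_coeff M Z d \<le> A * real d powr (- \<eta>)"
proof -
  interpret prob_space M by (rule M)
  have le1: "alpha_coeff M Z d \<le> 1" for d
    unfolding alpha_coeff_def
  proof (rule cSup_least)
    have "{} \<in> gen_events M Z J" for J unfolding gen_events_def by (rule sigma_sets.Empty)
    then show "{\<bar>prob (A \<inter> B) - prob A * prob B\<bar> |A B. A \<in> gen_events M Z {..0} \<and> B \<in> gen_events M Z {int d..}} \<noteq> {}"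
      by blast
    fix a assume "a \<in> {\<bar>prob (A \<inter> B) - prob A * prob B\<bar> |A B. A \<in> gen_events M Z {..0} \<and> B \<in> gen_events M Z {int d..}}"
    then obtain A B where a: "a = \<bar>prob (A \<inter> B) - prob A * prob B\<bar>" by blast
    have "0 \<le> prob A * prob B" "prob A * prob B \<le> 1" by (auto simp: mult_le_one)
    moreover have "0 \<le> prob (A \<inter> B)" "prob (A \<inter> B) \<le> 1" by auto
    ultimately show "a \<le> 1" unfolding a by linarith
  qed
  obtain C where C: "C > 0" "\<forall>\<^sub>F d in sequentially. norm (alpha_coeff M Z d) \<le> C * norm (real d powr (- \<eta>))"
    using landau_o.bigE[OF O] by blast
  then obtain N where N: "\<And>d. d \<ge> N \<Longrightarrow> \<bar>alpha_coeff M Z d\<bar> \<le> C * real d powr (- \<eta>)"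
    by (auto simp: eventually_sequentially)
  show thesis
  proof (rule that)
    show "C + real N powr \<eta> \<ge> 0" using C by simp
    fix d :: nat assume d: "d \<ge> 1"
    show "alpha_coeff M Z d \<le> (C + real N powr \<eta>) * real d powr (- \<eta>)"
    proof (cases "d \<ge> N")
      case True
      then have "alpha_coeff M Z d \<le> C * real d powr (- \<eta>)" using N[of d] by linarith
      also have "\<dots> \<le> (C + real N powr \<eta>) * real d powr (- \<eta>)" by (intro mult_right_mono) auto
      finally show ?thesis .
    next
      case False
      have "1 = real d powr \<eta> * real d powr (- \<eta>)" using d by (simp add: powr_add[symmetric])
      also have "\<dots> \<le> real N powr \<eta> * real d powr (- \<eta>)" using False \<eta> by (intro mult_right_mono powr_mono2) auto
      also have "\<dots> \<le> (C + real N powr \<eta>) * real d powr (- \<eta>)" using C by (intro mult_right_mono) auto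
      finally show ?thesis using le1[of d] by linarith
    qed
  qed
qed

context kernel_series begin

lemma cond_tail_u_seq:
  assumes "continuous_on UNIV (cond_cdf \<kappa> x)" "0 < k n" "k n < n"
  shows "cond_tail \<kappa> x (u_seq \<kappa> x k n) = real (k n) / real n"
proof -
  have eq: "cond_cdf \<kappa> x = cdf (\<kappa> x)" by (simp add: cond_cdf_def fun_eq_iff)
  have "cdf (\<kappa> x) (gen_inverse (cdf (\<kappa> x)) (1 - real (k n) / real n)) = 1 - real (k n) / real n"
    by (rule cdf_gen_inverse[OF cond_prob_space cond_sets]) (use assms in \<open>auto simp: eq divide_simps\<close>)
  then show ?thesis by (simp add: cond_tail_def u_seq_def eq)
qed

text \<open>
  For \<open>u \<in> U\<close> the factor \<open>L u\<close> is positive at every \<open>y > 0\<close>: it is positive for large \<open>y\<close>, and the tail,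
  being nonincreasing, cannot vanish earlier. So the logarithms in the hypothesis on \<open>L\<close> are
  those of positive numbers.
\<close>

lemma power_tail_family_cond_tail:
  assumes U: "open U" "x \<in> U" and \<gamma>: "\<And>u. u \<in> U \<Longrightarrow> \<gamma> u > 0" and slow: "\<And>u. u \<in> U \<Longrightarrow> slowly_varying (L u)"
    and rv: "\<And>u y. u \<in> U \<Longrightarrow> y > 0 \<Longrightarrow> cond_tail \<kappa> u y = L u y * y powr (- (1 / \<gamma> u))"
    and C1: "c\<^sub>\<gamma>-lipschitz_on U (\<lambda>u. 1 / \<gamma> u)" and c: "y\<^sub>0 > 1" "c\<^sub>L > 0"
    and C3: "\<And>u v y. u \<in> U \<Longrightarrow> v \<in> U \<Longrightarrow> y \<ge> y\<^sub>0 \<Longrightarrow> \<bar>(ln (L v y) - ln (L u y)) / ln y\<bar> \<le> c\<^sub>L * \<bar>v - u\<bar>"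
    and S: "c\<^sub>x > 0" "\<zeta>\<^sub>x * \<gamma> x > 1"
      "bdd_above ((\<lambda>t. t powr \<zeta>\<^sub>x * \<bar>cond_tail \<kappa> x t - c\<^sub>x * t powr (- (1 / \<gamma> x))\<bar>) ` {1..})"
  obtains d c D where "power_tail_family (cond_tail \<kappa>) x d c y\<^sub>0 (1 / \<gamma> x) \<zeta>\<^sub>x c\<^sub>x D"
proof -
  obtain \<epsilon> where \<epsilon>: "\<epsilon> > 0" "cball x \<epsilon> \<subseteq> U" using U by (metis open_contains_cball)
  have inU: "v \<in> U" if "\<bar>v - x\<bar> \<le> \<epsilon>" for v
    using \<epsilon>(2) that by (auto simp: dist_real_def abs_minus_commute)
  obtain D where D: "\<And>t. t \<ge> 1 \<Longrightarrow> t powr \<zeta>\<^sub>x * \<bar>cond_tail \<kappa> x t - c\<^sub>x * t powr (- (1 / \<gamma> x))\<bar> \<le> D"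
    using S(3) unfolding bdd_above_def by auto
  have cg: "c\<^sub>\<gamma> \<ge> 0" using C1 by (rule lipschitz_on_nonneg)
  have tpos: "cond_tail \<kappa> v y > 0" if v: "v \<in> U" and y: "y > 0" for v y
  proof -
    have "\<forall>\<^sub>F z in at_top. L v z > 0" using slow[OF v] by (simp add: slowly_varying_def)
    then obtain z where z: "z \<ge> y" "L v z > 0"
      using eventually_happens[OF eventually_conj[OF eventually_ge_at_top[of y]]] by force
    then have "cond_tail \<kappa> v z > 0" using rv[OF v, of z] y by simp
    then show ?thesis using cond_tail_antimono[OF z(1), of v] by linarith
  qed
  have Lpos: "L v y > 0" if v: "v \<in> U" and y: "y > 0" for v y
    using tpos[OF v y] rv[OF v y] y by (simp add: zero_less_mult_iff)
  show thesis
  proof (rule that[of \<epsilon> "c\<^sub>L + c\<^sub>\<gamma>" D], unfold_locales)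
    show "\<epsilon> > 0" "c\<^sub>L + c\<^sub>\<gamma> \<ge> 0" "y\<^sub>0 > 1" "c\<^sub>x > 0" using \<epsilon> c cg S by auto
    show "1 / \<gamma> x > 0" using \<gamma> U by simp
    show "\<zeta>\<^sub>x > 1 / \<gamma> x" using S \<gamma>[OF U(2)] by (simp add: field_simps)
    show "D \<ge> 0" using D[of 1] by (intro order_trans[OF _ D[of 1]]) auto
    show "cond_tail \<kappa> v y > 0" if "\<bar>v - x\<bar> \<le> \<epsilon>" "y \<ge> y\<^sub>0" for v y using tpos[OF inU] that c by simp
    show "\<bar>ln (cond_tail \<kappa> v y) - ln (cond_tail \<kappa> x y)\<bar> \<le> (c\<^sub>L + c\<^sub>\<gamma>) * \<bar>v - x\<bar> * ln y"
      if v: "\<bar>v - x\<bar> \<le> \<epsilon>" and y: "y \<ge> y\<^sub>0" for v y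
    proof -
      have y1: "y > 1" using y c by linarith
      then have ly: "ln y > 0" by simp
      have lnT: "ln (cond_tail \<kappa> w y) = ln (L w y) - 1 / \<gamma> w * ln y" if w: "w \<in> U" for w
        using rv[OF w, of y] Lpos[OF w, of y] y1 by (simp add: ln_mult ln_powr)
      have a: "\<bar>ln (L v y) - ln (L x y)\<bar> \<le> c\<^sub>L * \<bar>v - x\<bar> * ln y"
        using C3[OF U(2) inU[OF v] y] ly by (simp add: abs_divide divide_le_eq)
      have "\<bar>1 / \<gamma> v - 1 / \<gamma> x\<bar> \<le> c\<^sub>\<gamma> * \<bar>v - x\<bar>"
        using lipschitz_onD[OF C1 inU[OF v] U(2)] by (simp add: dist_real_def)
      then have "\<bar>1 / \<gamma> v - 1 / \<gamma> x\<bar> * ln y \<le> c\<^sub>\<gamma> * \<bar>v - x\<bar> * ln y" using ly by (intro mult_right_mono) auto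
      moreover have "\<bar>(1 / \<gamma> v - 1 / \<gamma> x) * ln y\<bar> = \<bar>1 / \<gamma> v - 1 / \<gamma> x\<bar> * ln y" using ly by (simp add: abs_mult)
      moreover have "ln (cond_tail \<kappa> v y) - ln (cond_tail \<kappa> x y)
          = (ln (L v y) - ln (L x y)) - (1 / \<gamma> v - 1 / \<gamma> x) * ln y"
        unfolding lnT[OF inU[OF v]] lnT[OF U(2)] by (simp add: algebra_simps)
      moreover have "(c\<^sub>L + c\<^sub>\<gamma>) * \<bar>v - x\<bar> * ln y = c\<^sub>L * \<bar>v - x\<bar> * ln y + c\<^sub>\<gamma> * \<bar>v - x\<bar> * ln y"
        by (simp add: algebra_simps)
      ultimately show ?thesis using a by linarith
    qed
    show "\<bar>cond_tail \<kappa> x y - c\<^sub>x * y powr (- (1 / \<gamma> x))\<bar> \<le> D * y powr (- \<zeta>\<^sub>x)" if "y \<ge> 1" for y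
      using D[OF that] that by (simp add: powr_minus field_simps)
  qed
qed

lemma quantiles_diverge:
  assumes pos: "\<And>y. y \<ge> y\<^sub>0 \<Longrightarrow> cond_tail \<kappa> x y > 0" and lim: "(\<lambda>n. cond_tail \<kappa> x (u n)) \<longlonglongrightarrow> 0"
  shows "filterlim u at_top sequentially"
  unfolding filterlim_at_top
proof
  fix z
  have "\<forall>\<^sub>F n in sequentially. cond_tail \<kappa> x (u n) < cond_tail \<kappa> x (max z y\<^sub>0)"
    using order_tendstoD(2)[OF lim pos] by simp
  then show "\<forall>\<^sub>F n in sequentially. z \<le> u n"
  proof eventually_elim
    case (elim n)
    then have "\<not> u n \<le> max z y\<^sub>0" using cond_tail_antimono[of "u n" "max z y\<^sub>0" x] by linarith
    then show ?case by simp
  qed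
qed

end

section \<open>Existence of suitable sequences\<close>

theorem theorem8:
  fixes M :: "'a measure"
    and X Y :: "int \<Rightarrow> 'a \<Rightarrow> real"
    and g \<gamma> K :: "real \<Rightarrow> real"
    and \<kappa> :: "real \<Rightarrow> real measure"
    and \<kappa>\<^sub>2 :: "nat \<Rightarrow> real \<times> real \<Rightarrow> (real \<times> real) measure"
    and L :: "real \<Rightarrow> real \<Rightarrow> real"
    and U :: "real set"
    and x \<eta> \<nu> c\<^sub>\<gamma> y\<^sub>0 c\<^sub>L c\<^sub>x \<zeta>\<^sub>x :: real
  assumes prob: "prob_space M"
    and rv_X: "\<And>j. X j \<in> borel_measurable M"
    and rv_Y: "\<And>j. Y j \<in> borel_measurable M"
    and Y_pos: "\<And>j \<omega>. \<omega> \<in> space M \<Longrightarrow> Y j \<omega> > 0"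
    and stationary: "strictly_stationary M (\<lambda>j \<omega>. (X j \<omega>, Y j \<omega>))"
    and g_nonneg: "\<And>u. g u \<ge> 0"
    and g_density: "distributed M lborel (X 0) (\<lambda>u. ennreal (g u))"
    and g_smooth: "twice_cont_diff g"
    and joint_densities: "bounded_joint_densities M X"
    and cond_law: "regular_cond_law M (X 0) (Y 0) \<kappa>"
    and cond_law2: "\<And>j. j \<ge> 1 \<Longrightarrow>
          regular_cond_law M (\<lambda>\<omega>. (X 0 \<omega>, X (int j) \<omega>)) (\<lambda>\<omega>. (Y 0 \<omega>, Y (int j) \<omega>)) (\<kappa>\<^sub>2 j)"
    and U_open: "open U"
    and x_in_U: "x \<in> U"
    and g_pos: "g x > 0"
    and gamma_pos: "\<And>u. u \<in> U \<Longrightarrow> \<gamma> u > 0"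
    and L_slow: "\<And>u. u \<in> U \<Longrightarrow> slowly_varying (L u)"
    and reg_var: "\<And>u y. u \<in> U \<Longrightarrow> y > 0 \<Longrightarrow> cond_tail \<kappa> u y = L u y * y powr (- (1 / \<gamma> u))"
    and kernel: "bounded_kernel K"
    and beta_mixing: "beta_coeff M (\<lambda>j \<omega>. (X j \<omega>, Y j \<omega>)) \<longlonglongrightarrow> 0"
    and eta: "\<eta> > 2"
    and alpha_rate: "alpha_coeff M (\<lambda>j \<omega>. (X j \<omega>, Y j \<omega>)) \<in> O(\<lambda>j. real j powr (- \<eta>))"
    and nu: "\<nu> > 0"
    and beta_rate: "beta_coeff M (\<lambda>j \<omega>. (X j \<omega>, Y j \<omega>)) \<in> O(\<lambda>j. real j powr (- \<nu>))"
    and Fx_cont: "continuous_on UNIV (cond_cdf \<kappa> x)"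
    and C1: "c\<^sub>\<gamma>-lipschitz_on U (\<lambda>u. 1 / \<gamma> u)"
    and C3_const: "y\<^sub>0 > 1" "c\<^sub>L > 0"
    and C3: "\<And>u v y. u \<in> U \<Longrightarrow> v \<in> U \<Longrightarrow> y \<ge> y\<^sub>0 \<Longrightarrow>
          \<bar>(ln (L v y) - ln (L u y)) / ln y\<bar> \<le> c\<^sub>L * \<bar>v - u\<bar>"
    and C6: "joint_exceedance_condition \<kappa> \<kappa>\<^sub>2 x"
    and C6': "joint_log_excess_condition \<kappa> \<kappa>\<^sub>2 x"
    and S_const: "c\<^sub>x > 0" "\<zeta>\<^sub>x * \<gamma> x > 1"
    and S: "bdd_above ((\<lambda>t. t powr \<zeta>\<^sub>x * \<bar>cond_tail \<kappa> x t - c\<^sub>x * t powr (- (1 / \<gamma> x))\<bar>) ` {1..})"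
  shows "\<exists>(k :: nat \<Rightarrow> nat) (h :: nat \<Rightarrow> real) (r :: nat \<Rightarrow> nat) (l :: nat \<Rightarrow> nat).
    intermediate k \<and> (\<forall>n. h n > 0) \<and> intermediate r \<and> intermediate l \<and>
    (let u = u_seq \<kappa> x k;
         Fu = (\<lambda>n. cond_tail \<kappa> x (u n));
         Kw = kernel_weight K x h X
     in
      (\<lambda>n. h n * ln (u n)) \<longlonglongrightarrow> 0 \<and>
      ((\<forall>\<^sub>F n in sequentially. real n * h n * Fu n = real (k n) * h n) \<and>
       filterlim (\<lambda>n. real n * h n * Fu n) at_top sequentially) \<and>
      ((\<forall>\<^sub>F n in sequentially. real (r n) * h n * Fu n = real (r n) * h n * real (k n) / real n) \<and>
       (\<lambda>n. real (r n) * h n * Fu n) \<longlonglongrightarrow> 0) \<and>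
      ((\<lambda>n. 1 / real (l n)) \<longlonglongrightarrow> 0 \<and>
       (\<lambda>n. real (l n) / real (r n)) \<longlonglongrightarrow> 0 \<and>
       (\<lambda>n. real (r n) / real n) \<longlonglongrightarrow> 0 \<and>
       (\<lambda>n. real n / real (r n) * beta_coeff M (\<lambda>j \<omega>. (X j \<omega>, Y j \<omega>)) (l n)) \<longlonglongrightarrow> 0) \<and>
      tends_to_zero_in_prob M
        (\<lambda>n \<omega>. sqrt (real (k n) * h n) * (g x - density_estimator K x h X n \<omega>)) \<and>
      (\<exists>s\<^sub>0\<in>{0<..<1}.
        (\<lambda>n. sqrt (real (k n) * h n) * sup_tail_bias M K \<kappa> \<gamma> g x k h X Y n s\<^sub>0) \<longlonglongrightarrow> 0) \<and>
      ((\<forall>\<^sub>F n in sequentially.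
          set_integrable lborel {1..} (\<lambda>t. tail_bias M K \<kappa> \<gamma> g x k h X Y n t / t)) \<and>
       (\<lambda>n. sqrt (real (k n) * h n) *
          (LINT t:{1..}|lborel. tail_bias M K \<kappa> \<gamma> g x k h X Y n t / t)) \<longlonglongrightarrow> 0) \<and>
      (\<forall>s>0. \<forall>t>0.
        (\<lambda>m. limsup (\<lambda>n. ereal (\<Sum>j=m..r n.
           (LINT \<omega>|M. Kw n 0 \<omega> * indicator {s * u n<..} (Y 0 \<omega>) *
                      Kw n (int j) \<omega> * indicator {t * u n<..} (Y (int j) \<omega>))
           / (h n * Fu n)))) \<longlonglongrightarrow> 0) \<and>
      (\<forall>A>0.
        (\<forall>\<^sub>F n in sequentially. \<forall>j\<ge>1.
           integrable M (\<lambda>\<omega>. Kw n 0 \<omega> * Kw n (int j) \<omega> *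
             log_plus (Y 0 \<omega> / (u n * A)) * log_plus (Y (int j) \<omega> / (u n * A)))) \<and>
        (\<lambda>m. limsup (\<lambda>n. ereal (\<Sum>j=m..r n.
           (LINT \<omega>|M. Kw n 0 \<omega> * Kw n (int j) \<omega> *
                      log_plus (Y 0 \<omega> / (u n * A)) * log_plus (Y (int j) \<omega> / (u n * A)))
           / (h n * Fu n)))) \<longlonglongrightarrow> 0))"
proof -
  obtain B where B: "B > 0" "\<And>z. K z \<le> B" by (rule bounded_kernelE[OF kernel], rule that)
  obtain G where G: "G \<ge> 0" "\<And>v. \<bar>v - x\<bar> \<le> 1 \<Longrightarrow> \<bar>g v - g x\<bar> \<le> G * \<bar>v - x\<bar>" "g \<in> borel_measurable borel"
    using twice_cont_diff_locally_lipschitz[OF g_smooth, of x] by metis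
  obtain J where J: "\<And>i j. i \<noteq> j \<Longrightarrow> \<exists>f. (\<forall>p. 0 \<le> f p \<and> f p \<le> J) \<and>
             distributed M (lborel \<Otimes>\<^sub>M lborel) (\<lambda>\<omega>. (X i \<omega>, X j \<omega>)) (\<lambda>p. ennreal (f p))"
    using joint_densities unfolding bounded_joint_densities_def by blast
  have J0: "J \<ge> 0" using J[of 0 1] by (force intro: order_trans)
  obtain A where A: "A \<ge> 0" "\<And>d. d \<ge> 1 \<Longrightarrow> alpha_coeff M (\<lambda>j \<omega>. (X j \<omega>, Y j \<omega>)) d \<le> A * real d powr (- \<eta>)"
  proof -
    have "\<eta> > 0" using eta by simp
    from alpha_coeff_le_powr[OF prob alpha_rate this] show thesis using that by metis
  qed
  interpret kernel_series M X Y g K \<kappa> x B J G A \<eta>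
    by (intro kernel_series.intro kernel_series_axioms.intro prob)
       (use rv_X rv_Y stationary g_nonneg g_density G J J0 cond_law kernel B eta A in auto)
  obtain d c D where ptf: "power_tail_family (cond_tail \<kappa>) x d c y\<^sub>0 (1 / \<gamma> x) \<zeta>\<^sub>x c\<^sub>x D"
    by (rule power_tail_family_cond_tail[OF U_open x_in_U gamma_pos L_slow reg_var C1 C3_const C3 S_const S])
  interpret power_tail_family "cond_tail \<kappa>" x d c y\<^sub>0 "1 / \<gamma> x" \<zeta>\<^sub>x c\<^sub>x D by (rule ptf)
  \<comment> \<open>\<open>u powr (- (\<zeta>\<^sub>x - 1 / \<gamma> x))\<close> is of the order of the \<open>\<sigma>\<close>-th power of the level \<open>k / n\<close>\<close>
  define \<sigma> where "\<sigma> = (\<zeta>\<^sub>x - 1 / \<gamma> x) / (1 / \<gamma> x)"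
  have \<sigma>: "\<sigma> > 0" using zeta_gt alpha_pos by (simp add: \<sigma>_def)
  obtain k r l h p T where tn: "tuning \<eta> \<nu> \<sigma> (1 / \<gamma> x) k r l h p T"
    by (rule tuning_exists[OF eta nu \<sigma> alpha_pos])
  interpret tn: tuning \<eta> \<nu> \<sigma> "1 / \<gamma> x" k r l h p T by (rule tn)
  note h = tn.bandwidth_pos
  define u where "u = u_seq \<kappa> x k"
  have level: "\<forall>\<^sub>F n in sequentially. cond_tail \<kappa> x (u n) = real (k n) / real n"
    using tn.k_between by eventually_elim (use cond_tail_u_seq[OF Fx_cont] in \<open>simp add: u_def\<close>)
  have k0: "(\<lambda>n. real (k n) / real n) \<longlonglongrightarrow> 0" using tn.intermediate(1) by (simp add: intermediate_def)
  have level0: "(\<lambda>n. cond_tail \<kappa> x (u n)) \<longlonglongrightarrow> 0"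
    by (rule Lim_transform_eventually[OF k0]) (use level in \<open>auto elim: eventually_mono\<close>)
  have u_top: "filterlim u at_top sequentially"
    by (rule quantiles_diverge[OF _ level0, of y\<^sub>0]) (use tail_pos[of x] d_pos in auto)
  obtain C\<^sub>q y\<^sub>1 where Cq: "C\<^sub>q > 0"
    "\<And>u \<phi>. u \<ge> y\<^sub>1 \<Longrightarrow> cond_tail \<kappa> x u = \<phi> \<Longrightarrow> u powr (- (\<zeta>\<^sub>x - 1 / \<gamma> x)) \<le> C\<^sub>q * \<phi> powr \<sigma>"
    "\<And>u N. u \<ge> y\<^sub>1 \<Longrightarrow> N \<ge> 2 * c\<^sub>x \<Longrightarrow> 1 / N \<le> cond_tail \<kappa> x u \<Longrightarrow> ln u \<le> 2 / (1 / \<gamma> x) * ln N"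
    unfolding \<sigma>_def using quantile_rates by metis
  have ev: "\<forall>\<^sub>F n in sequentially. cond_tail \<kappa> x (u n) = real (k n) / real n \<and> 0 < k n \<and> n \<ge> 1
      \<and> u n \<ge> 1 \<and> u n \<ge> y\<^sub>1 \<and> real n \<ge> 2 * c\<^sub>x"
  proof -
    have "\<forall>\<^sub>F n in sequentially. u n \<ge> max 1 y\<^sub>1" using u_top unfolding filterlim_at_top by blast
    moreover have "\<forall>\<^sub>F n in sequentially. real n \<ge> 2 * c\<^sub>x"
      using filterlim_real_sequentially unfolding filterlim_at_top by blast
    ultimately show ?thesis using level tn.k_between eventually_ge_at_top[of 1] by eventually_elim auto
  qed
  have lnu: "\<forall>\<^sub>F n in sequentially. 0 \<le> ln (u n) \<and> ln (u n) \<le> 2 * \<gamma> x * ln (real n)"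
    using ev
  proof eventually_elim
    case (elim n)
    have "1 / real n \<le> cond_tail \<kappa> x (u n)" using elim by (simp add: divide_right_mono)
    then show ?case using Cq(3)[of "u n" "real n"] elim by simp
  qed
  have hu: "(\<lambda>n. h n * ln (u n)) \<longlonglongrightarrow> 0"
  proof (rule Lim_null_comparison)
    show "(\<lambda>n. 2 * \<gamma> x * (h n * ln (real n))) \<longlonglongrightarrow> 0" by (rule tendsto_mult_right_zero[OF tn.bandwidth_lim(2)])
    show "\<forall>\<^sub>F n in sequentially. norm (h n * ln (u n)) \<le> 2 * \<gamma> x * (h n * ln (real n))"
      using lnu
    proof eventually_elim
      case (elim n)
      then have "h n * ln (u n) \<le> h n * (2 * \<gamma> x * ln (real n))" using h[of n] by (intro mult_left_mono) auto
      then show ?case using elim h[of n] by (simp add: abs_mult mult_ac)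
    qed
  qed
  interpret kernel_tail_series M X Y g K \<kappa> x B J G A \<eta> d c y\<^sub>0 "1 / \<gamma> x" \<zeta>\<^sub>x c\<^sub>x D h u
    by unfold_locales (use h tn.bandwidth_lim u_top hu in auto)
  have tl: "\<forall>\<^sub>F n in sequentially. real (k n) / real n = tail_level n"
    using level by (simp add: tail_level_def eq_commute)
  have transfer: "(\<lambda>n. f n (tail_level n)) \<longlonglongrightarrow> 0" if "(\<lambda>n. f n (real (k n) / real n)) \<longlonglongrightarrow> 0" for f :: "nat \<Rightarrow> real \<Rightarrow> real"
    by (rule Lim_transform_eventually[OF that]) (use tl in \<open>auto elim: eventually_mono\<close>)
  note near' = transfer[of "\<lambda>n t. (real (T n))\<^sup>2 * (real (p n) * h n / t)", OF tn.near]
  note indep' = transfer[of "\<lambda>n t. (real (T n))\<^sup>2 * (real (r n) * (h n * t))", OF tn.independent]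
  note far' = transfer[of "\<lambda>n t. (real (T n))\<^sup>2 * (real (p n) powr (- \<eta> / 2) / (h n * t))", OF tn.far]
  note excess' = transfer[of "\<lambda>n t. real (r n) * exp (- (1 / \<gamma> x / 4) * real (T n)) / t", OF tn.excess]
  note rh' = transfer[of "\<lambda>n t. real (r n) * (h n * t)", OF tn.block_mass]
  have bias: "(\<lambda>n. sqrt (real (k n) * h n) * bias_rate n) \<longlonglongrightarrow> 0"
  proof (rule Lim_null_comparison)
    have "(\<lambda>n. 2 * \<gamma> x * (sqrt (real (k n) * h n) * (h n * ln (real n)))
        + C\<^sub>q * (sqrt (real (k n) * h n) * (real (k n) / real n) powr \<sigma>)) \<longlonglongrightarrow> 2 * \<gamma> x * 0 + C\<^sub>q * 0"
      by (intro tendsto_intros tn.covariate_bias tn.second_order_bias)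
    then show "(\<lambda>n. 2 * \<gamma> x * (sqrt (real (k n) * h n) * (h n * ln (real n)))
        + C\<^sub>q * (sqrt (real (k n) * h n) * (real (k n) / real n) powr \<sigma>)) \<longlonglongrightarrow> 0" by simp
    show "\<forall>\<^sub>F n in sequentially. norm (sqrt (real (k n) * h n) * bias_rate n)
        \<le> 2 * \<gamma> x * (sqrt (real (k n) * h n) * (h n * ln (real n)))
        + C\<^sub>q * (sqrt (real (k n) * h n) * (real (k n) / real n) powr \<sigma>)"
      using ev lnu
    proof eventually_elim
      case (elim n)
      have "h n * ln (u n) \<le> h n * (2 * \<gamma> x * ln (real n))" using elim h[of n] by (intro mult_left_mono) auto
      moreover have "u n powr (- (\<zeta>\<^sub>x - 1 / \<gamma> x)) \<le> C\<^sub>q * (real (k n) / real n) powr \<sigma>" using Cq(2) elim by blast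
      ultimately have "bias_rate n \<le> 2 * \<gamma> x * (h n * ln (real n)) + C\<^sub>q * (real (k n) / real n) powr \<sigma>"
        unfolding bias_rate_def by (simp add: mult_ac)
      then have "sqrt (real (k n) * h n) * bias_rate n
          \<le> sqrt (real (k n) * h n) * (2 * \<gamma> x * (h n * ln (real n)) + C\<^sub>q * (real (k n) / real n) powr \<sigma>)"
        using h[of n] by (intro mult_left_mono) auto
      moreover have "0 \<le> bias_rate n" using elim h[of n] by (simp add: bias_rate_def)
      moreover have "0 \<le> sqrt (real (k n) * h n)" using h[of n] by simp
      ultimately show ?case by (simp add: abs_mult algebra_simps)
    qed
  qed
  have kh_nonneg: "0 \<le> real (k n) * h n" for n using h[of n] by simp
  note bias_limits = tail_bias_limits[where N = "\<lambda>n. real (k n) * h n" and k = k and \<gamma> = \<gamma>, OF u_def refl kh_nonneg bias]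
  have tl_nonneg: "0 \<le> tail_level n" for n by (simp add: tail_level_def cond_tail_nonneg)
  have pair_eq: "kernel_weight K x h X n 0 \<omega> * indicator {s * u n<..} (Y 0 \<omega>) *
        kernel_weight K x h X n (int j) \<omega> * indicator {t * u n<..} (Y (int j) \<omega>)
      = local_mass (h n) {s * u n<..} 0 \<omega> * local_mass (h n) {t * u n<..} (int j) \<omega>" for n s t j \<omega>
    by (simp add: kernel_weight_def local_mass_def mult.assoc)
  \<comment> \<open>the weighted limit gives the unweighted one, as \<open>T \<ge> 1\<close> eventually\<close>
  have joint_lim: "(\<lambda>n. \<Sum>j=1..r n. joint_tail_mass n s t j
      / (h n * tail_level n)) \<longlonglongrightarrow> 0" if "s > 0" "t > 0" for s t
  proof (rule Lim_null_comparison)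
    show "(\<lambda>n. (real (T n))\<^sup>2 * ((\<Sum>j=1..r n. joint_tail_mass n s t j)
      / (h n * tail_level n))) \<longlonglongrightarrow> 0"
      by (rule joint_exceedance_sum_lim[OF that _ tn.p_ge_1 near' indep' far']) simp
    show "\<forall>\<^sub>F n in sequentially. norm (\<Sum>j=1..r n. joint_tail_mass n s t j
      / (h n * tail_level n)) \<le> (real (T n))\<^sup>2 * ((\<Sum>j=1..r n. joint_tail_mass n s t j)
      / (h n * tail_level n))"
      using tn.T_ge_1
    proof eventually_elim
      case (elim n)
      define V where "V = (\<Sum>j=1..r n. joint_tail_mass n s t j) / (h n * tail_level n)"
      have "0 \<le> V" unfolding V_def using h[of n] tl_nonneg[of n]
        by (intro divide_nonneg_nonneg sum_nonneg Bochner_Integration.integral_nonneg) (auto simp: local_mass_bounds)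
      moreover have "1 \<le> (real (T n))\<^sup>2" using elim by (simp add: one_le_power)
      ultimately have "norm V \<le> (real (T n))\<^sup>2 * V" using mult_right_mono[of 1 "(real (T n))\<^sup>2" V] by simp
      then show ?case unfolding V_def by (simp only: sum_divide_distrib)
    qed
  qed
  note excess_lim = log_excess_sum_lim[OF _ tn.p_ge_1 near' indep' far' excess']
  obtain C\<^sub>\<beta> where C\<beta>: "\<forall>\<^sub>F j in sequentially. norm (beta_coeff M (\<lambda>j \<omega>. (X j \<omega>, Y j \<omega>)) j) \<le> C\<^sub>\<beta> * norm (real j powr (- \<nu>))"
    using landau_o.bigE[OF beta_rate] by blast
  have l_top: "filterlim l at_top sequentially" using tn.intermediate(3) by (simp add: intermediate_def)
  have beta_lim: "(\<lambda>n. real n / real (r n) * beta_coeff M (\<lambda>j \<omega>. (X j \<omega>, Y j \<omega>)) (l n)) \<longlonglongrightarrow> 0"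
  proof (rule Lim_null_comparison)
    show "(\<lambda>n. C\<^sub>\<beta> * (real n / real (r n) * real (l n) powr (- \<nu>))) \<longlonglongrightarrow> 0" by (rule tendsto_mult_right_zero[OF tn.coupling])
    show "\<forall>\<^sub>F n in sequentially. norm (real n / real (r n) * beta_coeff M (\<lambda>j \<omega>. (X j \<omega>, Y j \<omega>)) (l n))
        \<le> C\<^sub>\<beta> * (real n / real (r n) * real (l n) powr (- \<nu>))"
      using eventually_compose_filterlim[OF C\<beta> l_top]
    proof eventually_elim
      case (elim n)
      have "real n / real (r n) * norm (beta_coeff M (\<lambda>j \<omega>. (X j \<omega>, Y j \<omega>)) (l n)) \<le> real n / real (r n) * (C\<^sub>\<beta> * norm (real (l n) powr (- \<nu>)))"
        by (rule mult_left_mono[OF elim]) simp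
      then show ?case by (simp add: abs_mult mult_ac)
    qed
  qed
  have hF: "\<forall>\<^sub>F n in sequentially. real n * h n * tail_level n = real (k n) * h n"
    using tl eventually_ge_at_top[of 1] by eventually_elim (simp add: field_simps)
  show ?thesis
  proof (rule exI[of _ k], rule exI[of _ h], rule exI[of _ r], rule exI[of _ l],
      unfold Let_def, fold u_def, fold tail_level_def, intro conjI allI impI)
    show "intermediate k" "intermediate r" "intermediate l" by (fact tn.intermediate)+
    show "h n > 0" for n by (rule h)
    show "(\<lambda>n. h n * ln (u n)) \<longlonglongrightarrow> 0" by (rule hu)
    show "\<forall>\<^sub>F n in sequentially. real n * h n * tail_level n = real (k n) * h n" by (rule hF)
    show "filterlim (\<lambda>n. real n * h n * tail_level n) at_top sequentially"
      by (rule iffD2[OF filterlim_cong[OF refl refl hF] tn.sample_lim])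
    show "\<forall>\<^sub>F n in sequentially. real (r n) * h n * tail_level n = real (r n) * h n * real (k n) / real n"
      using tl by eventually_elim (simp flip: times_divide_eq_right)
    show "(\<lambda>n. real (r n) * h n * tail_level n) \<longlonglongrightarrow> 0" using rh' by (simp add: mult.assoc)
    show "(\<lambda>n. 1 / real (l n)) \<longlonglongrightarrow> 0"
      by (rule tendsto_divide_0[OF tendsto_const])
         (rule filterlim_at_top_imp_at_infinity[OF filterlim_compose[OF filterlim_real_sequentially l_top]])
    show "(\<lambda>n. real (l n) / real (r n)) \<longlonglongrightarrow> 0" by (rule tn.gap_over_block)
    show "(\<lambda>n. real (r n) / real n) \<longlonglongrightarrow> 0" using tn.intermediate(2) by (simp add: intermediate_def)
    show "(\<lambda>n. real n / real (r n) * beta_coeff M (\<lambda>j \<omega>. (X j \<omega>, Y j \<omega>)) (l n)) \<longlonglongrightarrow> 0" by (rule beta_lim)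
    show "tends_to_zero_in_prob M (\<lambda>n \<omega>. sqrt (real (k n) * h n) * (g x - density_estimator K x h X n \<omega>))"
    proof (rule density_estimator_consistent[OF h _ tn.p_ge_1 kh_nonneg _ tn.variance_near tn.variance_far tn.density_bias])
      show "\<forall>\<^sub>F n in sequentially. h n \<le> 1" by (rule eventually_h_le) simp
      show "(\<lambda>n. real (k n) * h n / (real n * h n)) \<longlonglongrightarrow> 0" using k0 h by (simp add: less_imp_neq[symmetric])
    qed
    show "\<exists>s\<^sub>0\<in>{0<..<1}. (\<lambda>n. sqrt (real (k n) * h n) * sup_tail_bias M K \<kappa> \<gamma> g x k h X Y n s\<^sub>0) \<longlonglongrightarrow> 0"
      by (rule bexI[of _ "1 / 2"]) (rule bias_limits(1), simp_all)
    show "\<forall>\<^sub>F n in sequentially. set_integrable lborel {1..} (\<lambda>t. tail_bias M K \<kappa> \<gamma> g x k h X Y n t / t)"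
      by (rule bias_limits(2))
    show "(\<lambda>n. sqrt (real (k n) * h n) * (LINT t:{1..}|lborel. tail_bias M K \<kappa> \<gamma> g x k h X Y n t / t)) \<longlonglongrightarrow> 0"
      by (rule bias_limits(3))
  next
    fix s t :: real assume "s > 0" "t > 0"
    then show "(\<lambda>m. limsup (\<lambda>n. ereal (\<Sum>j=m..r n.
           (LINT \<omega>|M. kernel_weight K x h X n 0 \<omega> * indicator {s * u n<..} (Y 0 \<omega>) *
                      kernel_weight K x h X n (int j) \<omega> * indicator {t * u n<..} (Y (int j) \<omega>))
           / (h n * tail_level n)))) \<longlonglongrightarrow> 0"
      unfolding pair_eq
      by (intro limsup_of_tail_sums joint_lim divide_nonneg_nonneg Bochner_Integration.integral_nonneg mult_nonneg_nonneg
          local_mass_bounds tl_nonneg less_imp_le[OF h])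
  next
    fix A' :: real assume A': "A' > 0"
    show "\<forall>\<^sub>F n in sequentially. \<forall>j\<ge>1. integrable M (\<lambda>\<omega>. kernel_weight K x h X n 0 \<omega> * kernel_weight K x h X n (int j) \<omega> *
             log_plus (Y 0 \<omega> / (u n * A')) * log_plus (Y (int j) \<omega> / (u n * A')))"
      unfolding kernel_weight_def using excess_lim(1)[OF A'] by (auto elim: eventually_mono)
    show "(\<lambda>m. limsup (\<lambda>n. ereal (\<Sum>j=m..r n.
           (LINT \<omega>|M. kernel_weight K x h X n 0 \<omega> * kernel_weight K x h X n (int j) \<omega> *
                      log_plus (Y 0 \<omega> / (u n * A')) * log_plus (Y (int j) \<omega> / (u n * A')))
           / (h n * tail_level n)))) \<longlonglongrightarrow> 0"
      unfolding kernel_weight_def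
      by (intro limsup_of_tail_sums excess_lim(2)[OF A'] divide_nonneg_nonneg Bochner_Integration.integral_nonneg
          mult_nonneg_nonneg K_nonneg log_plus_nonneg tl_nonneg less_imp_le[OF h])
  qed
qed

end
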